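(* Let $\sigma=\sigma_1+i\sigma_2\in\mathbb{C}$ with $\sigma_2>0$. For $(x,y)\in T^*G$ let $\iota:L_{(x,y)}=F_x\times(y+\mathfrak{t})\hookrightarrow T^*G\cong G\times\mathfrak{g}$ be the inclusion. Then $L_{(x,y)}$ is a symplectic submanifold of $(T^*G,\omega)$, and the distribution $\mathcal{P}^{\mathfrak{t}}_{0,\sigma}$ defines a Kähler structure along $L_{(x,y)}$ (that is, there is a complex structure on $L_{(x,y)}$ whose holomorphic tangent space is $\mathcal{P}^{\mathfrak{t}}_{0,\sigma}|_{L_{(x,y)}}$ and which together with $\iota^*\omega$ is Kähler). A global Kähler potential along $L_{(x,y)}$ is given by $$\kappa_{0,\sigma}=2\sigma_2\,(\iota^*f).$$
   Context: $G$ is a compact connected Lie group with Lie algebra $\mathfrak{g}$ carrying an $\mathrm{Ad}$-invariant inner product $\langle\cdot,\cdot\rangle$; $T\subset G$ is a maximal torus with Lie algebra $\mathfrak{t}$. Via left translation and the inner product, $T^*G\cong G\times\mathfrak{g}$ and $T_{(x,y)}(T^*G)\cong\mathfrak{g}\oplus\mathfrak{g}$, where $(U,V)$ is the velocity at $s=0$ of $s\mapsto(xe^{sU},y+sV)$. The canonical symplectic form is $\omega_{(x,y)}((U,V),(W,Z))=\langle U,Z\rangle-\langle V,W\rangle+\langle y,[U,W]\rangle$. $F:\mathfrak{g}\to\mathfrak{g}$ is a real linear self-adjoint map with image in $\mathfrak{t}$, $F|_{\mathfrak{t}^\perp}=0$ and $F|_{\mathfrak{t}}$ positive definite, and $f(x,y)=\frac12\langle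 y,Fy\rangle$ on $T^*G$. $F_x=xT\subset G$ denotes the fiber through $x$ of the principal bundle $p:G\to G/T$. The complex distribution $\mathcal{P}^{\mathfrak{t}}_{0,\sigma}\subset T(T^*G)\otimes\mathbb{C}$ is $$\mathcal{P}^{\mathfrak{t}}_{0,\sigma}|_{(x,y)}=\{(-\bar\sigma FA,A)\mid A\in\mathfrak{t}_{\mathbb{C}}\}.$$ A Kähler potential for $\iota^*\omega$ is a function $\kappa$ with $\iota^*\omega=i\partial\bar\partial\kappa$. *)

theory Defs
  imports "HOL-Analysis.Analysis" "HOL-Algebra.Coset"
begin

section \<open>Smooth manifolds modelled on linear subspaces\<close>

text \<open>
  Manifolds are subsets of a topological space, with the subspace topology, whose charts take
  values in a linear subspace \<open>E\<close> of a Euclidean space. Using subspaces rather than types as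
  model spaces allows the dimension to depend on parameters, and includes dimension 0.
\<close>

type_synonym ('p, 'e) chart = "'p set \<times> ('p \<Rightarrow> 'e)"

abbreviation chart_inv :: "('p, 'e) chart \<Rightarrow> 'e \<Rightarrow> 'p" where
  "chart_inv c \<equiv> inv_into (fst c) (snd c)"

abbreviation chart_image :: "('p, 'e) chart \<Rightarrow> 'e set" where
  "chart_image c \<equiv> snd c ` fst c"

text \<open>
  \<open>S\<close> is meant to be relatively open in the subspace \<open>E\<close>; then \<open>f' x\<close> is determined by \<open>f\<close> on
  the directions in \<open>E\<close>, and only these are used in the recursion.
\<close>
primrec k_smooth_on ::
  "nat \<Rightarrow> 'a::real_normed_vector set \<Rightarrow> 'a set \<Rightarrow> ('a \<Rightarrow> 'b::real_normed_vector) \<Rightarrow> bool" where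
  "k_smooth_on 0 E S f \<longleftrightarrow> continuous_on S f"
| "k_smooth_on (Suc k) E S f \<longleftrightarrow>
     (\<exists>f'. (\<forall>x\<in>S. (f has_derivative f' x) (at x within S)) \<and>
           (\<forall>v\<in>E. k_smooth_on k E S (\<lambda>x. f' x v)))"

definition smooth_on ::
  "'a::real_normed_vector set \<Rightarrow> 'a set \<Rightarrow> ('a \<Rightarrow> 'b::real_normed_vector) \<Rightarrow> bool" where
  "smooth_on E S f \<longleftrightarrow> (\<forall>k. k_smooth_on k E S f)"

definition dir_deriv :: "('a::real_normed_vector \<Rightarrow> 'b::real_normed_vector) \<Rightarrow> 'a \<Rightarrow> 'a \<Rightarrow> 'b" where
  "dir_deriv f z a = vector_derivative (\<lambda>s. f (z + s *\<^sub>R a)) (at 0)"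

definition is_chart ::
  "'p::topological_space set \<Rightarrow> 'e::euclidean_space set \<Rightarrow> ('p, 'e) chart \<Rightarrow> bool" where
  "is_chart M E c \<longleftrightarrow>
     openin (top_of_set M) (fst c) \<and> openin (top_of_set E) (chart_image c) \<and>
     homeomorphism (fst c) (chart_image c) (snd c) (chart_inv c)"

definition smooth_atlas ::
  "'p::topological_space set \<Rightarrow> 'e::euclidean_space set \<Rightarrow> ('p, 'e) chart set \<Rightarrow> bool" where
  "smooth_atlas M E \<A> \<longleftrightarrow>
     subspace E \<and> (\<forall>c\<in>\<A>. is_chart M E c) \<and> \<Union> (fst ` \<A>) = M \<and>
     (\<forall>c\<in>\<A>. \<forall>d\<in>\<A>. smooth_on E (snd c ` (fst c \<inter> fst d)) (snd d \<circ> chart_inv c))"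

definition smooth_map ::
  "'p::topological_space set \<Rightarrow> 'e::euclidean_space set \<Rightarrow> ('p, 'e) chart set \<Rightarrow>
   'q::topological_space set \<Rightarrow> ('q, 'f::euclidean_space) chart set \<Rightarrow> ('p \<Rightarrow> 'q) \<Rightarrow> bool" where
  "smooth_map M E \<A> N \<B> h \<longleftrightarrow>
     h ` M \<subseteq> N \<and> continuous_on M h \<and>
     (\<forall>c\<in>\<A>. \<forall>d\<in>\<B>. smooth_on E (snd c ` (fst c \<inter> h -` fst d)) (snd d \<circ> h \<circ> chart_inv c))"

definition prod_atlas ::
  "('p, 'e) chart set \<Rightarrow> ('q, 'f) chart set \<Rightarrow> ('p \<times> 'q, 'e \<times> 'f) chart set" where
  "prod_atlas \<A> \<B> = {(fst c \<times> fst d, map_prod (snd c) (snd d)) | c d. c \<in> \<A> \<and> d \<in> \<B>}"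

definition linear_atlas :: "'e set \<Rightarrow> ('e, 'e) chart set" where
  "linear_atlas E = {(E, id)}"

text \<open>
  An embedded submanifold is a subset which, in its subspace topology, carries a smooth structure
  making the inclusion a smooth immersion; such a structure is unique up to compatibility of
  atlases.
\<close>
definition embedded_submanifold ::
  "'p::topological_space set \<Rightarrow> ('p, 'e::euclidean_space) chart set \<Rightarrow>
   'p set \<Rightarrow> 'f::euclidean_space set \<Rightarrow> ('p, 'f) chart set \<Rightarrow> bool" where
  "embedded_submanifold M \<A> L K \<B> \<longleftrightarrow>
     smooth_atlas L K \<B> \<and> smooth_map L K \<B> M \<A> id \<and>
     (\<forall>c\<in>\<B>. \<forall>d\<in>\<A>. \<forall>z \<in> snd c ` (fst c \<inter> fst d). \<forall>a\<in>K.
        a \<noteq> 0 \<longrightarrow> dir_deriv (snd d \<circ> chart_inv c) z a \<noteq> 0)"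

section \<open>Symplectic and Kaehler submanifolds\<close>

text \<open>
  The ambient manifold is assumed to have a trivialised tangent bundle with fibre in \<open>'w\<close>:
  \<open>vel \<gamma>\<close> is the velocity at time 0 of a curve \<open>\<gamma>\<close>, as an element of the fibre, and a two-form is a
  family \<open>\<omega> p\<close> of bilinear forms on \<open>'w\<close>. Then \<open>frame vel c z a\<close> is the image of \<open>a\<close> under the
  differential of the inverse of the chart \<open>c\<close> of the submanifold, at \<open>z\<close>, and \<open>pullback\<close> is the
  coordinate expression of \<open>\<iota>\<^sup>*\<omega>\<close> in \<open>c\<close>.
\<close>

definition frame ::
  "((real \<Rightarrow> 'p) \<Rightarrow> 'w) \<Rightarrow> ('p, 'e::real_vector) chart \<Rightarrow> 'e \<Rightarrow> 'e \<Rightarrow> 'w" where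
  "frame vel c z a = vel (\<lambda>s. chart_inv c (z + s *\<^sub>R a))"

definition pullback ::
  "((real \<Rightarrow> 'p) \<Rightarrow> 'w) \<Rightarrow> ('p \<Rightarrow> 'w \<Rightarrow> 'w \<Rightarrow> real) \<Rightarrow>
   ('p, 'e::real_vector) chart \<Rightarrow> 'e \<Rightarrow> 'e \<Rightarrow> 'e \<Rightarrow> real" where
  "pullback vel \<omega> c z a b = \<omega> (chart_inv c z) (frame vel c z a) (frame vel c z b)"

text \<open>
  Symplectic forms on an open subset \<open>S\<close> of the linear space \<open>K\<close>. The closedness condition is the
  invariant formula for the exterior derivative on constant vector fields.
\<close>
definition symplectic_form_on ::
  "'e::euclidean_space set \<Rightarrow> 'e set \<Rightarrow> ('e \<Rightarrow> 'e \<Rightarrow> 'e \<Rightarrow> real) \<Rightarrow> bool" where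
  "symplectic_form_on K S \<Omega> \<longleftrightarrow>
     (\<forall>a\<in>K. \<forall>b\<in>K. smooth_on K S (\<lambda>z. \<Omega> z a b)) \<and>
     (\<forall>z\<in>S. \<forall>a\<in>K. \<forall>b\<in>K. \<forall>b'\<in>K. \<forall>r. \<Omega> z a (b + b') = \<Omega> z a b + \<Omega> z a b' \<and>
        \<Omega> z a (r *\<^sub>R b) = r * \<Omega> z a b) \<and>
     (\<forall>z\<in>S. \<forall>a\<in>K. \<forall>b\<in>K. \<Omega> z b a = - \<Omega> z a b) \<and>
     (\<forall>z\<in>S. \<forall>a\<in>K. \<forall>b\<in>K. \<forall>c\<in>K.
        dir_deriv (\<lambda>w. \<Omega> w b c) z a - dir_deriv (\<lambda>w. \<Omega> w a c) z b
          + dir_deriv (\<lambda>w. \<Omega> w a b) z c = 0) \<and>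
     (\<forall>z\<in>S. \<forall>a\<in>K. a \<noteq> 0 \<longrightarrow> (\<exists>b\<in>K. \<Omega> z a b \<noteq> 0))"

definition symplectic_submanifold ::
  "((real \<Rightarrow> 'p) \<Rightarrow> 'w) \<Rightarrow> 'p::topological_space set \<Rightarrow> ('p, 'e::euclidean_space) chart set \<Rightarrow>
   ('p \<Rightarrow> 'w \<Rightarrow> 'w \<Rightarrow> real) \<Rightarrow> 'p set \<Rightarrow> bool" where
  "symplectic_submanifold vel M \<A> \<omega> L \<longleftrightarrow>
     (\<exists>(K::'e set) \<B>. embedded_submanifold M \<A> L K \<B> \<and>
        (\<forall>c\<in>\<B>. symplectic_form_on K (chart_image c) (pullback vel \<omega> c)))"

text \<open>
  The complexification of a real vector space \<open>'v\<close> is \<open>'v \<times> 'v\<close>, where \<open>(a, b)\<close> stands for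
  \<open>a + \<i> b\<close>, with the following multiplication by complex scalars.
\<close>
definition cscale :: "complex \<Rightarrow> 'v::real_vector \<times> 'v \<Rightarrow> 'v \<times> 'v" where
  "cscale \<zeta> w = (Re \<zeta> *\<^sub>R fst w - Im \<zeta> *\<^sub>R snd w, Re \<zeta> *\<^sub>R snd w + Im \<zeta> *\<^sub>R fst w)"

text \<open>Complex manifolds are modelled on complex linear subspaces \<open>V\<close> of a complexification.\<close>
definition holomorphic_atlas ::
  "'p::topological_space set \<Rightarrow> ('v::euclidean_space \<times> 'v) set \<Rightarrow>
   ('p, 'v \<times> 'v) chart set \<Rightarrow> bool" where
  "holomorphic_atlas M V \<C> \<longleftrightarrow>
     smooth_atlas M V \<C> \<and> (\<forall>\<zeta>. \<forall>a\<in>V. cscale \<zeta> a \<in> V) \<and>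
     (\<forall>c\<in>\<C>. \<forall>d\<in>\<C>. \<forall>z \<in> snd c ` (fst c \<inter> fst d). \<forall>a\<in>V.
        dir_deriv (snd d \<circ> chart_inv c) z (cscale \<i> a)
          = cscale \<i> (dir_deriv (snd d \<circ> chart_inv c) z a))"

text \<open>
  In a holomorphic chart the complex structure on tangent spaces is \<open>cscale \<i>\<close>. A Kaehler form is
  a symplectic form that is invariant under it and whose associated symmetric form
  \<open>(a, b) \<mapsto> \<Omega> z a (\<i> b)\<close> is positive definite. The condition
  \<open>embedded_submanifold M \<A> L V \<C>\<close> says that the complex structure is one on the smooth manifold
  \<open>L\<close>, as its underlying smooth structure is the submanifold structure.
\<close>
definition kaehler_submanifold ::
  "((real \<Rightarrow> 'p) \<Rightarrow> 'w) \<Rightarrow> 'p::topological_space set \<Rightarrow> ('p, 'e::euclidean_space) chart set \<Rightarrow>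
   ('p \<Rightarrow> 'w \<Rightarrow> 'w \<Rightarrow> real) \<Rightarrow> 'p set \<Rightarrow>
   ('v::euclidean_space \<times> 'v) set \<Rightarrow> ('p, 'v \<times> 'v) chart set \<Rightarrow> bool" where
  "kaehler_submanifold vel M \<A> \<omega> L V \<C> \<longleftrightarrow>
     embedded_submanifold M \<A> L V \<C> \<and> holomorphic_atlas L V \<C> \<and>
     (\<forall>c\<in>\<C>. symplectic_form_on V (chart_image c) (pullback vel \<omega> c)) \<and>
     (\<forall>c\<in>\<C>. \<forall>z\<in>chart_image c. \<forall>a\<in>V. \<forall>b\<in>V.
        pullback vel \<omega> c z (cscale \<i> a) (cscale \<i> b) = pullback vel \<omega> c z a b) \<and>
     (\<forall>c\<in>\<C>. \<forall>z\<in>chart_image c. \<forall>a\<in>V. a \<noteq> 0 \<longrightarrow> 0 < pullback vel \<omega> c z a (cscale \<i> a))"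

text \<open>
  The vectors \<open>X - \<i> J X\<close>, with \<open>X\<close> tangent to \<open>L\<close>; the pair \<open>(X, Y)\<close> stands for \<open>X + \<i> Y\<close>.
\<close>
definition holomorphic_tangent_space ::
  "((real \<Rightarrow> 'p) \<Rightarrow> 'w::real_vector) \<Rightarrow> ('v::real_vector \<times> 'v) set \<Rightarrow> ('p, 'v \<times> 'v) chart \<Rightarrow>
   'v \<times> 'v \<Rightarrow> ('w \<times> 'w) set" where
  "holomorphic_tangent_space vel V c z =
     {(frame vel c z a, - frame vel c z (cscale \<i> a)) | a. a \<in> V}"

definition dz ::
  "('v::real_normed_vector \<times> 'v \<Rightarrow> complex) \<Rightarrow> 'v \<times> 'v \<Rightarrow> 'v \<times> 'v \<Rightarrow> complex" where
  "dz h z a = (dir_deriv h z a - \<i> * dir_deriv h z (cscale \<i> a)) / 2"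

definition dzbar ::
  "('v::real_normed_vector \<times> 'v \<Rightarrow> complex) \<Rightarrow> 'v \<times> 'v \<Rightarrow> 'v \<times> 'v \<Rightarrow> complex" where
  "dzbar h z a = (dir_deriv h z a + \<i> * dir_deriv h z (cscale \<i> a)) / 2"

text \<open>
  The two-form \<open>\<partial>\<beta>\<close> for \<open>\<beta> = dzbar h\<close>, evaluated on constant vectors \<open>a\<close> and \<open>b\<close>. In coordinates
  \<open>\<beta> = \<Sum>j. \<beta>\<^sub>j dzbar\<^sub>j\<close> and \<open>\<partial>\<beta> = \<Sum>j. \<partial>\<beta>\<^sub>j \<and> dzbar\<^sub>j\<close>, with \<open>\<partial>\<beta>\<^sub>j \<and> dzbar\<^sub>j\<close> antisymmetrised
  without a factor \<open>1/2\<close>.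
\<close>
definition d_dbar ::
  "('v::real_normed_vector \<times> 'v \<Rightarrow> complex) \<Rightarrow> 'v \<times> 'v \<Rightarrow> 'v \<times> 'v \<Rightarrow> 'v \<times> 'v \<Rightarrow> complex" where
  "d_dbar h z a b = dz (\<lambda>w. dzbar h w b) z a - dz (\<lambda>w. dzbar h w a) z b"

definition kaehler_potential ::
  "((real \<Rightarrow> 'p) \<Rightarrow> 'w) \<Rightarrow> ('p \<Rightarrow> 'w \<Rightarrow> 'w \<Rightarrow> real) \<Rightarrow>
   ('v::euclidean_space \<times> 'v) set \<Rightarrow> ('p, 'v \<times> 'v) chart set \<Rightarrow> ('p \<Rightarrow> real) \<Rightarrow> bool" where
  "kaehler_potential vel \<omega> V \<C> \<kappa> \<longleftrightarrow>
     (\<forall>c\<in>\<C>. smooth_on V (chart_image c) (\<kappa> \<circ> chart_inv c) \<and>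
       (\<forall>z\<in>chart_image c. \<forall>a\<in>V. \<forall>b\<in>V.
          complex_of_real (pullback vel \<omega> c z a b)
            = \<i> * d_dbar (\<lambda>w. complex_of_real (\<kappa> (chart_inv c w))) z a b))"

section \<open>Lie groups\<close>

definition lie_group ::
  "'g::t2_space monoid \<Rightarrow> 'v::euclidean_space set \<Rightarrow> ('g, 'v) chart set \<Rightarrow> bool" where
  "lie_group G \<gg> \<A> \<longleftrightarrow>
     group G \<and> smooth_atlas (carrier G) \<gg> \<A> \<and>
     smooth_map (carrier G \<times> carrier G) (\<gg> \<times> \<gg>) (prod_atlas \<A> \<A>) (carrier G) \<A>
       (\<lambda>(x, y). x \<otimes>\<^bsub>G\<^esub> y) \<and>
     smooth_map (carrier G) \<gg> \<A> (carrier G) \<A> (\<lambda>x. inv\<^bsub>G\<^esub> x)"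

text \<open>
  The Lie algebra, as a vector space with inner product: the differential at the unit
  element of a fixed chart \<open>c\<close> around it identifies the tangent space there with the model space \<open>\<gg>\<close>, and
  the inner product is the one that \<open>\<gg>\<close> inherits from the ambient Euclidean space. Composing a
  chart with a linear map shows that every inner product on the tangent space arises in this way.
  The curve \<open>s \<mapsto> chart_line c U s\<close> has velocity \<open>U\<close> at the unit element.
\<close>

definition unit_velocity :: "('g, 'v::real_normed_vector) chart \<Rightarrow> (real \<Rightarrow> 'g) \<Rightarrow> 'v" where
  "unit_velocity c \<gamma> = vector_derivative (\<lambda>s. snd c (\<gamma> s)) (at 0)"

definition chart_line :: "'g monoid \<Rightarrow> ('g, 'v::real_vector) chart \<Rightarrow> 'v \<Rightarrow> real \<Rightarrow> 'g" where
  "chart_line G c U s = chart_inv c (snd c \<one>\<^bsub>G\<^esub> + s *\<^sub>R U)"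

definition Ad :: "'g monoid \<Rightarrow> ('g, 'v::real_normed_vector) chart \<Rightarrow> 'g \<Rightarrow> 'v \<Rightarrow> 'v" where
  "Ad G c x W = unit_velocity c (\<lambda>s. x \<otimes>\<^bsub>G\<^esub> chart_line G c W s \<otimes>\<^bsub>G\<^esub> inv\<^bsub>G\<^esub> x)"

text \<open>The adjoint representation \<open>ad\<close> of the Lie algebra is the differential of \<open>Ad\<close> at the unit.\<close>
definition lie_bracket :: "'g monoid \<Rightarrow> ('g, 'v::real_normed_vector) chart \<Rightarrow> 'v \<Rightarrow> 'v \<Rightarrow> 'v" where
  "lie_bracket G c U W = vector_derivative (\<lambda>s. Ad G c (chart_line G c U s) W) (at 0)"

definition Ad_invariant :: "'g monoid \<Rightarrow> 'v::euclidean_space set \<Rightarrow> ('g, 'v) chart \<Rightarrow> bool" where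
  "Ad_invariant G \<gg> c \<longleftrightarrow>
     (\<forall>x\<in>carrier G. \<forall>U\<in>\<gg>. \<forall>W\<in>\<gg>. Ad G c x U \<bullet> Ad G c x W = U \<bullet> W)"

text \<open>
  A torus in \<open>G\<close> is the image of an injective homomorphism of Lie groups from the quotient of
  \<open>span B\<close> by the lattice generated by a basis \<open>B\<close>, that is, from a product of circles, to \<open>G\<close>.
\<close>
definition torus ::
  "'g::t2_space monoid \<Rightarrow> ('g, 'v::euclidean_space) chart set \<Rightarrow> 'g set \<Rightarrow> bool" where
  "torus G \<A> T \<longleftrightarrow>
     (\<exists>(B::'v set) \<rho>. independent B \<and>
        smooth_map (span B) (span B) (linear_atlas (span B)) (carrier G) \<A> \<rho> \<and>
        (\<forall>u\<in>span B. \<forall>w\<in>span B. \<rho> (u + w) = \<rho> u \<otimes>\<^bsub>G\<^esub> \<rho> w) \<and>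
        {w \<in> span B. \<rho> w = \<one>\<^bsub>G\<^esub>} = {(\<Sum>b\<in>B. of_int (n b) *\<^sub>R b) | n. True} \<and>
        \<rho> ` span B = T)"

definition maximal_torus ::
  "'g::t2_space monoid \<Rightarrow> ('g, 'v::euclidean_space) chart set \<Rightarrow> 'g set \<Rightarrow> bool" where
  "maximal_torus G \<A> T \<longleftrightarrow> torus G \<A> T \<and> (\<forall>T'. torus G \<A> T' \<and> T \<subseteq> T' \<longrightarrow> T' = T)"

text \<open>The Lie algebra of a Lie subgroup \<open>H\<close> is its tangent space at the unit element.\<close>
definition subgroup_lie_algebra ::
  "'g::t2_space monoid \<Rightarrow> ('g, 'v::euclidean_space) chart set \<Rightarrow> ('g, 'v) chart \<Rightarrow>
   'g set \<Rightarrow> 'v set" where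
  "subgroup_lie_algebra G \<A> c H =
     {unit_velocity c \<gamma> | \<gamma>.
        smooth_map UNIV UNIV (linear_atlas UNIV) (carrier G) \<A> \<gamma> \<and> range \<gamma> \<subseteq> H \<and> \<gamma> 0 = \<one>\<^bsub>G\<^esub>}"

section \<open>The cotangent bundle in left trivialisation\<close>

definition cotangent_bundle :: "'g monoid \<Rightarrow> 'v set \<Rightarrow> ('g \<times> 'v) set" where
  "cotangent_bundle G \<gg> = carrier G \<times> \<gg>"

definition cotangent_atlas ::
  "'v set \<Rightarrow> ('g, 'v) chart set \<Rightarrow> ('g \<times> 'v, 'v \<times> 'v) chart set" where
  "cotangent_atlas \<gg> \<A> = prod_atlas \<A> (linear_atlas \<gg>)"

text \<open>For example, \<open>s \<mapsto> (x e\<^sup>s\<^sup>U, y + s V)\<close> has left-trivialised velocity \<open>(U, V)\<close>.\<close>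
definition left_velocity ::
  "'g monoid \<Rightarrow> ('g, 'v::real_normed_vector) chart \<Rightarrow> (real \<Rightarrow> 'g \<times> 'v) \<Rightarrow> 'v \<times> 'v" where
  "left_velocity G c \<gamma> =
     (unit_velocity c (\<lambda>s. inv\<^bsub>G\<^esub> (fst (\<gamma> 0)) \<otimes>\<^bsub>G\<^esub> fst (\<gamma> s)),
      vector_derivative (\<lambda>s. snd (\<gamma> s)) (at 0))"

definition canonical_form ::
  "'g monoid \<Rightarrow> ('g, 'v::euclidean_space) chart \<Rightarrow> 'g \<times> 'v \<Rightarrow> 'v \<times> 'v \<Rightarrow> 'v \<times> 'v \<Rightarrow> real" where
  "canonical_form G c = (\<lambda>(x, y) (U, V) (W, Z). U \<bullet> Z - V \<bullet> W + y \<bullet> lie_bracket G c U W)"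

definition quadratic_hamiltonian :: "('v::real_inner \<Rightarrow> 'v) \<Rightarrow> 'g \<times> 'v \<Rightarrow> real" where
  "quadratic_hamiltonian F = (\<lambda>(x, y). 1 / 2 * (y \<bullet> F y))"

definition toral_leaf :: "'g monoid \<Rightarrow> 'g set \<Rightarrow> 'v::plus set \<Rightarrow> 'g \<times> 'v \<Rightarrow> ('g \<times> 'v) set" where
  "toral_leaf G T \<tt> = (\<lambda>(x, y). (x <#\<^bsub>G\<^esub> T) \<times> ((+) y ` \<tt>))"

text \<open>
  The vectors \<open>(- cnj \<sigma> F A, A)\<close> with \<open>A\<close> in the complexification of \<open>\<tt>\<close>, to which \<open>F\<close> is extended
  complex linearly, written as pairs of real and imaginary part. They do not depend on the base
  point.
\<close>
definition toral_distribution ::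
  "('v::real_vector \<Rightarrow> 'v) \<Rightarrow> complex \<Rightarrow> 'v set \<Rightarrow> (('v \<times> 'v) \<times> ('v \<times> 'v)) set" where
  "toral_distribution F \<sigma> \<tt> =
     {((fst w, fst A), (snd w, snd A)) | w A.
        A \<in> \<tt> \<times> \<tt> \<and> w = cscale (- cnj \<sigma>) (map_prod F F A)}"

end

theory Submission
  imports Defs
begin

text \<open>
  Write \<open>T = \<rho> (span B)\<close> with \<open>\<rho>\<close> a homomorphism whose kernel is the lattice generated by \<open>B\<close>. Its
  derivative \<open>d\<rho>\<close> at \<open>0\<close> is injective since the kernel is discrete, and \<open>\<rho>\<close> is open onto \<open>T\<close> since a
  fundamental domain is compact; hence \<open>\<tt>\<close> is the range of \<open>d\<rho>\<close>. With \<open>log\<close> the inverse of \<open>d\<rho>\<close>, the map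
  \<open>\<Phi> (a, b) = (x \<rho> (- log (\<sigma>\<^sub>1 F a + \<sigma>\<^sub>2 F b)), y + a)\<close> covers the leaf by \<open>\<tt> \<times> \<tt>\<close>, seen as the
  complexification of \<open>\<tt>\<close>, and is invariant under a discrete group of translations. So its local
  inverses are holomorphic charts. In left trivialisation the differential of \<open>\<Phi>\<close> is the constant map
  \<open>(a, b) \<mapsto> (- (\<sigma>\<^sub>1 F a + \<sigma>\<^sub>2 F b), a)\<close>, whose values together with the brackets vanishing on \<open>\<tt>\<close> give
  the constant form \<open>\<sigma>\<^sub>2 (\<langle>a, F b'\<rangle> - \<langle>b, F a'\<rangle>)\<close>. The potential becomes
  \<open>\<sigma>\<^sub>2 \<langle>y + a, F (y + a)\<rangle>\<close>, whose second derivatives yield this form.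
\<close>

section \<open>Smooth functions on relatively open subsets of subspaces\<close>

text \<open>The main obstacle is topological: the leaf must be an embedded submanifold in its
  subspace topology, and \<open>\<tt>\<close> is given by velocities of arbitrary smooth curves that
  lie in the torus. Openness of \<open>\<rho>\<close> onto its image settles both, because it lifts
  points of the torus near the unit to small vectors. The coordinates are dictated by the
  distribution. With \<open>A = a + \<i> b\<close>, the velocity X of \<open>\<Phi>\<close> in
  direction \<open>A\<close> is the real part of \<open>(- cnj \<sigma> F A, A)\<close>, and the
  velocity JX in direction \<open>\<i> A\<close> is minus its imaginary part. So X -
  \<open>\<i>\<close> JX is exactly the prescribed vector, without a factor. Positivity of
  \<open>F\<close> on \<open>\<tt>\<close> and \<open>Im \<sigma> > 0\<close> make
  \<open>(a, b)\<close> recoverable from the velocity: \<open>a\<close> is its second component, and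
  \<open>b\<close> solves a linear equation in which \<open>Im \<sigma> *\<^sub>R F b\<close> is the
  only unknown term. The base point \<open>y\<close> may lie outside \<open>\<tt>\<close>. The term
  of the canonical form that contains \<open>y\<close> disappears because brackets vanish on
  \<open>\<tt>\<close>, while differentiating the potential at \<open>y + a\<close> uses
  self-adjointness of \<open>F\<close> on all of \<open>\<gg>\<close>.\<close>

lemma linear_extension_from_subspace:
  fixes f :: "'a::euclidean_space \<Rightarrow> 'b::real_normed_vector"
  assumes E: "subspace E"
    and add: "\<And>u v. u \<in> E \<Longrightarrow> v \<in> E \<Longrightarrow> f (u + v) = f u + f v"
    and scale: "\<And>r v. v \<in> E \<Longrightarrow> f (r *\<^sub>R v) = r *\<^sub>R f v"
  obtains g where "bounded_linear g" "\<And>v. v \<in> E \<Longrightarrow> g v = f v"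
proof -
  \<comment> \<open>A left inverse of the identity restricted to \<open>E\<close> is a linear
    projection \<open>p\<close> onto \<open>E\<close>; the extension is \<open>f\<close> after
    \<open>p\<close>.\<close>
  have "linear (\<lambda>x::'a. x)" by (rule bounded_linear.linear[OF bounded_linear_ident])
  from linear_exists_left_inverse_on[OF this E]
  obtain p :: "'a \<Rightarrow> 'a" where p: "range p \<subseteq> E" "linear p" "\<And>v. v \<in> E \<Longrightarrow> p v = v"
    by auto
  have "linear (\<lambda>v. f (p v))"
    using p by (intro linearI) (auto simp: linear_add linear_scale add scale image_subset_iff)
  then have "bounded_linear (\<lambda>v. f (p v))" by (rule linear_conv_bounded_linear[THEN iffD1])
  then show ?thesis using that[of "\<lambda>v. f (p v)"] p(3) by simp
qed

text \<open>The filter is \<open>nhds 0\<close> and not \<open>at 0\<close>: two curves that agree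
  along it also agree at 0, so their derivatives at 0 can be exchanged.\<close>

lemma eventually_line_in_openin:
  fixes z a :: "'a::real_normed_vector"
  assumes "subspace E" "openin (top_of_set E) S" "z \<in> S" "a \<in> E"
  shows "\<forall>\<^sub>F s in nhds (0::real). z + s *\<^sub>R a \<in> S"
proof -
  obtain T where T: "open T" "S = E \<inter> T" using assms(2) by (auto simp: openin_open)
  have "((\<lambda>s. z + s *\<^sub>R a) \<longlongrightarrow> z + 0 *\<^sub>R a) (nhds (0::real))"
    by (intro tendsto_intros filterlim_ident)
  then have "\<forall>\<^sub>F s in nhds (0::real). z + s *\<^sub>R a \<in> T"
    using T assms(3) by (auto dest!: topological_tendstoD)
  moreover have "z + s *\<^sub>R a \<in> E" for s
    using assms T by (auto intro: subspace_add subspace_scale)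
  ultimately show ?thesis using T(2) by (auto elim: eventually_mono)
qed

text \<open>Although \<open>S\<close> may have empty interior in the ambient space, a direction in
  \<open>E\<close> stays in \<open>S\<close> for small parameters of both signs, so the derivative
  along the line is a genuine derivative at 0.\<close>

lemma has_derivative_imp_line:
  fixes f :: "'a::real_normed_vector \<Rightarrow> 'b::real_normed_vector"
  assumes E: "subspace E" "openin (top_of_set E) S" "z \<in> S" "a \<in> E"
    and f: "(f has_derivative f') (at z within S)"
  shows "((\<lambda>s. f (z + s *\<^sub>R a)) has_vector_derivative f' a) (at 0)"
proof -
  obtain U where U: "open U" "0 \<in> U" "\<And>s::real. s \<in> U \<Longrightarrow> z + s *\<^sub>R a \<in> S"
    using eventually_line_in_openin[OF E] by (auto simp: eventually_nhds)
  have 1: "((\<lambda>s::real. z + s *\<^sub>R a) has_derivative (\<lambda>s. s *\<^sub>R a)) (at 0 within U)"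
    by (auto intro!: derivative_eq_intros)
  have img: "(\<lambda>s. z + s *\<^sub>R a) ` U \<subseteq> S" using U(3) by blast
  have 2: "(f has_derivative f') (at (z + 0 *\<^sub>R a) within (\<lambda>s. z + s *\<^sub>R a) ` U)"
    using has_derivative_subset[OF f img] by simp
  have "((\<lambda>s. f (z + s *\<^sub>R a)) has_derivative (\<lambda>s. f' (s *\<^sub>R a))) (at 0 within U)"
    by (rule has_derivative_in_compose[OF 1 2])
  then have "((\<lambda>s. f (z + s *\<^sub>R a)) has_derivative (\<lambda>s. f' (s *\<^sub>R a))) (at 0)"
    by (simp only: at_within_open[OF U(2,1)])
  moreover have "linear f'" using f by (rule has_derivative_linear)
  ultimately show ?thesis by (simp add: has_vector_derivative_def linear_scale)
qed

lemma dir_deriv_eq: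
  fixes f :: "'a::real_normed_vector \<Rightarrow> 'b::real_normed_vector"
  assumes "subspace E" "openin (top_of_set E) S" "z \<in> S" "a \<in> E"
    and "(f has_derivative f') (at z within S)"
  shows "dir_deriv f z a = f' a"
  unfolding dir_deriv_def by (rule vector_derivative_at[OF has_derivative_imp_line[OF assms]])

lemma vector_derivative_cong_nhds:
  assumes "\<forall>\<^sub>F s in nhds t. f s = g s"
  shows "vector_derivative f (at t) = vector_derivative g (at t)"
  by (rule vector_derivative_cong_eq) (use assms in \<open>auto elim: eventually_mono\<close>)

lemma has_vector_derivative_cong_nhds:
  assumes "\<forall>\<^sub>F s in nhds t. f s = g s"
  shows "(f has_vector_derivative D) (at t) \<longleftrightarrow> (g has_vector_derivative D) (at t)"
  by (rule has_vector_derivative_cong_ev) (use assms eventually_nhds_x_imp_x[OF assms] in \<open>auto elim: eventually_mono\<close>)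

lemma dir_deriv_cong:
  assumes "subspace E" "openin (top_of_set E) S" "z \<in> S" "a \<in> E" "\<And>w. w \<in> S \<Longrightarrow> f w = g w"
  shows "dir_deriv f z a = dir_deriv g z a"
  unfolding dir_deriv_def
  by (rule vector_derivative_cong_nhds)
    (use eventually_line_in_openin[OF assms(1-4)] assms(5) in \<open>auto elim: eventually_mono\<close>)

section \<open>Smoothness of finite order: restriction, canonical derivatives, locality\<close>

lemma k_smooth_on_cong:
  "(\<And>x. x \<in> S \<Longrightarrow> f x = g x) \<Longrightarrow> k_smooth_on k E S f \<longleftrightarrow> k_smooth_on k E S g"
proof (cases k)
  case 0
  assume "\<And>x. x \<in> S \<Longrightarrow> f x = g x"
  then show ?thesis using 0 by (simp cong: continuous_on_cong)
next
  case (Suc j)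
  assume eq: "\<And>x. x \<in> S \<Longrightarrow> f x = g x"
  have "(f has_derivative D) (at x within S) \<longleftrightarrow> (g has_derivative D) (at x within S)" if "x \<in> S" for x D
    using eq that by (metis has_derivative_transform)
  then show ?thesis using Suc by simp
qed

lemma k_smooth_on_SucI:
  assumes "\<And>x. x \<in> S \<Longrightarrow> (f has_derivative f' x) (at x within S)"
    and "\<And>v. v \<in> E \<Longrightarrow> k_smooth_on k E S (\<lambda>x. f' x v)"
  shows "k_smooth_on (Suc k) E S f"
  unfolding k_smooth_on.simps using assms by blast

lemma k_smooth_on_SucE:
  assumes "k_smooth_on (Suc k) E S f"
  obtains f' where "\<And>x. x \<in> S \<Longrightarrow> (f has_derivative f' x) (at x within S)"
    and "\<And>v. v \<in> E \<Longrightarrow> k_smooth_on k E S (\<lambda>x. f' x v)"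
  using assms unfolding k_smooth_on.simps by blast

lemma k_smooth_on_subset: "k_smooth_on k E S f \<Longrightarrow> S' \<subseteq> S \<Longrightarrow> k_smooth_on k E S' f"
proof (induction k arbitrary: f)
  case 0
  then show ?case by (auto intro: continuous_on_subset)
next
  case (Suc k)
  from Suc.prems(1) obtain f' where f': "\<And>x. x \<in> S \<Longrightarrow> (f has_derivative f' x) (at x within S)"
    "\<And>v. v \<in> E \<Longrightarrow> k_smooth_on k E S (\<lambda>x. f' x v)"
    by (rule k_smooth_on_SucE) blast
  show ?case
    unfolding k_smooth_on.simps
    using f' Suc.IH[OF f'(2) Suc.prems(2)] Suc.prems(2)
    by (intro exI[of _ f']) (meson has_derivative_subset subsetD)
qed

lemma k_smooth_on_continuous: "k_smooth_on k E S f \<Longrightarrow> continuous_on S f"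
  by (cases k) (auto simp: continuous_on_eq_continuous_within intro: has_derivative_continuous)

lemma k_smooth_on_SucD: "k_smooth_on (Suc k) E S f \<Longrightarrow> k_smooth_on k E S f"
proof (induction k arbitrary: f)
  case 0
  then show ?case by (intro k_smooth_on.simps(1)[THEN iffD2] k_smooth_on_continuous)
next
  case (Suc k)
  then obtain f' where f': "\<forall>x\<in>S. (f has_derivative f' x) (at x within S)"
    "\<forall>v\<in>E. k_smooth_on (Suc k) E S (\<lambda>x. f' x v)" by auto
  then have "\<forall>v\<in>E. k_smooth_on k E S (\<lambda>x. f' x v)" using Suc.IH by blast
  then show ?case using f'(1) unfolding k_smooth_on.simps(2)[of k] by blast
qed

text \<open>The witness \<open>f'\<close> of the recursion is determined only in directions of
  \<open>E\<close>, so witnesses from different neighbourhoods need not agree. Replacing it by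
  \<open>dir_deriv\<close> makes the condition canonical, and local information can then be
  glued.\<close>

lemma k_smooth_on_Suc_iff:
  assumes E: "subspace E" "openin (top_of_set E) S"
  shows "k_smooth_on (Suc k) E S f \<longleftrightarrow>
    (\<forall>x\<in>S. f differentiable (at x within S)) \<and> (\<forall>v\<in>E. k_smooth_on k E S (\<lambda>x. dir_deriv f x v))"
proof (intro iffI conjI ballI)
  assume "k_smooth_on (Suc k) E S f"
  then obtain f' where f': "\<And>x. x \<in> S \<Longrightarrow> (f has_derivative f' x) (at x within S)"
    "\<And>v. v \<in> E \<Longrightarrow> k_smooth_on k E S (\<lambda>x. f' x v)"
    by (rule k_smooth_on_SucE) blast
  show "f differentiable (at x within S)" if "x \<in> S" for x
    using f'(1)[OF that] by (auto simp: differentiable_def)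
  show "k_smooth_on k E S (\<lambda>x. dir_deriv f x v)" if "v \<in> E" for v
  proof -
    have "k_smooth_on k E S (\<lambda>x. dir_deriv f x v) \<longleftrightarrow> k_smooth_on k E S (\<lambda>x. f' x v)"
      by (rule k_smooth_on_cong) (rule dir_deriv_eq[OF E _ that f'(1)])
    from this f'(2)[OF that] show ?thesis by (rule iffD2)
  qed
next
  assume *: "(\<forall>x\<in>S. f differentiable (at x within S)) \<and> (\<forall>v\<in>E. k_smooth_on k E S (\<lambda>x. dir_deriv f x v))"
  define f' where "f' x = frechet_derivative f (at x within S)" for x
  have f': "(f has_derivative f' x) (at x within S)" if "x \<in> S" for x
    using bspec[OF conjunct1[OF *] that] by (simp add: f'_def frechet_derivative_works)
  show "k_smooth_on (Suc k) E S f"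
  proof (rule k_smooth_on_SucI[OF f'])
    fix v assume v: "v \<in> E"
    show "k_smooth_on k E S (\<lambda>x. f' x v)"
    proof -
      have "k_smooth_on k E S (\<lambda>x. dir_deriv f x v) \<longleftrightarrow> k_smooth_on k E S (\<lambda>x. f' x v)"
        by (rule k_smooth_on_cong) (rule dir_deriv_eq[OF E _ v f'])
      from this bspec[OF conjunct2[OF *] v] show ?thesis by (rule iffD1)
    qed
  qed auto
qed

lemma at_within_openin_Int:
  assumes "openin (top_of_set E) S" "openin (top_of_set E) U" "x \<in> S" "x \<in> U"
  shows "at x within (S \<inter> U) = at x within S"
proof -
  obtain T where T: "open T" "U = E \<inter> T" using assms(2) by (auto simp: openin_open)
  have "S \<subseteq> E" using assms(1) by (auto dest: openin_imp_subset)
  then show ?thesis using T assms by (intro at_within_nhd[of x T]) auto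
qed

text \<open>Cutting \<open>S\<close> down to a relatively open neighbourhood of a point leaves the
  filter within \<open>S\<close> at that point unchanged; the induction runs on the globally defined
  \<open>dir_deriv\<close>.\<close>

lemma k_smooth_on_local:
  assumes E: "subspace E" "openin (top_of_set E) S"
    and loc: "\<And>x. x \<in> S \<Longrightarrow> \<exists>U. openin (top_of_set E) U \<and> x \<in> U \<and> k_smooth_on k E (S \<inter> U) f"
  shows "k_smooth_on k E S f"
  using loc
proof (induction k arbitrary: f)
  case 0
  have "continuous (at x within S) f" if x: "x \<in> S" for x
  proof -
    obtain U where U: "openin (top_of_set E) U" "x \<in> U" "continuous_on (S \<inter> U) f"
      using 0[OF x] by auto
    have "continuous (at x within (S \<inter> U)) f"
      using U x by (auto simp: continuous_on_eq_continuous_within)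
    then show ?thesis using at_within_openin_Int[OF E(2) U(1) x U(2)] by (simp add: continuous_within)
  qed
  then show ?case by (simp add: continuous_on_eq_continuous_within)
next
  case (Suc k)
  show ?case
    unfolding k_smooth_on_Suc_iff[OF E]
  proof (intro conjI ballI)
    fix x assume x: "x \<in> S"
    obtain U where U: "openin (top_of_set E) U" "x \<in> U" "k_smooth_on (Suc k) E (S \<inter> U) f"
      using Suc.prems[OF x] by blast
    have SU: "openin (top_of_set E) (S \<inter> U)" using E U by auto
    have "f differentiable (at x within (S \<inter> U))"
      using U(3) x U(2) unfolding k_smooth_on_Suc_iff[OF E(1) SU] by blast
    then show "f differentiable (at x within S)" using at_within_openin_Int[OF E(2) U(1) x U(2)] by simp
  next
    fix v assume v: "v \<in> E"
    show "k_smooth_on k E S (\<lambda>x. dir_deriv f x v)"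
    proof (rule Suc.IH)
      fix x assume x: "x \<in> S"
      obtain U where U: "openin (top_of_set E) U" "x \<in> U" "k_smooth_on (Suc k) E (S \<inter> U) f"
        using Suc.prems[OF x] by blast
      have SU: "openin (top_of_set E) (S \<inter> U)" using E U by auto
      show "\<exists>U. openin (top_of_set E) U \<and> x \<in> U \<and> k_smooth_on k E (S \<inter> U) (\<lambda>x. dir_deriv f x v)"
        using U v unfolding k_smooth_on_Suc_iff[OF E(1) SU] by blast
    qed
  qed
qed

section \<open>Rules for building smooth functions, up to the chain rule\<close>

lemma k_smooth_on_const: "k_smooth_on k E S (\<lambda>_. a)"
proof (induction k arbitrary: a)
  case 0
  show ?case by simp
next
  case (Suc k)
  show ?case
    by (rule k_smooth_on_SucI[where f="\<lambda>_. a" and f'="\<lambda>_ _. 0"], rule has_derivative_const, rule Suc.IH)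
qed

lemma k_smooth_on_linear_compose:
  "bounded_linear h \<Longrightarrow> k_smooth_on k E S f \<Longrightarrow> k_smooth_on k E S (\<lambda>x. h (f x))"
proof (induction k arbitrary: f)
  case 0
  then show ?case by (simp add: bounded_linear.continuous_on)
next
  case (Suc k)
  from Suc.prems(2) obtain f' where f': "\<And>x. x \<in> S \<Longrightarrow> (f has_derivative f' x) (at x within S)"
    "\<And>v. v \<in> E \<Longrightarrow> k_smooth_on k E S (\<lambda>x. f' x v)"
    by (rule k_smooth_on_SucE) blast
  show ?case
    by (rule k_smooth_on_SucI[where f'="\<lambda>x v. h (f' x v)"])
      (rule bounded_linear.has_derivative[OF Suc.prems(1)] Suc.IH[OF Suc.prems(1)], erule f')+
qed

lemma k_smooth_on_ident: "k_smooth_on k E S (\<lambda>x. x)"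
proof (cases k)
  case 0
  then show ?thesis by simp
next
  case (Suc j)
  show ?thesis unfolding Suc
    by (rule k_smooth_on_SucI[where f="\<lambda>x. x" and f'="\<lambda>_ v. v"], rule has_derivative_ident, rule k_smooth_on_const)
qed

lemmas k_smooth_on_linear = k_smooth_on_linear_compose[OF _ k_smooth_on_ident]

lemma k_smooth_on_add:
  "k_smooth_on k E S f \<Longrightarrow> k_smooth_on k E S g \<Longrightarrow> k_smooth_on k E S (\<lambda>x. f x + g x)"
proof (induction k arbitrary: f g)
  case 0
  then show ?case by (simp add: continuous_on_add)
next
  case (Suc k)
  obtain f' where f': "\<And>x. x \<in> S \<Longrightarrow> (f has_derivative f' x) (at x within S)"
    "\<And>v. v \<in> E \<Longrightarrow> k_smooth_on k E S (\<lambda>x. f' x v)" using Suc.prems(1) by (rule k_smooth_on_SucE) blast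
  obtain g' where g': "\<And>x. x \<in> S \<Longrightarrow> (g has_derivative g' x) (at x within S)"
    "\<And>v. v \<in> E \<Longrightarrow> k_smooth_on k E S (\<lambda>x. g' x v)" using Suc.prems(2) by (rule k_smooth_on_SucE) blast
  show ?case
    by (rule k_smooth_on_SucI[where f'="\<lambda>x v. f' x v + g' x v"])
      (rule has_derivative_add Suc.IH, erule f', erule g')+
qed

lemma k_smooth_on_sum:
  "(\<And>i. i \<in> I \<Longrightarrow> k_smooth_on k E S (f i)) \<Longrightarrow> k_smooth_on k E S (\<lambda>x. \<Sum>i\<in>I. f i x)"
  by (induction I rule: infinite_finite_induct) (simp_all add: k_smooth_on_const k_smooth_on_add)

lemma k_smooth_on_bilinear:
  assumes h: "bounded_bilinear h"
  shows "k_smooth_on k E S f \<Longrightarrow> k_smooth_on k E S g \<Longrightarrow> k_smooth_on k E S (\<lambda>x. h (f x) (g x))"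
proof (induction k arbitrary: f g)
  case 0
  then show ?case by (simp add: bounded_bilinear.continuous_on[OF h])
next
  case (Suc k)
  obtain f' where f': "\<And>x. x \<in> S \<Longrightarrow> (f has_derivative f' x) (at x within S)"
    "\<And>v. v \<in> E \<Longrightarrow> k_smooth_on k E S (\<lambda>x. f' x v)" using Suc.prems(1) by (rule k_smooth_on_SucE) blast
  obtain g' where g': "\<And>x. x \<in> S \<Longrightarrow> (g has_derivative g' x) (at x within S)"
    "\<And>v. v \<in> E \<Longrightarrow> k_smooth_on k E S (\<lambda>x. g' x v)" using Suc.prems(2) by (rule k_smooth_on_SucE) blast
  show ?case
    by (rule k_smooth_on_SucI[where f'="\<lambda>x v. h (f x) (g' x v) + h (f' x v) (g x)"])
      (assumption | rule bounded_bilinear.FDERIV[OF h] k_smooth_on_add Suc.IH f' g'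
          k_smooth_on_SucD[OF Suc.prems(1)] k_smooth_on_SucD[OF Suc.prems(2)])+
qed

lemma k_smooth_on_Pair:
  assumes "k_smooth_on k E S f" "k_smooth_on k E S g"
  shows "k_smooth_on k E S (\<lambda>x. (f x, g x))"
proof -
  have "k_smooth_on k E S (\<lambda>x. (f x, 0) + (0, g x))"
    using assms
    by (intro k_smooth_on_add k_smooth_on_linear_compose[where h="\<lambda>u. (u, 0)"]
        k_smooth_on_linear_compose[where h="\<lambda>u. (0, u)"])
      (auto intro!: bounded_linear_Pair bounded_linear_zero bounded_linear_ident)
  then show ?thesis by simp
qed

lemma has_vector_derivative_quotient:
  assumes f: "(f has_vector_derivative v) (at 0)"
  shows "((\<lambda>s. (f s - f 0) /\<^sub>R s) \<longlongrightarrow> v) (at 0)"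
proof (rule Lim_transform2)
  show "((\<lambda>s. v) \<longlongrightarrow> v) (at 0)" by simp
  have "((\<lambda>s. norm ((f s - f 0) - s *\<^sub>R v) / norm s) \<longlongrightarrow> 0) (at 0)"
    using f by (simp add: has_vector_derivative_def has_derivative_iff_norm)
  moreover have "\<forall>\<^sub>F s in at 0. norm ((f s - f 0) - s *\<^sub>R v) / norm s = norm (v - (f s - f 0) /\<^sub>R s)"
    unfolding eventually_at_filter
  proof (intro always_eventually allI impI)
    fix s :: real assume s: "s \<noteq> 0"
    have "v - (f s - f 0) /\<^sub>R s = (- inverse s) *\<^sub>R ((f s - f 0) - s *\<^sub>R v)"
      using s by (simp add: algebra_simps)
    then have "norm (v - (f s - f 0) /\<^sub>R s) = \<bar>inverse s\<bar> * norm ((f s - f 0) - s *\<^sub>R v)"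
      by (metis norm_scaleR abs_minus_cancel)
    then show "norm ((f s - f 0) - s *\<^sub>R v) / norm s = norm (v - (f s - f 0) /\<^sub>R s)"
      by (simp add: divide_inverse)
  qed
  ultimately have "((\<lambda>s. norm (v - (f s - f 0) /\<^sub>R s)) \<longlongrightarrow> 0) (at 0)"
    by (rule Lim_transform_eventually)
  then show "((\<lambda>s. v - (f s - f 0) /\<^sub>R s) \<longlongrightarrow> 0) (at 0)" by (rule tendsto_norm_zero_cancel)
qed

text \<open>Difference quotients of a curve in a subspace stay in it, and subspaces of a Euclidean
  space are closed.\<close>

lemma has_vector_derivative_in_subspace:
  fixes f :: "real \<Rightarrow> 'a::euclidean_space"
  assumes E: "subspace E" and f: "(f has_vector_derivative v) (at 0)"
    and ev: "\<forall>\<^sub>F s in nhds 0. f s \<in> E"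
  shows "v \<in> E"
proof -
  note lim = has_vector_derivative_quotient[OF f]
  have "\<forall>\<^sub>F s in at 0. (f s - f 0) /\<^sub>R s \<in> E"
    using ev eventually_nhds_x_imp_x[OF ev] E
    by (auto simp: eventually_at_filter intro!: subspace_scale subspace_diff elim: eventually_mono)
  then show ?thesis
    by (intro Lim_in_closed_set[OF closed_subspace[OF E] _ _ lim]) auto
qed

lemma has_derivative_in_subspace:
  fixes f :: "'a::real_normed_vector \<Rightarrow> 'b::euclidean_space"
  assumes E: "subspace E" "openin (top_of_set E) S" "x \<in> S" "v \<in> E"
    and f: "(f has_derivative f') (at x within S)" and F: "subspace F" "f ` S \<subseteq> F"
  shows "f' v \<in> F"
  by (rule has_vector_derivative_in_subspace[OF F(1) has_derivative_imp_line[OF E f]])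
    (use eventually_line_in_openin[OF E] F(2) in \<open>auto elim!: eventually_mono\<close>)

lemma orthonormal_expansion:
  assumes "subspace E"
  obtains C where "finite C" "C \<subseteq> E" "\<And>v::'a::euclidean_space. v \<in> E \<Longrightarrow> v = (\<Sum>b\<in>C. (v \<bullet> b) *\<^sub>R b)"
proof -
  obtain C where C: "C \<subseteq> E" "pairwise orthogonal C" "\<And>x. x \<in> C \<Longrightarrow> norm x = 1" "independent C" "span C = E"
    using orthonormal_basis_subspace[OF assms] by metis
  have fin: "finite C" using C(4) by (rule independent_imp_finite)
  have "v = (\<Sum>b\<in>C. (v \<bullet> b) *\<^sub>R b)" if "v \<in> E" for v
  proof -
    let ?w = "v - (\<Sum>b\<in>C. (v \<bullet> b) *\<^sub>R b)"
    have "?w \<bullet> b = 0" if b: "b \<in> C" for b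
    proof -
      have "(\<Sum>a\<in>C. (v \<bullet> a) *\<^sub>R a) \<bullet> b = (\<Sum>a\<in>C. (v \<bullet> a) * (a \<bullet> b))" by (simp add: inner_sum_left)
      also have "\<dots> = (\<Sum>a\<in>C. if a = b then v \<bullet> b else 0)"
        using C(2,3) b by (intro sum.cong) (auto simp: pairwise_def orthogonal_def norm_eq_1)
      also have "\<dots> = v \<bullet> b" using b fin by simp
      finally show ?thesis by (simp add: inner_diff_left)
    qed
    moreover have "?w \<in> span C" using C \<open>v \<in> E\<close> assms
      by (auto intro!: subspace_diff subspace_sum subspace_scale)
    ultimately have "orthogonal ?w ?w"
      by (intro orthogonal_to_span[of ?w C ?w]) (auto simp: orthogonal_def inner_commute)
    then show ?thesis by (simp add: orthogonal_def)
  qed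
  then show ?thesis using that fin C(1) by blast
qed

text \<open>The derivative of the composite is \<open>f' (g x)\<close> applied to a direction that
  varies with \<open>x\<close>, whereas the recursion gives smoothness of \<open>f'\<close> in fixed
  directions only. Expanding the moving direction in an orthonormal basis of \<open>F\<close>
  reduces it to finitely many fixed ones with smooth coefficients.\<close>

lemma k_smooth_on_compose:
  fixes g :: "'a::real_normed_vector \<Rightarrow> 'b::euclidean_space" and f :: "'b \<Rightarrow> 'c::real_normed_vector"
  assumes E: "subspace E" "openin (top_of_set E) S" and F: "subspace F" "openin (top_of_set F) R"
    and sub: "g ` S \<subseteq> R"
  shows "k_smooth_on k F R f \<Longrightarrow> k_smooth_on k E S g \<Longrightarrow> k_smooth_on k E S (\<lambda>x. f (g x))"
proof (induction k arbitrary: f)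
  case 0
  then show ?case using sub by (auto intro: continuous_on_compose2)
next
  case (Suc k)
  obtain f' where f': "\<And>x. x \<in> R \<Longrightarrow> (f has_derivative f' x) (at x within R)"
    "\<And>v. v \<in> F \<Longrightarrow> k_smooth_on k F R (\<lambda>x. f' x v)" using Suc.prems(1) by (rule k_smooth_on_SucE) blast
  obtain g' where g': "\<And>x. x \<in> S \<Longrightarrow> (g has_derivative g' x) (at x within S)"
    "\<And>v. v \<in> E \<Longrightarrow> k_smooth_on k E S (\<lambda>x. g' x v)" using Suc.prems(2) by (rule k_smooth_on_SucE) blast
  have gk: "k_smooth_on k E S g" using Suc.prems(2) by (rule k_smooth_on_SucD)
  obtain C where C: "finite C" "C \<subseteq> F" "\<And>v. v \<in> F \<Longrightarrow> v = (\<Sum>b\<in>C. (v \<bullet> b) *\<^sub>R b)"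
    using orthonormal_expansion[OF F(1)] by metis
  have RF: "R \<subseteq> F" using F(2) by (auto dest: openin_imp_subset)
  show ?case
  proof (rule k_smooth_on_SucI[where f'="\<lambda>x v. f' (g x) (g' x v)"])
    fix x assume x: "x \<in> S"
    have "(f has_derivative f' (g x)) (at (g x) within g ` S)"
      using f'(1)[of "g x"] sub x by (auto intro: has_derivative_subset)
    from has_derivative_in_compose[OF g'(1)[OF x] this]
    show "((\<lambda>x. f (g x)) has_derivative (\<lambda>v. f' (g x) (g' x v))) (at x within S)" .
  next
    fix v assume v: "v \<in> E"
    have "f' (g x) (g' x v) = (\<Sum>b\<in>C. (g' x v \<bullet> b) *\<^sub>R f' (g x) b)" if x: "x \<in> S" for x
    proof -
      have lin: "linear (f' (g x))" using f'(1)[of "g x"] sub x by (auto intro: has_derivative_linear)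
      have "g' x v \<in> F"
        using has_derivative_in_subspace[OF E x v g'(1)[OF x] F(1)] sub RF by blast
      then have "f' (g x) (g' x v) = f' (g x) (\<Sum>b\<in>C. (g' x v \<bullet> b) *\<^sub>R b)" using C(3) by metis
      then show ?thesis by (simp add: linear_sum[OF lin] linear_scale[OF lin])
    qed
    moreover have "k_smooth_on k E S (\<lambda>x. \<Sum>b\<in>C. (g' x v \<bullet> b) *\<^sub>R f' (g x) b)"
      using C(2) by (intro k_smooth_on_sum k_smooth_on_bilinear[OF bounded_bilinear_scaleR] Suc.IH f' gk
          k_smooth_on_linear_compose[OF bounded_linear_inner_left] g' v) auto
    ultimately show "k_smooth_on k E S (\<lambda>x. f' (g x) (g' x v))"
      by (subst k_smooth_on_cong) auto
  qed
qed

section \<open>The same rules for smoothness of all orders\<close>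

lemma smooth_on_cong: "(\<And>x. x \<in> S \<Longrightarrow> f x = g x) \<Longrightarrow> smooth_on E S f \<longleftrightarrow> smooth_on E S g"
  unfolding smooth_on_def using k_smooth_on_cong by blast

lemma smooth_on_subset: "smooth_on E S f \<Longrightarrow> S' \<subseteq> S \<Longrightarrow> smooth_on E S' f"
  unfolding smooth_on_def using k_smooth_on_subset by blast

lemma smooth_on_const: "smooth_on E S (\<lambda>_. a)"
  unfolding smooth_on_def using k_smooth_on_const by blast

lemma smooth_on_linear: "bounded_linear h \<Longrightarrow> smooth_on E S h"
  unfolding smooth_on_def using k_smooth_on_linear by blast

lemma smooth_on_linear_compose: "bounded_linear h \<Longrightarrow> smooth_on E S f \<Longrightarrow> smooth_on E S (\<lambda>x. h (f x))"
  unfolding smooth_on_def using k_smooth_on_linear_compose by blast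

lemma smooth_on_Pair: "smooth_on E S f \<Longrightarrow> smooth_on E S g \<Longrightarrow> smooth_on E S (\<lambda>x. (f x, g x))"
  unfolding smooth_on_def using k_smooth_on_Pair by blast

lemma smooth_on_add: "smooth_on E S f \<Longrightarrow> smooth_on E S g \<Longrightarrow> smooth_on E S (\<lambda>x. f x + g x)"
  unfolding smooth_on_def using k_smooth_on_add by blast

lemma smooth_on_bilinear:
  "bounded_bilinear h \<Longrightarrow> smooth_on E S f \<Longrightarrow> smooth_on E S g \<Longrightarrow> smooth_on E S (\<lambda>x. h (f x) (g x))"
  unfolding smooth_on_def using k_smooth_on_bilinear by blast

lemma smooth_on_compose:
  fixes g :: "'a::real_normed_vector \<Rightarrow> 'b::euclidean_space" and f :: "'b \<Rightarrow> 'c::real_normed_vector"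
  assumes "subspace E" "openin (top_of_set E) S" "subspace F" "openin (top_of_set F) R"
    and "g ` S \<subseteq> R" "smooth_on F R f" "smooth_on E S g"
  shows "smooth_on E S (\<lambda>x. f (g x))"
  using assms k_smooth_on_compose[OF assms(1-5)] unfolding smooth_on_def by blast

lemma smooth_on_local:
  assumes "subspace E" "openin (top_of_set E) S"
    and "\<And>x. x \<in> S \<Longrightarrow> \<exists>U. openin (top_of_set E) U \<and> x \<in> U \<and> smooth_on E (S \<inter> U) f"
  shows "smooth_on E S f"
  unfolding smooth_on_def
  by (intro allI k_smooth_on_local[OF assms(1,2)]) (use assms(3) in \<open>unfold smooth_on_def, blast\<close>)

lemma smooth_on_continuous: "smooth_on E S f \<Longrightarrow> continuous_on S f"
  unfolding smooth_on_def using k_smooth_on_continuous by blast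

lemma smooth_on_differentiable:
  assumes "smooth_on E S f" "x \<in> S"
  obtains f' where "(f has_derivative f') (at x within S)"
proof -
  have "k_smooth_on (Suc 0) E S f" using assms(1) by (simp only: smooth_on_def)
  then show ?thesis using that assms(2) by auto
qed

lemma smooth_on_dir_deriv:
  assumes E: "subspace E" "openin (top_of_set E) S" and "v \<in> E" "smooth_on E S f"
  shows "smooth_on E S (\<lambda>x. dir_deriv f x v)"
  unfolding smooth_on_def
proof
  fix k
  have "k_smooth_on (Suc k) E S f" using assms(4) by (simp only: smooth_on_def)
  then show "k_smooth_on k E S (\<lambda>x. dir_deriv f x v)"
    using assms(3) unfolding k_smooth_on_Suc_iff[OF E] by blast
qed

section \<open>Charts and smooth maps\<close>

lemma isCont_tendsto_nhds: "isCont f x \<Longrightarrow> (f \<longlongrightarrow> f x) (nhds x)"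
  by (simp add: isCont_def tendsto_at_iff_tendsto_nhds)

text \<open>It is enough that the curve stays in \<open>E\<close> near 0: continuity at 0 moves it
  into the relatively open \<open>S\<close>, where the derivative of \<open>f\<close> is
  available.\<close>

lemma curve_chain_rule:
  fixes f :: "'a::real_normed_vector \<Rightarrow> 'b::real_normed_vector"
  assumes S: "openin (top_of_set E) S" and f: "(f has_derivative f') (at z within S)" "z \<in> S"
    and g: "(g has_vector_derivative a) (at 0)" "g 0 = z" "\<forall>\<^sub>F s in nhds 0. g s \<in> E"
  shows "((\<lambda>s. f (g s)) has_vector_derivative f' a) (at 0)"
proof -
  obtain T where T: "open T" "S = E \<inter> T" using S by (auto simp: openin_open)
  have "isCont g 0" using g(1) by (rule has_vector_derivative_continuous)
  then have "(g \<longlongrightarrow> g 0) (nhds 0)" by (rule isCont_tendsto_nhds)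
  then have "\<forall>\<^sub>F s in nhds 0. g s \<in> T" using T f(2) g(2) by (auto dest!: topological_tendstoD)
  with g(3) have "\<forall>\<^sub>F s in nhds 0. g s \<in> S" by (rule eventually_elim2) (simp add: T(2))
  then obtain U where U: "open U" "0 \<in> U" "g ` U \<subseteq> S" by (auto simp: eventually_nhds)
  have 1: "(g has_derivative (\<lambda>s. s *\<^sub>R a)) (at 0 within U)"
    using g(1) by (auto simp: has_vector_derivative_def intro: has_derivative_at_withinI)
  have 2: "(f has_derivative f') (at (g 0) within g ` U)"
    using has_derivative_subset[OF f(1) U(3)] g(2) by simp
  have "((\<lambda>s. f (g s)) has_derivative (\<lambda>s. f' (s *\<^sub>R a))) (at 0 within U)"
    by (rule has_derivative_in_compose[OF 1 2])
  then have "((\<lambda>s. f (g s)) has_derivative (\<lambda>s. f' (s *\<^sub>R a))) (at 0)"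
    by (simp only: at_within_open[OF U(2,1)])
  moreover have "linear f'" using f(1) by (rule has_derivative_linear)
  ultimately show ?thesis by (simp add: has_vector_derivative_def linear_scale)
qed

text \<open>The topological half of \<open>smooth_atlas\<close>, on which composition of smooth maps
  rests; it passes to products by \<open>topological_atlas_prod\<close>.\<close>

definition topological_atlas ::
  "'p::topological_space set \<Rightarrow> 'e::euclidean_space set \<Rightarrow> ('p, 'e) chart set \<Rightarrow> bool" where
  "topological_atlas M E \<A> \<longleftrightarrow>
     subspace E \<and> (\<forall>c\<in>\<A>. is_chart M E c) \<and> \<Union> (fst ` \<A>) = M"

lemma smooth_atlas_topological: "smooth_atlas M E \<A> \<Longrightarrow> topological_atlas M E \<A>"
  by (simp add: smooth_atlas_def topological_atlas_def)

lemma topological_atlasD: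
  assumes "topological_atlas M E \<A>"
  shows "subspace E" "\<And>c. c \<in> \<A> \<Longrightarrow> is_chart M E c" "\<And>p. p \<in> M \<Longrightarrow> \<exists>c\<in>\<A>. p \<in> fst c"
  using assms by (auto simp: topological_atlas_def)

lemma is_chartD:
  assumes "is_chart M E c"
  shows "openin (top_of_set M) (fst c)" "openin (top_of_set E) (chart_image c)"
    "fst c \<subseteq> M" "chart_image c \<subseteq> E"
    "p \<in> fst c \<Longrightarrow> chart_inv c (snd c p) = p"
    "u \<in> chart_image c \<Longrightarrow> chart_inv c u \<in> fst c"
    "u \<in> chart_image c \<Longrightarrow> snd c (chart_inv c u) = u"
    "continuous_on (fst c) (snd c)" "continuous_on (chart_image c) (chart_inv c)"
  using assms by (auto simp: is_chart_def homeomorphism_def dest: openin_imp_subset)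

lemma chart_inv_in: "is_chart M E c \<Longrightarrow> u \<in> snd c ` (fst c \<inter> W) \<Longrightarrow> chart_inv c u \<in> fst c \<inter> W"
  by (auto simp: is_chartD(5))

lemma is_chart_inj: "is_chart M E c \<Longrightarrow> inj_on (snd c) (fst c)"
  by (metis inj_onI is_chartD(5))

lemma is_chartI:
  assumes "openin (top_of_set M) (fst c)" "openin (top_of_set E) (chart_image c)"
    and "inj_on (snd c) (fst c)" "continuous_on (fst c) (snd c)" "continuous_on (chart_image c) (chart_inv c)"
  shows "is_chart M E c"
  using assms by (auto simp: is_chart_def homeomorphism_def inv_into_image_cancel)

lemma openin_chart_preimage:
  assumes c: "is_chart M E c" and h: "continuous_on M h" "h ` M \<subseteq> N"
    and W: "openin (top_of_set N) W"
  shows "openin (top_of_set E) (snd c ` (fst c \<inter> h -` W))"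
proof -
  note cd = is_chartD[OF c]
  have "snd c ` (fst c \<inter> h -` W) = chart_image c \<inter> (\<lambda>u. h (chart_inv c u)) -` W"
    using cd(5,6,7) by (force simp: image_iff)
  moreover have "openin (top_of_set (chart_image c)) (chart_image c \<inter> (\<lambda>u. h (chart_inv c u)) -` W)"
  proof (rule continuous_openin_preimage[OF _ _ W])
    show "continuous_on (chart_image c) (\<lambda>u. h (chart_inv c u))"
      using cd(3,6) by (intro continuous_on_compose2[OF h(1) cd(9)]) auto
    show "(\<lambda>u. h (chart_inv c u)) \<in> chart_image c \<rightarrow> N"
      using h(2) cd(3,6) by blast
  qed
  ultimately show ?thesis using cd(2) openin_trans by metis
qed

lemma chart_transition_openin:
  assumes "is_chart M E c" "is_chart M E' d"
  shows "openin (top_of_set E) (snd c ` (fst c \<inter> fst d))"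
  using openin_chart_preimage[OF assms(1), of "\<lambda>x. x" M "fst d"] is_chartD(1)[OF assms(2)] by simp

lemma smooth_mapD:
  assumes "smooth_map M E \<A> N \<B> h"
  shows "h ` M \<subseteq> N" "continuous_on M h"
    "c \<in> \<A> \<Longrightarrow> d \<in> \<B> \<Longrightarrow> smooth_on E (snd c ` (fst c \<inter> h -` fst d)) (\<lambda>u. snd d (h (chart_inv c u)))"
  using assms by (auto simp: smooth_map_def comp_def)

lemma smooth_mapI:
  assumes "h ` M \<subseteq> N" "continuous_on M h"
    "\<And>c d. c \<in> \<A> \<Longrightarrow> d \<in> \<B> \<Longrightarrow> smooth_on E (snd c ` (fst c \<inter> h -` fst d)) (\<lambda>u. snd d (h (chart_inv c u)))"
  shows "smooth_map M E \<A> N \<B> h"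
  using assms by (auto simp: smooth_map_def comp_def)

text \<open>Smoothness is tested near each point, where a chart \<open>b\<close> of the middle
  manifold can be inserted between the two coordinate expressions.\<close>

lemma smooth_map_compose:
  assumes A: "topological_atlas M E \<A>" and B: "topological_atlas N F \<B>" and C: "topological_atlas P K \<C>"
    and h: "smooth_map M E \<A> N \<B> h" and g: "smooth_map N F \<B> P \<C> g"
  shows "smooth_map M E \<A> P \<C> (\<lambda>p. g (h p))"
proof (rule smooth_mapI)
  note hD = smooth_mapD[OF h] and gD = smooth_mapD[OF g]
  show "(\<lambda>p. g (h p)) ` M \<subseteq> P" using hD(1) gD(1) by blast
  show cgh: "continuous_on M (\<lambda>p. g (h p))" using hD(1,2) gD(2) by (auto intro: continuous_on_compose2)
  fix c d assume c: "c \<in> \<A>" and d: "d \<in> \<C>"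
  note cc = topological_atlasD(2)[OF A c] and dc = topological_atlasD(2)[OF C d]
  let ?S = "snd c ` (fst c \<inter> (\<lambda>p. g (h p)) -` fst d)"
  have S: "openin (top_of_set E) ?S"
    using hD(1) gD(1) by (intro openin_chart_preimage[OF cc cgh _ is_chartD(1)[OF dc]]) blast
  show "smooth_on E ?S (\<lambda>u. snd d (g (h (chart_inv c u))))"
  proof (rule smooth_on_local[OF topological_atlasD(1)[OF A] S])
    fix z assume "z \<in> ?S"
    then obtain p where p: "z = snd c p" "p \<in> fst c" "g (h p) \<in> fst d" by auto
    have "h p \<in> N" using p(2) is_chartD(3)[OF cc] hD(1) by blast
    then obtain b where b: "b \<in> \<B>" "h p \<in> fst b" using topological_atlasD(3)[OF B] by blast
    note bc = topological_atlasD(2)[OF B b(1)]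
    let ?U = "snd c ` (fst c \<inter> h -` fst b)"
    have U: "openin (top_of_set E) ?U"
      by (rule openin_chart_preimage[OF cc hD(2,1) is_chartD(1)[OF bc]])
    let ?R = "snd b ` (fst b \<inter> g -` fst d)"
    have R: "openin (top_of_set F) ?R"
      by (rule openin_chart_preimage[OF bc gD(2,1) is_chartD(1)[OF dc]])
    have inS: "chart_inv c u \<in> fst c" "h (chart_inv c u) \<in> fst b" "g (h (chart_inv c u)) \<in> fst d"
      if "u \<in> ?S \<inter> ?U" for u
      using chart_inv_in[OF cc, of u "h -` fst b"] chart_inv_in[OF cc, of u "(\<lambda>p. g (h p)) -` fst d"] that
      by auto
    have "smooth_on E (?S \<inter> ?U) (\<lambda>u. (\<lambda>v. snd d (g (chart_inv b v))) (snd b (h (chart_inv c u))))"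
    proof (rule smooth_on_compose[OF topological_atlasD(1)[OF A] _ topological_atlasD(1)[OF B] R])
      show "openin (top_of_set E) (?S \<inter> ?U)" using S U by blast
      show "(\<lambda>u. snd b (h (chart_inv c u))) ` (?S \<inter> ?U) \<subseteq> ?R"
        using inS by blast
      show "smooth_on F ?R (\<lambda>v. snd d (g (chart_inv b v)))" using gD(3)[OF b(1) d] .
      show "smooth_on E (?S \<inter> ?U) (\<lambda>u. snd b (h (chart_inv c u)))"
        by (rule smooth_on_subset[OF hD(3)[OF c b(1)]]) blast
    qed
    moreover have "smooth_on E (?S \<inter> ?U) (\<lambda>u. (\<lambda>v. snd d (g (chart_inv b v))) (snd b (h (chart_inv c u)))) \<longleftrightarrow>
        smooth_on E (?S \<inter> ?U) (\<lambda>u. snd d (g (h (chart_inv c u))))"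
      by (rule smooth_on_cong) (simp only: is_chartD(5)[OF bc inS(2)])
    moreover have "z \<in> ?U" using p b by blast
    ultimately show "\<exists>U. openin (top_of_set E) U \<and> z \<in> U \<and>
        smooth_on E (?S \<inter> U) (\<lambda>u. snd d (g (h (chart_inv c u))))"
      using U by blast
  qed
qed

lemma smooth_map_const:
  assumes "p \<in> N"
  shows "smooth_map M E \<A> N \<B> (\<lambda>_. p)"
  using assms by (intro smooth_mapI) (auto intro: smooth_on_const)

lemma smooth_map_ident:
  assumes "smooth_atlas M E \<A>"
  shows "smooth_map M E \<A> M \<A> (\<lambda>p. p)"
  using assms by (intro smooth_mapI) (auto simp: smooth_atlas_def comp_def)

subsection \<open>Products\<close>

lemma chart_inv_prod:
  assumes "is_chart M E c" "is_chart N F d" "u \<in> chart_image c" "v \<in> chart_image d"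
  shows "chart_inv (fst c \<times> fst d, map_prod (snd c) (snd d)) (u, v) = (chart_inv c u, chart_inv d v)"
proof -
  have "inj_on (map_prod (snd c) (snd d)) (fst c \<times> fst d)"
    using is_chart_inj[OF assms(1)] is_chart_inj[OF assms(2)] by (rule map_prod_inj_on)
  moreover have "(u, v) = map_prod (snd c) (snd d) (chart_inv c u, chart_inv d v)"
    using is_chartD(7)[OF assms(1,3)] is_chartD(7)[OF assms(2,4)] by simp
  ultimately show ?thesis
    using is_chartD(6)[OF assms(1,3)] is_chartD(6)[OF assms(2,4)]
    by (simp only: fst_conv snd_conv) (simp add: inv_into_f_eq)
qed

lemma is_chart_prod:
  assumes c: "is_chart M E c" and d: "is_chart N F d"
  shows "is_chart (M \<times> N) (E \<times> F) (fst c \<times> fst d, map_prod (snd c) (snd d))"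
proof (rule is_chartI)
  let ?p = "(fst c \<times> fst d, map_prod (snd c) (snd d))"
  have im: "chart_image ?p = chart_image c \<times> chart_image d" by force
  show "openin (top_of_set (M \<times> N)) (fst ?p)"
    using is_chartD(1)[OF c] is_chartD(1)[OF d] by (simp add: openin_Times)
  show "openin (top_of_set (E \<times> F)) (chart_image ?p)"
    unfolding im using is_chartD(2)[OF c] is_chartD(2)[OF d] by (rule openin_Times)
  show "inj_on (snd ?p) (fst ?p)" using is_chart_inj[OF c] is_chart_inj[OF d] by (simp add: map_prod_inj_on)
  have "continuous_on (fst c \<times> fst d) (\<lambda>z. (snd c (fst z), snd d (snd z)))"
    by (auto intro!: continuous_on_Pair continuous_on_compose2[OF is_chartD(8)[OF c]]
        continuous_on_compose2[OF is_chartD(8)[OF d]] continuous_intros)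
  then show "continuous_on (fst ?p) (snd ?p)" by (simp add: map_prod_def case_prod_beta)
  have "continuous_on (chart_image c \<times> chart_image d) (\<lambda>z. (chart_inv c (fst z), chart_inv d (snd z)))"
    by (auto intro!: continuous_on_Pair continuous_on_compose2[OF is_chartD(9)[OF c]]
        continuous_on_compose2[OF is_chartD(9)[OF d]] continuous_intros)
  then show "continuous_on (chart_image ?p) (chart_inv ?p)"
    unfolding im using chart_inv_prod[OF c d] by (elim continuous_on_eq) auto
qed

lemma prod_atlasE:
  assumes "p \<in> prod_atlas \<A> \<B>"
  obtains c d where "p = (fst c \<times> fst d, map_prod (snd c) (snd d))" "c \<in> \<A>" "d \<in> \<B>"
  using assms unfolding prod_atlas_def by blast

lemma topological_atlas_prod:
  assumes A: "topological_atlas M E \<A>" and B: "topological_atlas N F \<B>"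
  shows "topological_atlas (M \<times> N) (E \<times> F) (prod_atlas \<A> \<B>)"
proof -
  have "\<Union> (fst ` prod_atlas \<A> \<B>) = \<Union> (fst ` \<A>) \<times> \<Union> (fst ` \<B>)"
    unfolding prod_atlas_def by (force simp: image_iff)
  moreover have "subspace (E \<times> F)" using A B by (auto simp: topological_atlas_def intro: subspace_Times)
  moreover have "is_chart (M \<times> N) (E \<times> F) p" if "p \<in> prod_atlas \<A> \<B>" for p
  proof -
    obtain c d where "p = (fst c \<times> fst d, map_prod (snd c) (snd d))" "c \<in> \<A>" "d \<in> \<B>"
      using \<open>p \<in> prod_atlas \<A> \<B>\<close> by (rule prod_atlasE)
    then show ?thesis using A B by (simp add: topological_atlas_def is_chart_prod)
  qed
  ultimately show ?thesis using A B by (simp add: topological_atlas_def)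
qed

lemma smooth_map_Pair:
  assumes f: "smooth_map M E \<A> N \<B> f" and g: "smooth_map M E \<A> P \<C> g"
  shows "smooth_map M E \<A> (N \<times> P) (prod_atlas \<B> \<C>) (\<lambda>p. (f p, g p))"
proof (rule smooth_mapI)
  note fD = smooth_mapD[OF f] and gD = smooth_mapD[OF g]
  show "(\<lambda>p. (f p, g p)) ` M \<subseteq> N \<times> P" using fD(1) gD(1) by blast
  show "continuous_on M (\<lambda>p. (f p, g p))" using fD(2) gD(2) by (rule continuous_on_Pair)
  fix c d assume c: "c \<in> \<A>" and "d \<in> prod_atlas \<B> \<C>"
  from this(2) obtain d1 d2 where d: "d = (fst d1 \<times> fst d2, map_prod (snd d1) (snd d2))" "d1 \<in> \<B>" "d2 \<in> \<C>"
    by (rule prod_atlasE)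
  have "smooth_on E (snd c ` (fst c \<inter> (\<lambda>p. (f p, g p)) -` fst d))
     (\<lambda>u. (snd d1 (f (chart_inv c u)), snd d2 (g (chart_inv c u))))"
  proof (rule smooth_on_Pair)
    show "smooth_on E (snd c ` (fst c \<inter> (\<lambda>p. (f p, g p)) -` fst d)) (\<lambda>u. snd d1 (f (chart_inv c u)))"
      by (rule smooth_on_subset[OF fD(3)[OF c d(2)]]) (auto simp: d(1))
    show "smooth_on E (snd c ` (fst c \<inter> (\<lambda>p. (f p, g p)) -` fst d)) (\<lambda>u. snd d2 (g (chart_inv c u)))"
      by (rule smooth_on_subset[OF gD(3)[OF c d(3)]]) (auto simp: d(1))
  qed
  then show "smooth_on E (snd c ` (fst c \<inter> (\<lambda>p. (f p, g p)) -` fst d)) (\<lambda>u. snd d (f (chart_inv c u), g (chart_inv c u)))"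
    by (simp add: d(1))
qed

text \<open>In product charts a projection is a linear projection followed by a transition map of
  one factor.\<close>

lemma
  assumes A: "smooth_atlas M E \<A>" and B: "smooth_atlas N F \<B>"
  shows smooth_map_fst: "smooth_map (M \<times> N) (E \<times> F) (prod_atlas \<A> \<B>) M \<A> fst"
    and smooth_map_snd: "smooth_map (M \<times> N) (E \<times> F) (prod_atlas \<A> \<B>) N \<B> snd"
proof -
  note At = smooth_atlas_topological[OF A] and Bt = smooth_atlas_topological[OF B]
  have EF: "subspace (E \<times> F)" using topological_atlas_prod[OF At Bt] by (rule topological_atlasD)
  show "smooth_map (M \<times> N) (E \<times> F) (prod_atlas \<A> \<B>) M \<A> fst"
  proof (rule smooth_mapI)
    show "continuous_on (M \<times> N) fst" by (intro continuous_intros)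
    fix c d assume cp: "c \<in> prod_atlas \<A> \<B>" and d: "d \<in> \<A>"
    from cp obtain c1 c2 where c: "c = (fst c1 \<times> fst c2, map_prod (snd c1) (snd c2))" "c1 \<in> \<A>" "c2 \<in> \<B>"
      by (rule prod_atlasE)
    note cc = topological_atlasD(2)[OF At c(2)] topological_atlasD(2)[OF Bt c(3)]
      and dc = topological_atlasD(2)[OF At d]
    let ?S = "snd c ` (fst c \<inter> fst -` fst d)" and ?R = "snd c1 ` (fst c1 \<inter> fst d)"
    have "smooth_on (E \<times> F) ?S (\<lambda>u. (\<lambda>v. snd d (chart_inv c1 v)) (fst u))"
    proof (rule smooth_on_compose[where f="\<lambda>v. snd d (chart_inv c1 v)" and g=fst, OF EF _ topological_atlasD(1)[OF At] chart_transition_openin[OF cc(1) dc]])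
      show "openin (top_of_set (E \<times> F)) ?S"
        using topological_atlasD(2)[OF topological_atlas_prod[OF At Bt] cp]
        by (rule openin_chart_preimage[OF _ _ _ is_chartD(1)[OF dc]]) (auto intro: continuous_intros)
      show "smooth_on E ?R (\<lambda>v. snd d (chart_inv c1 v))" using A c(2) d by (auto simp: smooth_atlas_def comp_def)
      show "smooth_on (E \<times> F) ?S fst" by (intro smooth_on_linear bounded_linear_fst)
    qed (auto simp: c(1))
    moreover have "chart_inv c u = (chart_inv c1 (fst u), chart_inv c2 (snd u))" if "u \<in> ?S" for u
      using that chart_inv_prod[OF cc, of "fst u" "snd u"] by (auto simp: c(1))
    ultimately show "smooth_on (E \<times> F) ?S (\<lambda>u. snd d (fst (chart_inv c u)))"
      by (subst smooth_on_cong[where g="\<lambda>u. snd d (chart_inv c1 (fst u))"]) auto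
  qed auto
  show "smooth_map (M \<times> N) (E \<times> F) (prod_atlas \<A> \<B>) N \<B> snd"
  proof (rule smooth_mapI)
    show "continuous_on (M \<times> N) snd" by (intro continuous_intros)
    fix c d assume cp: "c \<in> prod_atlas \<A> \<B>" and d: "d \<in> \<B>"
    from cp obtain c1 c2 where c: "c = (fst c1 \<times> fst c2, map_prod (snd c1) (snd c2))" "c1 \<in> \<A>" "c2 \<in> \<B>"
      by (rule prod_atlasE)
    note cc = topological_atlasD(2)[OF At c(2)] topological_atlasD(2)[OF Bt c(3)]
      and dc = topological_atlasD(2)[OF Bt d]
    let ?S = "snd c ` (fst c \<inter> snd -` fst d)" and ?R = "snd c2 ` (fst c2 \<inter> fst d)"
    have "smooth_on (E \<times> F) ?S (\<lambda>u. (\<lambda>v. snd d (chart_inv c2 v)) (snd u))"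
    proof (rule smooth_on_compose[where f="\<lambda>v. snd d (chart_inv c2 v)" and g=snd, OF EF _ topological_atlasD(1)[OF Bt] chart_transition_openin[OF cc(2) dc]])
      show "openin (top_of_set (E \<times> F)) ?S"
        using topological_atlasD(2)[OF topological_atlas_prod[OF At Bt] cp]
        by (rule openin_chart_preimage[OF _ _ _ is_chartD(1)[OF dc]]) (auto intro: continuous_intros)
      show "smooth_on F ?R (\<lambda>v. snd d (chart_inv c2 v))" using B c(3) d by (auto simp: smooth_atlas_def comp_def)
      show "smooth_on (E \<times> F) ?S snd" by (intro smooth_on_linear bounded_linear_snd)
    qed (auto simp: c(1))
    moreover have "chart_inv c u = (chart_inv c1 (fst u), chart_inv c2 (snd u))" if "u \<in> ?S" for u
      using that chart_inv_prod[OF cc, of "fst u" "snd u"] by (auto simp: c(1))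
    ultimately show "smooth_on (E \<times> F) ?S (\<lambda>u. snd d (snd (chart_inv c u)))"
      by (subst smooth_on_cong[where g="\<lambda>u. snd d (chart_inv c2 (snd u))"]) auto
  qed auto
qed

subsection \<open>Linear spaces\<close>

lemma inv_into_id_eq: "u \<in> E \<Longrightarrow> inv_into E id u = u"
  using inv_into_f_f[of id E u] by simp

lemma smooth_atlas_linear:
  assumes "subspace E"
  shows "smooth_atlas E E (linear_atlas E)"
proof -
  have "is_chart E E (E, id)"
    by (rule is_chartI) (auto intro!: continuous_on_eq[OF continuous_on_id] simp: inv_into_id_eq)
  moreover have "smooth_on E E (inv_into E id)"
    using smooth_on_linear[OF bounded_linear_ident, of E E]
    by (subst smooth_on_cong[where g="\<lambda>u. u"]) (auto simp: inv_into_id_eq)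
  ultimately show ?thesis using assms by (auto simp: smooth_atlas_def linear_atlas_def)
qed

lemma smooth_map_linear_atlas:
  assumes h: "smooth_on E E h" "h ` E \<subseteq> F"
  shows "smooth_map E E (linear_atlas E) F (linear_atlas F) h"
proof (rule smooth_mapI[OF h(2) smooth_on_continuous[OF h(1)]])
  have "E \<inter> h -` F = E" using h(2) by auto
  moreover have "smooth_on E E (\<lambda>u. h (inv_into E id u))"
    using h(1) by (subst smooth_on_cong[where g=h]) (auto simp: inv_into_id_eq)
  ultimately show "smooth_on E (snd c ` (fst c \<inter> h -` fst d)) (\<lambda>u. snd d (h (chart_inv c u)))"
    if "c \<in> linear_atlas E" "d \<in> linear_atlas F" for c d
    using that by (simp add: linear_atlas_def)
qed

lemma smooth_map_from_linear:
  assumes "smooth_map E E (linear_atlas E) N \<B> h" "d \<in> \<B>"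
  shows "smooth_on E (E \<inter> h -` fst d) (\<lambda>u. snd d (h u))"
proof -
  have "smooth_on E (E \<inter> h -` fst d) (\<lambda>u. snd d (h (inv_into E id u)))"
    using smooth_mapD(3)[OF assms(1) _ assms(2), of "(E, id)"] by (simp add: linear_atlas_def)
  then show ?thesis by (subst (asm) smooth_on_cong[where g="\<lambda>u. snd d (h u)"]) (auto simp: inv_into_id_eq)
qed

text \<open>The differential of \<open>h\<close> in coordinates, tested on curves.\<close>
lemma smooth_map_curve:
  assumes A: "topological_atlas M E \<A>" and B: "topological_atlas N F \<B>"
    and h: "smooth_map M E \<A> N \<B> h" and c: "c \<in> \<A>" "p \<in> fst c" and d: "d \<in> \<B>" "h p \<in> fst d"
  obtains h' where "linear h'"
    "\<And>\<gamma> a. \<gamma> 0 = p \<Longrightarrow> \<forall>\<^sub>F s in nhds 0. \<gamma> s \<in> fst c \<Longrightarrow>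
       ((\<lambda>s. snd c (\<gamma> s)) has_vector_derivative a) (at 0) \<Longrightarrow>
       ((\<lambda>s. snd d (h (\<gamma> s))) has_vector_derivative h' a) (at 0)"
proof -
  note cc = topological_atlasD(2)[OF A c(1)] and dc = topological_atlasD(2)[OF B d(1)]
  note hD = smooth_mapD[OF h]
  let ?S = "snd c ` (fst c \<inter> h -` fst d)"
  have S: "openin (top_of_set E) ?S" by (rule openin_chart_preimage[OF cc hD(2,1) is_chartD(1)[OF dc]])
  have p: "snd c p \<in> ?S" using c(2) d(2) by blast
  obtain h' where h': "((\<lambda>u. snd d (h (chart_inv c u))) has_derivative h') (at (snd c p) within ?S)"
    by (rule smooth_on_differentiable[OF hD(3)[OF c(1) d(1)] p])
  show ?thesis
  proof (rule that[of h'])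
    show "linear h'" using h' by (rule has_derivative_linear)
    fix \<gamma> a assume \<gamma>: "\<gamma> 0 = p" "\<forall>\<^sub>F s in nhds 0. \<gamma> s \<in> fst c"
      "((\<lambda>s. snd c (\<gamma> s)) has_vector_derivative a) (at 0)"
    have "((\<lambda>s. snd d (h (chart_inv c (snd c (\<gamma> s))))) has_vector_derivative h' a) (at 0)"
      by (rule curve_chain_rule[OF S h' p \<gamma>(3)])
        (use \<gamma>(1,2) is_chartD(4)[OF cc] in \<open>auto elim!: eventually_mono\<close>)
    moreover have "\<forall>\<^sub>F s in nhds 0. snd d (h (chart_inv c (snd c (\<gamma> s)))) = snd d (h (\<gamma> s))"
      using \<gamma>(2) is_chartD(5)[OF cc] by (auto elim!: eventually_mono)
    ultimately show "((\<lambda>s. snd d (h (\<gamma> s))) has_vector_derivative h' a) (at 0)"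
      by (simp add: has_vector_derivative_cong_nhds)
  qed
qed

section \<open>Lie groups in a chart at the unit element\<close>

locale lie_group_chart =
  fixes G :: "'g::t2_space monoid" (structure) and \<gg> :: "'v::euclidean_space set"
    and \<A> :: "('g, 'v) chart set" and c :: "('g, 'v) chart"
  assumes lie: "lie_group G \<gg> \<A>" and c: "c \<in> \<A>" "\<one> \<in> fst c"
begin

sublocale group G using lie by (simp add: lie_group_def)

lemma smooth_atlas_G: "smooth_atlas (carrier G) \<gg> \<A>"
  using lie by (simp add: lie_group_def)

lemma inv_mult_cancel: "p \<in> carrier G \<Longrightarrow> q \<in> carrier G \<Longrightarrow> inv p \<otimes> (p \<otimes> q) = q"
  by (simp add: m_assoc[symmetric])

lemmas atlas_G = smooth_atlas_topological[OF smooth_atlas_G]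
lemmas atlas_GG = topological_atlas_prod[OF atlas_G atlas_G]
lemmas subspace_\<gg> = topological_atlasD(1)[OF atlas_G]
lemmas chart_c = topological_atlasD(2)[OF atlas_G c(1)]

lemma smooth_mult:
  "smooth_map (carrier G \<times> carrier G) (\<gg> \<times> \<gg>) (prod_atlas \<A> \<A>) (carrier G) \<A> (\<lambda>p. fst p \<otimes> snd p)"
  using lie by (simp add: lie_group_def case_prod_beta')

lemma smooth_mult_of:
  assumes "topological_atlas M E \<B>"
    and "smooth_map M E \<B> (carrier G) \<A> f" "smooth_map M E \<B> (carrier G) \<A> g"
  shows "smooth_map M E \<B> (carrier G) \<A> (\<lambda>p. f p \<otimes> g p)"
  using smooth_map_compose[OF assms(1) atlas_GG atlas_G smooth_map_Pair[OF assms(2,3)] smooth_mult] by simp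

lemma smooth_inv_of:
  assumes "topological_atlas M E \<B>" and "smooth_map M E \<B> (carrier G) \<A> f"
  shows "smooth_map M E \<B> (carrier G) \<A> (\<lambda>p. inv f p)"
proof -
  have "smooth_map (carrier G) \<gg> \<A> (carrier G) \<A> (\<lambda>x. inv x)"
    using lie by (simp add: lie_group_def)
  from smooth_map_compose[OF assms(1) atlas_G atlas_G assms(2) this] show ?thesis .
qed

lemma smooth_left_mult:
  assumes "p \<in> carrier G"
  shows "smooth_map (carrier G) \<gg> \<A> (carrier G) \<A> (\<lambda>q. p \<otimes> q)"
  by (rule smooth_mult_of[OF atlas_G smooth_map_const[OF assms] smooth_map_ident[OF smooth_atlas_G]])

lemma smooth_conj:
  "smooth_map (carrier G \<times> carrier G) (\<gg> \<times> \<gg>) (prod_atlas \<A> \<A>) (carrier G) \<A>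
     (\<lambda>p. fst p \<otimes> snd p \<otimes> inv (fst p))"
  using smooth_map_fst[OF smooth_atlas_G smooth_atlas_G] smooth_map_snd[OF smooth_atlas_G smooth_atlas_G]
  by (intro smooth_mult_of smooth_inv_of atlas_GG)

text \<open>Conjugation of \<open>q\<close> by \<open>p\<close> as a function of both elements, each
  read in the chart \<open>c\<close>. \<open>Ad\<close> is its derivative in the second variable at
  the unit, and the bracket is a mixed second derivative, so smoothness of this one function
  controls both.\<close>

definition conj_coord :: "'v \<times> 'v \<Rightarrow> 'v" where
  "conj_coord z = snd c (chart_inv c (fst z) \<otimes> chart_inv c (snd z) \<otimes> inv (chart_inv c (fst z)))"

definition conj_dom :: "('v \<times> 'v) set" where
  "conj_dom = {z \<in> chart_image c \<times> chart_image c.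
     chart_inv c (fst z) \<otimes> chart_inv c (snd z) \<otimes> inv (chart_inv c (fst z)) \<in> fst c}"

lemma
  shows conj_dom_openin: "openin (top_of_set (\<gg> \<times> \<gg>)) conj_dom"
    and conj_coord_smooth: "smooth_on (\<gg> \<times> \<gg>) conj_dom conj_coord"
proof -
  let ?cc = "(fst c \<times> fst c, map_prod (snd c) (snd c))"
  let ?h = "\<lambda>p. fst p \<otimes> snd p \<otimes> inv (fst p)"
  have cc: "?cc \<in> prod_atlas \<A> \<A>" using c(1) unfolding prod_atlas_def by blast
  note ccc = topological_atlasD(2)[OF atlas_GG cc]
  have dom: "snd ?cc ` (fst ?cc \<inter> ?h -` fst c) = conj_dom" (is "?L = _")
  proof (intro equalityI subsetI)
    fix z assume "z \<in> ?L"
    then obtain p q where pq: "z = (snd c p, snd c q)" "p \<in> fst c" "q \<in> fst c" "p \<otimes> q \<otimes> inv p \<in> fst c"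
      by auto
    then show "z \<in> conj_dom" unfolding conj_dom_def by (simp add: is_chartD(5)[OF chart_c])
  next
    fix z assume z: "z \<in> conj_dom"
    then have "fst z \<in> chart_image c" "snd z \<in> chart_image c" by (auto simp: conj_dom_def)
    note inv = is_chartD(6,7)[OF chart_c this(1)] is_chartD(6,7)[OF chart_c this(2)]
    show "z \<in> ?L"
      by (rule image_eqI[of _ _ "(chart_inv c (fst z), chart_inv c (snd z))"])
        (use z inv in \<open>auto simp: conj_dom_def\<close>)
  qed
  note hD = smooth_mapD[OF smooth_conj]
  show "openin (top_of_set (\<gg> \<times> \<gg>)) conj_dom"
    using openin_chart_preimage[OF ccc hD(2,1) is_chartD(1)[OF chart_c]] unfolding dom .
  have "smooth_on (\<gg> \<times> \<gg>) conj_dom (\<lambda>u. snd c (?h (chart_inv ?cc u)))"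
    using hD(3)[OF cc c(1)] unfolding dom .
  moreover have "snd c (?h (chart_inv ?cc u)) = conj_coord u" if "u \<in> conj_dom" for u
  proof -
    have "chart_inv ?cc (fst u, snd u) = (chart_inv c (fst u), chart_inv c (snd u))"
      by (rule chart_inv_prod[OF chart_c chart_c]) (use that in \<open>auto simp: conj_dom_def\<close>)
    then have "chart_inv ?cc u = (chart_inv c (fst u), chart_inv c (snd u))"
      by (simp only: prod.collapse)
    then show ?thesis by (simp only: conj_coord_def fst_conv snd_conv)
  qed
  ultimately show "smooth_on (\<gg> \<times> \<gg>) conj_dom conj_coord" by (simp only: cong: smooth_on_cong)
qed

text \<open>Immediate from the definitions, since \<open>chart_line\<close> is the coordinate line
  through the unit.\<close>

lemma Ad_conj_coord:
  "Ad G c (chart_inv c u) W = dir_deriv conj_coord (u, snd c \<one>) (0, W)"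
  by (simp add: Ad_def unit_velocity_def dir_deriv_def conj_coord_def chart_line_def)

text \<open>Left multiplication by \<open>inv p\<close> has a linear differential in coordinates,
  and a linear map sends 0 to 0. This moves a vanishing velocity from an arbitrary chart
  \<open>e\<close> around \<open>p\<close> to the chart \<open>c\<close> at the unit.\<close>

lemma unit_velocity_left_mult:
  assumes p: "p \<in> fst e" "e \<in> \<A>" and \<gamma>: "\<gamma> 0 = p" "\<forall>\<^sub>F s in nhds 0. \<gamma> s \<in> fst e"
    and 0: "((\<lambda>s. snd e (\<gamma> s)) has_vector_derivative 0) (at 0)"
  shows "((\<lambda>s. snd c (inv p \<otimes> \<gamma> s)) has_vector_derivative 0) (at 0)"
proof -
  have pG: "p \<in> carrier G" using is_chartD(3)[OF topological_atlasD(2)[OF atlas_G p(2)]] p(1) by blast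
  obtain h' where h': "linear h'"
    "\<And>\<gamma> a. \<gamma> 0 = p \<Longrightarrow> \<forall>\<^sub>F s in nhds 0. \<gamma> s \<in> fst e \<Longrightarrow>
       ((\<lambda>s. snd e (\<gamma> s)) has_vector_derivative a) (at 0) \<Longrightarrow>
       ((\<lambda>s. snd c (inv p \<otimes> \<gamma> s)) has_vector_derivative h' a) (at 0)"
  proof (rule smooth_map_curve[OF atlas_G atlas_G smooth_left_mult p(2,1) c(1)])
    show "inv p \<in> carrier G" using pG by simp
    show "inv p \<otimes> p \<in> fst c" using pG c(2) by simp
  qed blast
  show ?thesis using h'(2)[OF \<gamma> 0] linear_0[OF h'(1)] by simp
qed

end

section \<open>Tori\<close>

locale lie_group_torus = lie_group_chart G \<gg> \<A> c
  for G :: "'g::t2_space monoid" (structure) and \<gg> :: "'v::euclidean_space set"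
    and \<A> :: "('g, 'v) chart set" and c :: "('g, 'v) chart" +
  fixes B :: "'v set" and \<rho> :: "'v \<Rightarrow> 'g"
  assumes B: "independent B"
    and \<rho>_smooth: "smooth_map (span B) (span B) (linear_atlas (span B)) (carrier G) \<A> \<rho>"
    and \<rho>_add: "\<And>u w. u \<in> span B \<Longrightarrow> w \<in> span B \<Longrightarrow> \<rho> (u + w) = \<rho> u \<otimes> \<rho> w"
    and \<rho>_kernel: "{w \<in> span B. \<rho> w = \<one>} = {(\<Sum>b\<in>B. of_int (n b) *\<^sub>R b) | n. True}"
begin

lemma finite_B: "finite B" using B by (rule independent_imp_finite)

lemma \<rho>_lattice: "\<rho> (\<Sum>b\<in>B. of_int (n b) *\<^sub>R b) = \<one>"
  using \<rho>_kernel by blast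

lemma \<rho>_0: "\<rho> 0 = \<one>" using \<rho>_lattice[of "\<lambda>_. 0"] by simp

lemma \<rho>_carrier: "w \<in> span B \<Longrightarrow> \<rho> w \<in> carrier G"
  using smooth_mapD(1)[OF \<rho>_smooth] by blast

lemma \<rho>_continuous: "continuous_on (span B) \<rho>" by (rule smooth_mapD(2)[OF \<rho>_smooth])

lemma \<rho>_minus: "w \<in> span B \<Longrightarrow> \<rho> (- w) = inv \<rho> w"
  using \<rho>_add[of "- w" w] \<rho>_0 by (intro inv_equality[symmetric]) (auto simp: \<rho>_carrier span_neg)

lemma \<rho>_diff: "u \<in> span B \<Longrightarrow> w \<in> span B \<Longrightarrow> \<rho> (u - w) = \<rho> u \<otimes> inv \<rho> w"
  using \<rho>_add[of u "- w"] by (simp add: \<rho>_minus span_neg)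

lemma \<rho>_eq_iff: "u \<in> span B \<Longrightarrow> w \<in> span B \<Longrightarrow> \<rho> u = \<rho> w \<longleftrightarrow> \<rho> (u - w) = \<one>"
  by (metis \<rho>_diff \<rho>_carrier inv_closed inv_equality inv_inv r_inv)

text \<open>A linear map \<open>g\<close> that sends \<open>B\<close> injectively into the standard
  orthonormal basis turns lattice coefficients into inner products. A nonzero lattice vector
  therefore has an image of norm at least 1, and the operator bound \<open>K\<close> of
  \<open>g\<close> gives the radius \<open>1 / K\<close>.\<close>

lemma lattice_discrete:
  obtains \<epsilon> where "\<epsilon> > 0" "\<And>w. w \<in> span B \<Longrightarrow> \<rho> w = \<one> \<Longrightarrow> norm w < \<epsilon> \<Longrightarrow> w = 0"
proof -
  have "card B \<le> card (Basis :: 'v set)" using independent_bound[OF B] by simp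
  then obtain f :: "'v \<Rightarrow> 'v" where f: "f ` B \<subseteq> Basis" "inj_on f B"
    using card_le_inj[OF finite_B finite_Basis] by blast
  obtain g :: "'v \<Rightarrow> 'v" where g: "linear g" "\<forall>x\<in>B. g x = f x"
    using linear_independent_extend[OF B, of f] by blast
  have "bounded_linear g" using g(1) by (rule linear_conv_bounded_linear[THEN iffD1])
  then obtain K where K: "K > 0" "\<And>x. norm (g x) \<le> norm x * K"
    using bounded_linear.pos_bounded by blast
  show ?thesis
  proof (rule that[of "1 / K"])
    show "1 / K > 0" using K by simp
    fix w assume w: "w \<in> span B" "\<rho> w = \<one>" "norm w < 1 / K"
    then obtain n where n: "w = (\<Sum>b\<in>B. of_int (n b) *\<^sub>R b)" using \<rho>_kernel by blast
    have "n b = 0" if b: "b \<in> B" for b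
    proof -
      have "g w = (\<Sum>a\<in>B. of_int (n a) *\<^sub>R f a)"
        unfolding n linear_sum[OF g(1)] using g(2) by (simp add: linear_scale[OF g(1)])
      then have "g w \<bullet> f b = (\<Sum>a\<in>B. of_int (n a) * (f a \<bullet> f b))" by (simp add: inner_sum_left)
      also have "\<dots> = (\<Sum>a\<in>B. if a = b then of_int (n b) else 0)"
      proof (rule sum.cong)
        fix a assume a: "a \<in> B"
        have "f a \<bullet> f b = (if a = b then 1 else 0)"
          using f a b inj_on_eq_iff[OF f(2) a b] by (simp add: inner_Basis image_subset_iff)
        then show "of_int (n a) * (f a \<bullet> f b) = (if a = b then of_int (n b) else 0)" by simp
      qed simp
      also have "\<dots> = of_int (n b)" using b finite_B by simp
      finally have "\<bar>of_int (n b)\<bar> \<le> norm (g w)"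
        using Basis_le_norm[of "f b" "g w"] f(1) b by (simp add: image_subset_iff)
      also have "\<dots> \<le> norm w * K" by (rule K)
      also have "\<dots> < 1" using w(3) K(1) by (simp add: field_simps)
      finally show ?thesis by linarith
    qed
    then show "w = 0" unfolding n by simp
  qed
qed

text \<open>Every element of the torus has a preimage in a fixed compact set, so the image under \<open>\<rho>\<close> of the
  complement of a periodic open set is compact, hence closed.\<close>
lemma \<rho>_open:
  assumes W: "openin (top_of_set (span B)) W"
  shows "openin (top_of_set (\<rho> ` span B)) (\<rho> ` W)"
proof -
  \<comment> \<open>\<open>R\<close> bounds the fundamental cell of vectors with all coefficients in
    [0,1), so the compact set \<open>Q\<close> contains a representative of every class.
    \<open>X\<close> is the set of all lattice translates of points of \<open>W\<close>.\<close>
  define R where "R = (\<Sum>b\<in>B. norm b)"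
  define Q where "Q = span B \<inter> cball 0 R"
  define X where "X = span B \<inter> \<rho> -` \<rho> ` W"
  have WB: "W \<subseteq> span B" using W by (rule openin_imp_subset)
  have fund: "\<exists>q\<in>Q. \<rho> q = \<rho> w" if w: "w \<in> span B" for w
  proof -
    obtain u where u: "w = (\<Sum>b\<in>B. u b *\<^sub>R b)" using w span_finite[OF finite_B] by auto
    define q where "q = (\<Sum>b\<in>B. frac (u b) *\<^sub>R b)"
    have "norm q \<le> (\<Sum>b\<in>B. norm (frac (u b) *\<^sub>R b))" unfolding q_def by (rule norm_sum)
    also have "\<dots> \<le> R" unfolding R_def
    proof (rule sum_mono)
      fix b
      have "\<bar>frac (u b)\<bar> \<le> 1" using frac_lt_1[of "u b"] frac_ge_0[of "u b"] by linarith
      then have "\<bar>frac (u b)\<bar> * norm b \<le> 1 * norm b" by (rule mult_right_mono) simp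
      then show "norm (frac (u b) *\<^sub>R b) \<le> norm b" by simp
    qed
    finally have "q \<in> Q" unfolding Q_def q_def by (simp add: span_sum span_scale span_base)
    moreover have "w - q = (\<Sum>b\<in>B. of_int \<lfloor>u b\<rfloor> *\<^sub>R b)"
      unfolding u q_def sum_subtractf[symmetric] by (rule sum.cong) (simp_all add: frac_def algebra_simps)
    then have "\<rho> (w - q) = \<one>" by (simp only: \<rho>_lattice)
    then have "\<rho> q = \<rho> w" using \<rho>_eq_iff[OF w, of q] \<open>q \<in> Q\<close> unfolding Q_def by simp
    ultimately show ?thesis by blast
  qed
  have "openin (top_of_set (span B)) X"
  proof (subst openin_subopen, intro ballI)
    fix w assume w: "w \<in> X"
    then obtain w0 where w0: "w0 \<in> W" "\<rho> w = \<rho> w0" "w \<in> span B" unfolding X_def by auto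
    \<comment> \<open>The difference \<open>w0 - w\<close> lies in the kernel, so translating
      \<open>W\<close> back by it gives a neighbourhood of \<open>w\<close> inside
      \<open>X\<close>.\<close>
    let ?Y = "span B \<inter> (\<lambda>v. v + (w0 - w)) -` W"
    have "openin (top_of_set (span B)) ?Y"
      using w0 WB by (intro continuous_openin_preimage[OF _ _ W] continuous_intros) (auto intro!: span_add span_diff)
    moreover have "w \<in> ?Y" using w0 by simp
    moreover have "?Y \<subseteq> X"
    proof
      fix v assume v: "v \<in> ?Y"
      have "\<rho> (w0 - w) = \<one>" using \<rho>_eq_iff[of w0 w] w0 WB by auto
      then have "\<rho> (v + (w0 - w)) = \<rho> v" using v w0 WB by (subst \<rho>_add) (auto intro!: span_diff simp: \<rho>_carrier)
      then show "v \<in> X" using v unfolding X_def by (metis (no_types, lifting) IntD1 IntD2 IntI image_eqI vimageD vimageI)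
    qed
    ultimately show "\<exists>T. openin (top_of_set (span B)) T \<and> w \<in> T \<and> T \<subseteq> X" by blast
  qed
  then obtain O' where O': "open O'" "X = span B \<inter> O'" by (auto simp: openin_open)
  have "compact Q" unfolding Q_def using closed_span compact_cball
    by (rule closed_Int_compact)
  then have "compact (Q - O')" using O'(1) by (rule compact_diff)
  moreover have "continuous_on (Q - O') \<rho>"
    by (rule continuous_on_subset[OF \<rho>_continuous]) (auto simp: Q_def)
  ultimately have "closed (\<rho> ` (Q - O'))"
    by (intro compact_imp_closed compact_continuous_image)
  \<comment> \<open>Since \<open>X\<close> is a union of full fibres of \<open>\<rho>\<close>, a
    point of the torus lies outside the image of \<open>W\<close> exactly when its representative in
    \<open>Q\<close> avoids \<open>O'\<close>.\<close>
  moreover have "\<rho> ` W = \<rho> ` span B \<inter> - \<rho> ` (Q - O')"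
  proof (intro equalityI subsetI)
    fix t assume "t \<in> \<rho> ` W"
    moreover have "t \<notin> \<rho> ` (Q - O')"
    proof
      assume "t \<in> \<rho> ` (Q - O')"
      then obtain q where "q \<in> Q" "q \<notin> O'" "t = \<rho> q" by blast
      then have "q \<in> X" using \<open>t \<in> \<rho> ` W\<close> unfolding X_def Q_def by auto
      then show False using O'(2) \<open>q \<notin> O'\<close> by blast
    qed
    ultimately show "t \<in> \<rho> ` span B \<inter> - \<rho> ` (Q - O')" using WB by blast
  next
    fix t assume t: "t \<in> \<rho> ` span B \<inter> - \<rho> ` (Q - O')"
    then obtain w where "w \<in> span B" "t = \<rho> w" by blast
    then obtain q where q: "q \<in> Q" "\<rho> q = t" using fund by blast
    then have "q \<in> O'" using t by blast
    then have "q \<in> X" using q(1) O'(2) unfolding Q_def by blast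
    then show "t \<in> \<rho> ` W" using q(2) unfolding X_def by blast
  qed
  ultimately show ?thesis by (metis openin_open_Int open_Compl)
qed

subsection \<open>The differential at the unit element\<close>

definition exp_dom :: "'v set" where "exp_dom = span B \<inter> \<rho> -` fst c"

text \<open>Only the values on \<open>span B\<close> are determined by \<open>\<rho>\<close>;
  elsewhere the choice is arbitrary, but \<open>d\<rho>\<close> is linear on the whole
  space.\<close>

definition d\<rho> :: "'v \<Rightarrow> 'v" where
  "d\<rho> = (SOME D. ((\<lambda>w. snd c (\<rho> w)) has_derivative D) (at 0 within exp_dom))"

lemma exp_dom_openin: "openin (top_of_set (span B)) exp_dom"
  unfolding exp_dom_def
  using continuous_openin_preimage[OF \<rho>_continuous _ is_chartD(1)[OF chart_c]] \<rho>_carrier by blast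

lemma zero_exp_dom: "0 \<in> exp_dom" using c(2) by (simp add: exp_dom_def span_zero \<rho>_0)

lemma d\<rho>: "((\<lambda>w. snd c (\<rho> w)) has_derivative d\<rho>) (at 0 within exp_dom)"
proof -
  have "smooth_on (span B) exp_dom (\<lambda>w. snd c (\<rho> w))"
    unfolding exp_dom_def by (rule smooth_map_from_linear[OF \<rho>_smooth c(1)])
  then obtain D where "((\<lambda>w. snd c (\<rho> w)) has_derivative D) (at 0 within exp_dom)"
    using zero_exp_dom by (rule smooth_on_differentiable)
  then show ?thesis unfolding d\<rho>_def by (rule someI[where P="\<lambda>D. (_ has_derivative D) _"])
qed

lemma linear_d\<rho>: "linear d\<rho>" using d\<rho> by (rule has_derivative_linear)

lemma eventually_exp_dom: "w \<in> span B \<Longrightarrow> \<forall>\<^sub>F s in nhds 0. s *\<^sub>R w \<in> exp_dom"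
  using eventually_line_in_openin[OF subspace_span exp_dom_openin zero_exp_dom] by simp

lemma eventually_\<rho>_chart: "w \<in> span B \<Longrightarrow> \<forall>\<^sub>F s in nhds 0. \<rho> (s *\<^sub>R w) \<in> fst c"
  using eventually_exp_dom[of w] by (rule eventually_mono) (auto simp: exp_dom_def)

lemma d\<rho>_curve:
  "w \<in> span B \<Longrightarrow> ((\<lambda>s. snd c (\<rho> (s *\<^sub>R w))) has_vector_derivative d\<rho> w) (at 0)"
  using has_derivative_imp_line[OF subspace_span exp_dom_openin zero_exp_dom _ d\<rho>, of w] by simp

lemma d\<rho>_in: "w \<in> span B \<Longrightarrow> d\<rho> w \<in> \<gg>"
  by (rule has_vector_derivative_in_subspace[OF subspace_\<gg> d\<rho>_curve], assumption,
      rule eventually_mono[OF eventually_\<rho>_chart], assumption)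
    (use is_chartD(4)[OF chart_c] in blast)

text \<open>If the derivative vanished on \<open>w\<close>, then \<open>s \<mapsto> \<rho> (s w)\<close>, being a homomorphism, would be locally
  constant, contradicting the discreteness of the kernel.\<close>
lemma d\<rho>_inj:
  assumes w: "w \<in> span B" and Dw: "d\<rho> w = 0"
  shows "w = 0"
proof (rule ccontr)
  assume "w \<noteq> 0"
  obtain \<delta> where \<delta>: "\<delta> > 0" "\<And>s. \<bar>s\<bar> < \<delta> \<Longrightarrow> \<rho> (s *\<^sub>R w) \<in> fst c"
    using eventually_\<rho>_chart[OF w] by (auto simp: eventually_nhds_metric)
  obtain \<epsilon> where \<epsilon>: "\<epsilon> > 0" "\<And>w. w \<in> span B \<Longrightarrow> \<rho> w = \<one> \<Longrightarrow> norm w < \<epsilon> \<Longrightarrow> w = 0"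
    by (rule lattice_discrete) blast
  \<comment> \<open>The homomorphism property carries the vanishing derivative from 0 to every
    \<open>s0\<close>: near \<open>s0\<close> the curve is the left translate by
    \<open>\<rho> (s0 *\<^sub>R w)\<close> of the curve near 0.\<close>
  have deriv: "((\<lambda>s. snd c (\<rho> (s *\<^sub>R w))) has_vector_derivative 0) (at s0 within ball 0 \<delta>)"
    if s0: "s0 \<in> ball 0 \<delta>" for s0
  proof -
    let ?p = "\<rho> (s0 *\<^sub>R w)"
    have p: "?p \<in> fst c" using \<delta>(2) s0 by (simp add: dist_norm)
    have pG: "?p \<in> carrier G" using \<rho>_carrier w by (simp add: span_scale)
    obtain h' where h': "linear h'"
      "\<And>\<gamma> a. \<gamma> 0 = \<one> \<Longrightarrow> \<forall>\<^sub>F s in nhds 0. \<gamma> s \<in> fst c \<Longrightarrow>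
       ((\<lambda>s. snd c (\<gamma> s)) has_vector_derivative a) (at 0) \<Longrightarrow>
       ((\<lambda>s. snd c (?p \<otimes> \<gamma> s)) has_vector_derivative h' a) (at 0)"
      by (rule smooth_map_curve[OF atlas_G atlas_G smooth_left_mult[OF pG] c c(1)]) (use p pG in auto)
    have "((\<lambda>s. snd c (?p \<otimes> \<rho> (s *\<^sub>R w))) has_vector_derivative h' (d\<rho> w)) (at 0)"
      by (rule h'(2)) (simp_all add: \<rho>_0 eventually_\<rho>_chart[OF w] d\<rho>_curve[OF w])
    moreover have "?p \<otimes> \<rho> (s *\<^sub>R w) = \<rho> ((s0 + s) *\<^sub>R w)" for s
      using w by (simp add: \<rho>_add[symmetric] span_scale scaleR_add_left)
    ultimately have "((\<lambda>s. snd c (\<rho> ((s0 + s) *\<^sub>R w))) has_vector_derivative 0) (at (s0 - s0))"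
      using Dw linear_0[OF h'(1)] by simp
    moreover have "((\<lambda>s. s - s0) has_vector_derivative 1) (at s0)"
      by (auto intro!: derivative_eq_intros)
    ultimately have "(((\<lambda>s. snd c (\<rho> ((s0 + s) *\<^sub>R w))) \<circ> (\<lambda>s. s - s0)) has_vector_derivative (1 *\<^sub>R 0)) (at s0)"
      by (intro vector_diff_chain_at)
    then show ?thesis by (simp add: comp_def has_vector_derivative_at_within)
  qed
  obtain k where k: "\<And>s. s \<in> ball 0 \<delta> \<Longrightarrow> snd c (\<rho> (s *\<^sub>R w)) = k"
    using has_vector_derivative_zero_constant[OF convex_ball deriv] by metis
  \<comment> \<open>The bound by \<open>\<delta>\<close> keeps the point in the chart, where equal
    coordinates mean equal group elements; the bound by \<open>\<epsilon>\<close> makes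
    \<open>s *\<^sub>R w\<close> too short for a nonzero lattice vector.\<close>
  define s where "s = min (\<delta> / 2) (\<epsilon> / (2 * norm w))"
  have s: "0 < s" "s < \<delta>" using \<delta>(1) \<epsilon>(1) \<open>w \<noteq> 0\<close> by (auto simp: s_def)
  have "s * norm w \<le> \<epsilon> / (2 * norm w) * norm w" by (rule mult_right_mono) (auto simp: s_def)
  also have "\<dots> < \<epsilon>" using \<epsilon>(1) \<open>w \<noteq> 0\<close> by simp
  finally have small: "norm (s *\<^sub>R w) < \<epsilon>" using s by simp
  have "snd c (\<rho> (s *\<^sub>R w)) = snd c \<one>" using k[of s] k[of 0] s \<delta>(1) by (simp add: \<rho>_0 dist_norm)
  then have "\<rho> (s *\<^sub>R w) = \<one>"
    using is_chart_inj[OF chart_c] \<delta>(2)[of s] c(2) s by (auto dest: inj_onD)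
  then have "s *\<^sub>R w = 0" using \<epsilon>(2)[OF span_scale[OF w] _ small] by simp
  then show False using s \<open>w \<noteq> 0\<close> by simp
qed

lemma subspace_d\<rho>: "subspace (d\<rho> ` span B)"
  using linear_d\<rho> subspace_span by (rule linear_subspace_image)

text \<open>A curve \<open>\<gamma>\<close> in the torus is \<open>\<rho> (w s)\<close> with small \<open>w s\<close> of size \<open>O(s)\<close>, hence its velocity is in
  the closure of the range of the derivative.\<close>
lemma velocity_in_d\<rho>:
  assumes \<gamma>: "smooth_map UNIV UNIV (linear_atlas UNIV) (carrier G) \<A> \<gamma>" "range \<gamma> \<subseteq> \<rho> ` span B" "\<gamma> 0 = \<one>"
  shows "unit_velocity c \<gamma> \<in> d\<rho> ` span B"
proof -
  define g where "g s = snd c (\<gamma> s)" for s :: real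
  have cont: "continuous_on UNIV \<gamma>" by (rule smooth_mapD(2)[OF \<gamma>(1)])
  have sm: "smooth_on UNIV (UNIV \<inter> \<gamma> -` fst c) (\<lambda>s. snd c (\<gamma> s))"
    by (rule smooth_map_from_linear[OF \<gamma>(1) c(1)])
  have op: "openin (top_of_set UNIV) (UNIV \<inter> \<gamma> -` fst c)"
    by (rule continuous_openin_preimage[OF cont _ is_chartD(1)[OF chart_c]])
      (use smooth_mapD(1)[OF \<gamma>(1)] in blast)
  have mem: "0 \<in> UNIV \<inter> \<gamma> -` fst c" using \<gamma>(3) c(2) by simp
  obtain g' where g': "((\<lambda>s. snd c (\<gamma> s)) has_derivative g') (at 0 within (UNIV \<inter> \<gamma> -` fst c))"
    by (rule smooth_on_differentiable[OF sm mem])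
  have "((\<lambda>s. snd c (\<gamma> (0 + s *\<^sub>R 1))) has_vector_derivative g' 1) (at 0)"
    by (rule has_derivative_imp_line[OF subspace_UNIV op mem _ g']) simp
  then have dg: "(g has_vector_derivative g' 1) (at 0)" by (simp add: g_def[abs_def])
  then have vel: "unit_velocity c \<gamma> = g' 1"
    unfolding unit_velocity_def by (simp add: g_def[abs_def] vector_derivative_at)
  \<comment> \<open>An injective linear map on a finite-dimensional space is bounded below.\<close>
  obtain m where m: "m > 0" "\<And>w. w \<in> span B \<Longrightarrow> m * norm w \<le> norm (d\<rho> w)"
    using injective_imp_isometric[OF closed_span subspace_span
        linear_conv_bounded_linear[THEN iffD1, OF linear_d\<rho>]] d\<rho>_inj by (metis mult.commute)
  let ?N = "norm (g' 1) + 1"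
  have "g' 1 \<in> closure (d\<rho> ` span B)"
    unfolding closure_approachable
  proof (intro allI impI)
    fix \<eta> :: real assume \<eta>: "\<eta> > 0"
    \<comment> \<open>The bound \<open>m / 2\<close> absorbs the remainder of \<open>d\<rho>\<close>
      and yields \<open>norm w\<close> at most \<open>2 / m\<close> times the chord of
      \<open>g\<close>. The second bound then makes the remainder at most
      \<open>\<eta> / 2 * \<bar>s\<bar>\<close>, as the chord is at most
      \<open>?N * \<bar>s\<bar>\<close> once the quotient is within 1 of
      \<open>g' 1\<close>.\<close>
    define e where "e = min (m / 2) (m * \<eta> / (4 * ?N))"
    have N: "?N > 0" using norm_ge_zero[of "g' 1"] by linarith
    have e: "e > 0" using m(1) \<eta> N by (simp add: e_def)
    have e1: "e \<le> m / 2" unfolding e_def by (rule min.cobounded1)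
    have e2: "e \<le> m * \<eta> / (4 * ?N)" unfolding e_def by (rule min.cobounded2)
    obtain d where d: "d > 0"
      "\<And>w. w \<in> exp_dom \<Longrightarrow> norm w < d \<Longrightarrow> norm (snd c (\<rho> w) - snd c (\<rho> 0) - d\<rho> w) \<le> e * norm w"
      using d\<rho> e unfolding has_derivative_within_alt by fastforce
    \<comment> \<open>Here openness of \<open>\<rho>\<close> matters: a preimage of
      \<open>\<gamma> s\<close> could be far from 0, but for small \<open>s\<close> one exists in
      the ball where the linear approximation is good.\<close>
    have "openin (top_of_set (\<rho> ` span B)) (\<rho> ` (span B \<inter> ball 0 d))"
      by (rule \<rho>_open) (simp add: openin_open_Int)
    from continuous_openin_preimage[OF cont _ this] \<gamma>(2)
    have "openin (top_of_set UNIV) (UNIV \<inter> \<gamma> -` (\<rho> ` (span B \<inter> ball 0 d)))" by blast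
    moreover have "0 \<in> UNIV \<inter> \<gamma> -` (\<rho> ` (span B \<inter> ball 0 d))"
      using \<gamma>(3) \<rho>_0 d(1) span_zero[of B] by (auto intro!: image_eqI[of _ _ 0])
    ultimately have "\<forall>\<^sub>F s in nhds 0. \<gamma> s \<in> \<rho> ` (span B \<inter> ball 0 d)"
      using eventually_nhds_in_open by fastforce
    moreover have "\<forall>\<^sub>F s in nhds 0. \<gamma> s \<in> fst c"
      using op mem eventually_nhds_in_open by fastforce
    ultimately have "\<forall>\<^sub>F s in at 0. \<gamma> s \<in> \<rho> ` (span B \<inter> ball 0 d) \<and> \<gamma> s \<in> fst c"
      unfolding eventually_at_filter by (rule eventually_elim2) blast
    moreover have "\<forall>\<^sub>F s in at 0. dist ((g s - g 0) /\<^sub>R s) (g' 1) < min 1 (\<eta> / 2)"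
      using has_vector_derivative_quotient[OF dg] \<eta> by (intro tendstoD) auto
    moreover have "\<forall>\<^sub>F s in at (0::real). s \<noteq> 0" by (simp add: eventually_at_filter)
    ultimately have "\<forall>\<^sub>F s in at 0. (\<gamma> s \<in> \<rho> ` (span B \<inter> ball 0 d) \<and> \<gamma> s \<in> fst c) \<and>
        dist ((g s - g 0) /\<^sub>R s) (g' 1) < min 1 (\<eta> / 2) \<and> s \<noteq> 0"
      by (simp only: eventually_conj_iff)
    then obtain s where s: "\<gamma> s \<in> \<rho> ` (span B \<inter> ball 0 d)" "\<gamma> s \<in> fst c"
      "dist ((g s - g 0) /\<^sub>R s) (g' 1) < min 1 (\<eta> / 2)" "s \<noteq> 0"
      using eventually_happens'[OF trivial_limit_at] by blast
    then obtain w where w: "\<gamma> s = \<rho> w" "w \<in> span B" "norm w < d" by auto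
    let ?q = "(g s - g 0) /\<^sub>R s"
    have s_pos: "0 < \<bar>s\<bar>" using s(4) by simp
    have err: "norm (g s - g 0 - d\<rho> w) \<le> e * norm w"
      using d(2)[of w] w s(2) by (simp add: g_def \<gamma>(3) \<rho>_0 exp_dom_def)
    have "m * norm w \<le> norm (d\<rho> w)" using m w by simp
    also have "\<dots> = norm ((g s - g 0) - (g s - g 0 - d\<rho> w))" by simp
    also have "\<dots> \<le> norm (g s - g 0) + norm (g s - g 0 - d\<rho> w)" by (rule norm_triangle_ineq4)
    also have "\<dots> \<le> norm (g s - g 0) + e * norm w" using err by simp
    also have "\<dots> \<le> norm (g s - g 0) + m / 2 * norm w"
      by (intro add_left_mono mult_right_mono e1) simp
    finally have bound: "norm w \<le> 2 / m * norm (g s - g 0)" using m(1) by (simp add: field_simps)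
    have "norm ?q \<le> ?N"
      using norm_triangle_ineq[of "?q - g' 1" "g' 1"] s(3) by (simp add: dist_norm)
    moreover have nq: "norm (v /\<^sub>R s) = norm v / \<bar>s\<bar>" for v :: 'v
      by (simp only: norm_scaleR abs_inverse divide_inverse mult.commute)
    ultimately have "norm (g s - g 0) / \<bar>s\<bar> \<le> ?N" by (simp only: nq)
    then have "norm (g s - g 0) \<le> \<bar>s\<bar> * ?N"
      by (subst mult.commute) (simp only: pos_divide_le_eq[OF s_pos])
    then have "2 / m * norm (g s - g 0) \<le> 2 / m * (\<bar>s\<bar> * ?N)"
      using m(1) by (intro mult_left_mono) auto
    with bound have "norm w \<le> 2 / m * (\<bar>s\<bar> * ?N)" by (rule order_trans)
    then have "e * norm w \<le> e * (2 / m * (\<bar>s\<bar> * ?N))" using e by (intro mult_left_mono) auto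
    also have "\<dots> \<le> (m * \<eta> / (4 * ?N)) * (2 / m * (\<bar>s\<bar> * ?N))"
      using m(1) N by (intro mult_right_mono e2) simp
    also have "\<dots> = \<eta> / 2 * \<bar>s\<bar>"
    proof -
      have "m * t / (4 * n) * (2 / m * (q * n)) = t / 2 * q" if "n > 0" for n t q :: real
        using m(1) that by (simp add: field_simps)
      then show ?thesis using N by blast
    qed
    finally have "norm (g s - g 0 - d\<rho> w) \<le> \<eta> / 2 * \<bar>s\<bar>" using err by simp
    moreover have "?q - d\<rho> (w /\<^sub>R s) = (g s - g 0 - d\<rho> w) /\<^sub>R s"
      by (simp add: linear_scale[OF linear_d\<rho>] algebra_simps)
    ultimately have "norm (?q - d\<rho> (w /\<^sub>R s)) \<le> \<eta> / 2"
      by (simp only: nq pos_divide_le_eq[OF s_pos])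
    moreover have "norm (?q - g' 1) < \<eta> / 2" using s(3) by (simp add: dist_norm)
    ultimately have "dist (d\<rho> (w /\<^sub>R s)) (g' 1) < \<eta>"
      using norm_triangle_ineq4[of "?q - g' 1" "?q - d\<rho> (w /\<^sub>R s)"] by (simp add: dist_norm)
    moreover have "d\<rho> (w /\<^sub>R s) \<in> d\<rho> ` span B" using w(2) by (simp add: span_scale)
    ultimately show "\<exists>y\<in>d\<rho> ` span B. dist y (g' 1) < \<eta>" by blast
  qed
  then show ?thesis unfolding vel using closed_subspace[OF subspace_d\<rho>] by (simp add: closure_closed)
qed

lemma lie_algebra_eq: "subgroup_lie_algebra G \<A> c (\<rho> ` span B) = d\<rho> ` span B"
proof (intro equalityI subsetI)
  fix v assume "v \<in> subgroup_lie_algebra G \<A> c (\<rho> ` span B)"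
  then show "v \<in> d\<rho> ` span B" using velocity_in_d\<rho> by (auto simp: subgroup_lie_algebra_def)
next
  fix v assume "v \<in> d\<rho> ` span B"
  then obtain w where w: "w \<in> span B" "v = d\<rho> w" by blast
  have "smooth_map UNIV UNIV (linear_atlas UNIV) (span B) (linear_atlas (span B)) (\<lambda>s::real. s *\<^sub>R w)"
    using w(1) by (intro smooth_map_linear_atlas smooth_on_linear bounded_linear_scaleR_left)
      (auto intro: span_scale)
  from smooth_map_compose[OF smooth_atlas_topological[OF smooth_atlas_linear[OF subspace_UNIV]]
      smooth_atlas_topological[OF smooth_atlas_linear[OF subspace_span]] atlas_G this \<rho>_smooth]
  have "smooth_map UNIV UNIV (linear_atlas UNIV) (carrier G) \<A> (\<lambda>s::real. \<rho> (s *\<^sub>R w))" .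
  moreover have "range (\<lambda>s::real. \<rho> (s *\<^sub>R w)) \<subseteq> \<rho> ` span B" using w(1) by (auto intro: span_scale)
  moreover have "unit_velocity c (\<lambda>s. \<rho> (s *\<^sub>R w)) = v"
    unfolding unit_velocity_def w(2) by (rule vector_derivative_at[OF d\<rho>_curve[OF w(1)]])
  ultimately show "v \<in> subgroup_lie_algebra G \<A> c (\<rho> ` span B)"
    unfolding subgroup_lie_algebra_def using \<rho>_0 by (auto intro!: exI[of _ "\<lambda>s. \<rho> (s *\<^sub>R w)"])
qed

subsection \<open>The Lie algebra of a torus is abelian\<close>

text \<open>Conjugation by \<open>\<rho> u\<close> fixes every
  \<open>\<rho> (t *\<^sub>R m)\<close>, because addition in \<open>span B\<close> commutes.
  Differentiating at \<open>t = 0\<close> gives the claim; the chain rule passes from the curve in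
  the torus to the coordinate line used by \<open>dir_deriv\<close>.\<close>

lemma Ad_torus:
  assumes u: "u \<in> exp_dom" "(snd c (\<rho> u), snd c \<one>) \<in> conj_dom" and m: "m \<in> span B"
  shows "dir_deriv conj_coord (snd c (\<rho> u), snd c \<one>) (0, d\<rho> m) = d\<rho> m"
proof -
  let ?z = "(snd c (\<rho> u), snd c \<one>)"
  have uB: "u \<in> span B" "\<rho> u \<in> fst c" using u(1) by (auto simp: exp_dom_def)
  obtain A' where A': "(conj_coord has_derivative A') (at ?z within conj_dom)"
    by (rule smooth_on_differentiable[OF conj_coord_smooth u(2)])
  have EE: "subspace (\<gg> \<times> \<gg>)" using subspace_\<gg> by (intro subspace_Times)
  have dd: "dir_deriv conj_coord ?z (0, d\<rho> m) = A' (0, d\<rho> m)"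
    by (rule dir_deriv_eq[OF EE conj_dom_openin u(2) _ A'])
      (simp add: d\<rho>_in m subspace_0[OF subspace_\<gg>])
  have "((\<lambda>t. conj_coord (snd c (\<rho> u), snd c (\<rho> (t *\<^sub>R m)))) has_vector_derivative A' (0, d\<rho> m)) (at 0)"
  proof (rule curve_chain_rule[OF conj_dom_openin A' u(2)])
    show "((\<lambda>t. (snd c (\<rho> u), snd c (\<rho> (t *\<^sub>R m)))) has_vector_derivative (0, d\<rho> m)) (at 0)"
      by (intro has_vector_derivative_Pair has_vector_derivative_const d\<rho>_curve m)
    show "\<forall>\<^sub>F s in nhds 0. (snd c (\<rho> u), snd c (\<rho> (s *\<^sub>R m))) \<in> \<gg> \<times> \<gg>"
      using eventually_\<rho>_chart[OF m] by (rule eventually_mono) (use uB is_chartD(4)[OF chart_c] in blast)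
  qed (simp add: \<rho>_0)
  moreover have "\<forall>\<^sub>F t in nhds 0. conj_coord (snd c (\<rho> u), snd c (\<rho> (t *\<^sub>R m))) = snd c (\<rho> (t *\<^sub>R m))"
    using eventually_\<rho>_chart[OF m]
  proof (rule eventually_mono)
    fix t assume t: "\<rho> (t *\<^sub>R m) \<in> fst c"
    have tB: "t *\<^sub>R m \<in> span B" using m by (rule span_scale)
    have "\<rho> u \<otimes> \<rho> (t *\<^sub>R m) \<otimes> inv \<rho> u = \<rho> (u + t *\<^sub>R m - u)"
      using uB tB by (simp only: \<rho>_add \<rho>_diff span_add)
    then show "conj_coord (snd c (\<rho> u), snd c (\<rho> (t *\<^sub>R m))) = snd c (\<rho> (t *\<^sub>R m))"
      by (simp add: conj_coord_def is_chartD(5)[OF chart_c] uB t)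
  qed
  ultimately have "((\<lambda>t. snd c (\<rho> (t *\<^sub>R m))) has_vector_derivative A' (0, d\<rho> m)) (at 0)"
    by (simp only: has_vector_derivative_cong_nhds)
  from vector_derivative_unique_at[OF this d\<rho>_curve[OF m]] dd show ?thesis by simp
qed

text \<open>The bracket is defined along \<open>chart_line\<close>, which may leave the torus. As
  \<open>Ad\<close> depends smoothly on the conjugating element, only the velocity of the curve
  counts, so the line may be replaced by \<open>\<rho> (s *\<^sub>R n)\<close>, along which
  \<open>Ad\<close> fixes \<open>d\<rho> m\<close>.\<close>

lemma lie_bracket_torus:
  assumes n: "n \<in> span B" and m: "m \<in> span B"
  shows "lie_bracket G c (d\<rho> n) (d\<rho> m) = 0"
proof -
  let ?z = "(snd c \<one>, snd c \<one>)" and ?f = "\<lambda>z. dir_deriv conj_coord z (0, d\<rho> m)"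
  have EE: "subspace (\<gg> \<times> \<gg>)" using subspace_\<gg> by (intro subspace_Times)
  have z: "?z \<in> conj_dom" using c(2) by (simp add: conj_dom_def is_chartD(5)[OF chart_c])
  have m0: "(0, d\<rho> m) \<in> \<gg> \<times> \<gg>" and n0: "(d\<rho> n, 0) \<in> \<gg> \<times> \<gg>"
    using d\<rho>_in[OF n] d\<rho>_in[OF m] subspace_0[OF subspace_\<gg>] by auto
  have "smooth_on (\<gg> \<times> \<gg>) conj_dom ?f"
    by (rule smooth_on_dir_deriv[OF EE conj_dom_openin m0 conj_coord_smooth])
  then obtain f' where f': "(?f has_derivative f') (at ?z within conj_dom)"
    using z by (rule smooth_on_differentiable)
  have "((\<lambda>s. ?f (?z + s *\<^sub>R (d\<rho> n, 0))) has_vector_derivative f' (d\<rho> n, 0)) (at 0)"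
    by (rule has_derivative_imp_line[OF EE conj_dom_openin z n0 f'])
  moreover have "\<forall>\<^sub>F s in nhds 0. ?f (?z + s *\<^sub>R (d\<rho> n, 0)) = Ad G c (chart_line G c (d\<rho> n) s) (d\<rho> m)"
    using eventually_line_in_openin[OF EE conj_dom_openin z n0]
    by (rule eventually_mono) (simp add: chart_line_def Ad_conj_coord)
  ultimately have "((\<lambda>s. Ad G c (chart_line G c (d\<rho> n) s) (d\<rho> m)) has_vector_derivative f' (d\<rho> n, 0)) (at 0)"
    by (simp only: has_vector_derivative_cong_nhds)
  then have br: "lie_bracket G c (d\<rho> n) (d\<rho> m) = f' (d\<rho> n, 0)"
    unfolding lie_bracket_def by (rule vector_derivative_at)
  let ?\<gamma> = "\<lambda>s. (snd c (\<rho> (s *\<^sub>R n)), snd c \<one>)"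
  have d\<gamma>: "(?\<gamma> has_vector_derivative (d\<rho> n, 0)) (at 0)"
    by (intro has_vector_derivative_Pair has_vector_derivative_const d\<rho>_curve n)
  have ev\<gamma>: "\<forall>\<^sub>F s in nhds 0. ?\<gamma> s \<in> \<gg> \<times> \<gg>"
    using eventually_\<rho>_chart[OF n] by (rule eventually_mono) (use c(2) is_chartD(4)[OF chart_c] in blast)
  have "((\<lambda>s. ?f (?\<gamma> s)) has_vector_derivative f' (d\<rho> n, 0)) (at 0)"
    by (rule curve_chain_rule[OF conj_dom_openin f' z d\<gamma> _ ev\<gamma>]) (simp add: \<rho>_0)
  moreover have "\<forall>\<^sub>F s in nhds 0. ?f (?\<gamma> s) = d\<rho> m"
  proof -
    obtain O' where O': "open O'" "conj_dom = (\<gg> \<times> \<gg>) \<inter> O'"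
      using conj_dom_openin by (auto simp: openin_open)
    have "isCont ?\<gamma> 0" using d\<gamma> by (rule has_vector_derivative_continuous)
    then have "(?\<gamma> \<longlongrightarrow> ?\<gamma> 0) (nhds 0)" by (rule isCont_tendsto_nhds)
    then have "\<forall>\<^sub>F s in nhds 0. ?\<gamma> s \<in> O'"
      by (rule topological_tendstoD) (use O' z in \<open>auto simp: \<rho>_0\<close>)
    with ev\<gamma> have "\<forall>\<^sub>F s in nhds 0. ?\<gamma> s \<in> conj_dom"
      by (rule eventually_elim2) (simp only: O'(2) Int_iff)
    with eventually_exp_dom[OF n] show ?thesis
      by (rule eventually_elim2) (rule Ad_torus[OF _ _ m])
  qed
  ultimately have "((\<lambda>s. d\<rho> m) has_vector_derivative f' (d\<rho> n, 0)) (at 0)"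
    by (simp only: has_vector_derivative_cong_nhds)
  then have "f' (d\<rho> n, 0) = 0" using has_vector_derivative_const vector_derivative_unique_at by blast
  then show ?thesis using br by simp
qed

subsection \<open>Translates of the torus\<close>

text \<open>Translating \<open>x \<otimes> \<rho> (u + s *\<^sub>R v)\<close> back by its value at
  \<open>s = 0\<close> leaves \<open>\<rho> (s *\<^sub>R v)\<close>, so the velocity depends neither
  on \<open>x\<close> nor on \<open>u\<close>. The curve is prescribed only near 0, since inverse
  charts follow the parametrisation only there.\<close>

lemma left_velocity_translate:
  assumes x: "x \<in> carrier G" and uv: "u \<in> span B" "v \<in> span B"
    and \<gamma>: "\<forall>\<^sub>F s in nhds 0. \<gamma> s = (x \<otimes> \<rho> (u + s *\<^sub>R v), b + s *\<^sub>R a)"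
  shows "left_velocity G c \<gamma> = (d\<rho> v, a)"
proof -
  have 0: "fst (\<gamma> 0) = x \<otimes> \<rho> u" using eventually_nhds_x_imp_x[OF \<gamma>] by simp
  have "inv (x \<otimes> \<rho> u) \<otimes> (x \<otimes> \<rho> (u + s *\<^sub>R v)) = \<rho> (s *\<^sub>R v)" for s
  proof -
    have sv: "s *\<^sub>R v \<in> span B" using uv by (simp add: span_scale)
    have "x \<otimes> \<rho> (u + s *\<^sub>R v) = (x \<otimes> \<rho> u) \<otimes> \<rho> (s *\<^sub>R v)"
      using x uv sv by (simp add: \<rho>_add m_assoc \<rho>_carrier)
    then show ?thesis using x uv sv by (simp add: inv_mult_cancel \<rho>_carrier)
  qed
  then have "\<forall>\<^sub>F s in nhds 0. snd c (inv (fst (\<gamma> 0)) \<otimes> fst (\<gamma> s)) = snd c (\<rho> (s *\<^sub>R v))"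
    unfolding 0 using \<gamma> by (auto elim: eventually_mono)
  then have 1: "unit_velocity c (\<lambda>s. inv (fst (\<gamma> 0)) \<otimes> fst (\<gamma> s)) = d\<rho> v"
    unfolding unit_velocity_def
    using vector_derivative_cong_nhds vector_derivative_at[OF d\<rho>_curve[OF uv(2)]] by metis
  have "((\<lambda>s. b + s *\<^sub>R a) has_vector_derivative a) (at 0)"
    by (auto intro!: derivative_eq_intros)
  moreover have "\<forall>\<^sub>F s in nhds 0. snd (\<gamma> s) = b + s *\<^sub>R a" using \<gamma> by (auto elim: eventually_mono)
  ultimately have 2: "vector_derivative (\<lambda>s. snd (\<gamma> s)) (at 0) = a"
    using vector_derivative_cong_nhds vector_derivative_at by metis
  show ?thesis by (simp only: left_velocity_def 1 2)
qed

text \<open>Translation to the unit reduces the claim to injectivity of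
  \<open>d\<rho>\<close>.\<close>

lemma translate_immersion:
  assumes x: "x \<in> carrier G" and uv: "u \<in> span B" "v \<in> span B" and e: "e \<in> \<A>" "x \<otimes> \<rho> u \<in> fst e"
    and 0: "((\<lambda>s. snd e (x \<otimes> \<rho> (u + s *\<^sub>R v))) has_vector_derivative 0) (at 0)"
  shows "v = 0"
proof -
  have sv: "s *\<^sub>R v \<in> span B" for s using uv by (simp add: span_scale)
  have xmap: "smooth_map (span B) (span B) (linear_atlas (span B)) (carrier G) \<A> (\<lambda>w. x \<otimes> \<rho> w)"
    by (rule smooth_mult_of[OF smooth_atlas_topological[OF smooth_atlas_linear[OF subspace_span]]
          smooth_map_const[OF x] \<rho>_smooth])
  note xD = smooth_mapD[OF xmap]
  have "openin (top_of_set (span B)) (span B \<inter> (\<lambda>w. x \<otimes> \<rho> w) -` fst e)"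
    by (rule continuous_openin_preimage[OF xD(2) _ is_chartD(1)[OF topological_atlasD(2)[OF atlas_G e(1)]]])
      (use xD(1) in blast)
  from eventually_line_in_openin[OF subspace_span this _ uv(2), of u] e(2) uv(1)
  have ev: "\<forall>\<^sub>F s in nhds 0. x \<otimes> \<rho> (u + s *\<^sub>R v) \<in> fst e" by (auto elim: eventually_mono)
  have "((\<lambda>s. snd c (inv (x \<otimes> \<rho> u) \<otimes> (x \<otimes> \<rho> (u + s *\<^sub>R v)))) has_vector_derivative 0) (at 0)"
    by (rule unit_velocity_left_mult[OF e(2,1) _ ev 0]) simp
  moreover have "inv (x \<otimes> \<rho> u) \<otimes> (x \<otimes> \<rho> (u + s *\<^sub>R v)) = \<rho> (s *\<^sub>R v)" for s
  proof -
    have "x \<otimes> \<rho> (u + s *\<^sub>R v) = (x \<otimes> \<rho> u) \<otimes> \<rho> (s *\<^sub>R v)"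
      using x uv sv by (simp add: \<rho>_add m_assoc \<rho>_carrier)
    then show ?thesis using x uv sv by (simp add: inv_mult_cancel \<rho>_carrier)
  qed
  ultimately have "((\<lambda>s. snd c (\<rho> (s *\<^sub>R v))) has_vector_derivative 0) (at 0)" by simp
  from vector_derivative_unique_at[OF this d\<rho>_curve[OF uv(2)]] have "d\<rho> v = 0" by simp
  then show ?thesis by (rule d\<rho>_inj[OF uv(2)])
qed

end

section \<open>Submanifolds covered by a linear space\<close>

text \<open>\<open>\<Phi>\<close> is a covering of \<open>L\<close> by the linear space \<open>V\<close>, whose fibres are the orbits of a group of
  translations. Restricted to balls of radius \<open>r\<close> it is injective and yields charts with translations
  as coordinate changes.\<close>
locale translation_covering =
  fixes V :: "'e::euclidean_space set" and \<Phi> :: "'e \<Rightarrow> 'p::topological_space" and L :: "'p set" and r :: real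
  assumes V: "subspace V" and \<Phi>_cont: "continuous_on V \<Phi>" and \<Phi>_image: "\<Phi> ` V = L"
    and \<Phi>_open: "\<And>W. openin (top_of_set V) W \<Longrightarrow> openin (top_of_set L) (\<Phi> ` W)"
    and period: "\<And>z z' w. z \<in> V \<Longrightarrow> z' \<in> V \<Longrightarrow> w \<in> V \<Longrightarrow> \<Phi> z = \<Phi> z' \<Longrightarrow> \<Phi> (w + (z' - z)) = \<Phi> w"
    and discrete: "\<And>z z'. z \<in> V \<Longrightarrow> z' \<in> V \<Longrightarrow> \<Phi> z = \<Phi> z' \<Longrightarrow> norm (z - z') < 4 * r \<Longrightarrow> z = z'"
    and r: "r > 0"
begin

definition sheet :: "'e \<Rightarrow> 'e set" where "sheet a = V \<inter> ball a r"

definition sheet_chart :: "'e \<Rightarrow> ('p, 'e) chart" where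
  "sheet_chart a = (\<Phi> ` sheet a, inv_into (sheet a) \<Phi>)"

definition covering_atlas :: "('p, 'e) chart set" where "covering_atlas = sheet_chart ` V"

lemma sheet_openin: "openin (top_of_set V) (sheet a)"
  unfolding sheet_def by (rule openin_open_Int) simp

lemma sheet_dist: "z \<in> sheet a \<Longrightarrow> z' \<in> sheet a \<Longrightarrow> norm (z - z') < 2 * r"
  using norm_triangle_ineq4[of "a - z'" "a - z"] by (auto simp: sheet_def dist_norm)

lemma sheet_inj: "inj_on \<Phi> (sheet a)"
proof (rule inj_onI)
  fix z z' assume z: "z \<in> sheet a" "z' \<in> sheet a" "\<Phi> z = \<Phi> z'"
  show "z = z'" using discrete[of z z'] z sheet_dist[OF z(1,2)] r by (auto simp: sheet_def)
qed

lemma inv_sheet: "z \<in> sheet a \<Longrightarrow> inv_into (sheet a) \<Phi> (\<Phi> z) = z"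
  using sheet_inj by (rule inv_into_f_f)

lemma sheet_chart_image: "chart_image (sheet_chart a) = sheet a"
  by (simp add: sheet_chart_def inv_into_image_cancel[OF _ subset_refl] image_image inv_sheet)

lemma sheet_chart_inv:
  assumes z: "z \<in> sheet a"
  shows "chart_inv (sheet_chart a) z = \<Phi> z"
proof -
  have "inj_on (snd (sheet_chart a)) (fst (sheet_chart a))"
    unfolding sheet_chart_def fst_conv snd_conv by (rule inj_on_inv_into) simp
  moreover have "\<Phi> z \<in> fst (sheet_chart a)" using z by (simp add: sheet_chart_def)
  moreover have "snd (sheet_chart a) (\<Phi> z) = z" using z by (simp add: sheet_chart_def inv_sheet)
  ultimately show ?thesis by (metis inv_into_f_f)
qed

lemma is_chart_sheet: "is_chart L V (sheet_chart a)"
proof (rule is_chartI)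
  show "openin (top_of_set L) (fst (sheet_chart a))"
    unfolding sheet_chart_def fst_conv by (rule \<Phi>_open[OF sheet_openin])
  show "openin (top_of_set V) (chart_image (sheet_chart a))"
    unfolding sheet_chart_image by (rule sheet_openin)
  show "inj_on (snd (sheet_chart a)) (fst (sheet_chart a))"
    unfolding sheet_chart_def fst_conv snd_conv by (rule inj_on_inv_into) simp
  have cs: "continuous_on (sheet a) \<Phi>"
    by (rule continuous_on_subset[OF \<Phi>_cont]) (auto simp: sheet_def)
  show "continuous_on (fst (sheet_chart a)) (snd (sheet_chart a))"
    unfolding sheet_chart_def fst_conv snd_conv
  proof (rule continuous_on_inverse_open_map[OF cs refl])
    show "inv_into (sheet a) \<Phi> (\<Phi> z) = z" if "z \<in> sheet a" for z using that by (rule inv_sheet)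
    fix U assume U: "openin (top_of_set (sheet a)) U"
    then have "openin (top_of_set L) (\<Phi> ` U)" using sheet_openin openin_trans \<Phi>_open by blast
    moreover have "\<Phi> ` U \<subseteq> \<Phi> ` sheet a" using U openin_imp_subset by blast
    moreover have "\<Phi> ` sheet a \<subseteq> L" using \<Phi>_image by (auto simp: sheet_def)
    ultimately show "openin (top_of_set (\<Phi> ` sheet a)) (\<Phi> ` U)"
      by (rule openin_subset_trans)
  qed
  show "continuous_on (chart_image (sheet_chart a)) (chart_inv (sheet_chart a))"
    unfolding sheet_chart_image using cs by (elim continuous_on_eq) (simp add: sheet_chart_inv)
qed

lemma sheet_overlap:
  assumes "z \<in> snd (sheet_chart a) ` (fst (sheet_chart a) \<inter> W)"
  shows "z \<in> sheet a" "z \<in> V" "\<Phi> z \<in> W"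
proof -
  obtain p where p: "p \<in> fst (sheet_chart a)" "p \<in> W" "z = snd (sheet_chart a) p" using assms by blast
  then obtain z' where "z' \<in> sheet a" "p = \<Phi> z'" by (auto simp: sheet_chart_def)
  then have "z = z'" using p(3) by (simp add: sheet_chart_def inv_sheet)
  then show "z \<in> sheet a" "z \<in> V" "\<Phi> z \<in> W" using \<open>z' \<in> sheet a\<close> \<open>p = \<Phi> z'\<close> p by (auto simp: sheet_def)
qed

text \<open>Two lifts of one point differ by a period. Shifting \<open>z'\<close> by the period
  found at \<open>z\<close> gives a lift of the same point as the coordinate of \<open>z'\<close> in
  the second chart. The two lifts differ by less than \<open>2 * r + 2 * r\<close>, which is why
  \<open>discrete\<close> is stated with \<open>4 * r\<close>; so they coincide, and one shift
  serves the whole overlap, connected or not.\<close>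

lemma transition_translation:
  obtains l where "\<And>z. z \<in> snd (sheet_chart a) ` (fst (sheet_chart a) \<inter> fst (sheet_chart b)) \<Longrightarrow>
    snd (sheet_chart b) (chart_inv (sheet_chart a) z) = z + l"
proof -
  let ?S = "snd (sheet_chart a) ` (fst (sheet_chart a) \<inter> fst (sheet_chart b))"
  let ?\<tau> = "\<lambda>z. snd (sheet_chart b) (chart_inv (sheet_chart a) z)"
  have S: "?\<tau> z \<in> sheet b \<and> \<Phi> (?\<tau> z) = \<Phi> z" if "z \<in> ?S" for z
  proof -
    note zz = sheet_overlap[OF that]
    obtain w where w: "w \<in> sheet b" "\<Phi> z = \<Phi> w" using zz(3) by (auto simp: sheet_chart_def)
    have "?\<tau> z = w" using w zz(1) by (simp add: sheet_chart_inv) (simp add: sheet_chart_def inv_sheet)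
    then show ?thesis using w by simp
  qed
  show ?thesis
  proof (cases "?S = {}")
    case True
    show ?thesis by (rule that[of 0]) (use True in blast)
  next
    case False
    then obtain z where z: "z \<in> ?S" by blast
    show ?thesis
    proof (rule that)
      fix z' assume z': "z' \<in> ?S"
      note sz = sheet_overlap[OF z] S[OF z] and sz' = sheet_overlap[OF z'] S[OF z']
      have V\<tau>: "?\<tau> z \<in> V" "?\<tau> z' \<in> V" using sz sz' by (auto simp: sheet_def)
      have "\<Phi> (z' + (?\<tau> z - z)) = \<Phi> z'" using period[of z "?\<tau> z" z'] sz sz' V\<tau> by simp
      then have eq: "\<Phi> (z' + (?\<tau> z - z)) = \<Phi> (?\<tau> z')" using sz' by simp
      have "norm (z' + (?\<tau> z - z) - ?\<tau> z') = norm ((z' - z) - (?\<tau> z' - ?\<tau> z))" by (simp add: algebra_simps)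
      also have "\<dots> \<le> norm (z' - z) + norm (?\<tau> z' - ?\<tau> z)" by (rule norm_triangle_ineq4)
      also have "\<dots> < 2 * r + 2 * r" using sz sz' by (intro add_strict_mono sheet_dist) auto
      finally have "z' + (?\<tau> z - z) = ?\<tau> z'"
        using sz sz' V\<tau> V by (intro discrete[OF _ _ eq]) (auto intro: subspace_add subspace_diff)
      then show "?\<tau> z' = z' + (?\<tau> z - z)" by simp
    qed
  qed
qed

lemma covering_atlas_smooth: "smooth_atlas L V covering_atlas"
proof -
  have "\<Union> (fst ` covering_atlas) = L"
  proof (intro equalityI subsetI)
    fix p assume "p \<in> L"
    then obtain z where "z \<in> V" "p = \<Phi> z" using \<Phi>_image by blast
    then show "p \<in> \<Union> (fst ` covering_atlas)"
      using r by (auto simp: covering_atlas_def sheet_chart_def sheet_def intro!: bexI[of _ z] image_eqI[of _ _ z])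
  next
    fix p assume "p \<in> \<Union> (fst ` covering_atlas)"
    then show "p \<in> L" using \<Phi>_image by (auto simp: covering_atlas_def sheet_chart_def sheet_def)
  qed
  moreover have "smooth_on V (snd (sheet_chart a) ` (fst (sheet_chart a) \<inter> fst (sheet_chart b)))
      (snd (sheet_chart b) \<circ> chart_inv (sheet_chart a))" for a b
  proof -
    obtain l where l: "\<And>z. z \<in> snd (sheet_chart a) ` (fst (sheet_chart a) \<inter> fst (sheet_chart b)) \<Longrightarrow>
      snd (sheet_chart b) (chart_inv (sheet_chart a) z) = z + l" by (rule transition_translation) blast
    have "smooth_on V S (\<lambda>z. z + l)" for S
      by (intro smooth_on_add smooth_on_const smooth_on_linear bounded_linear_ident)
    then show ?thesis by (subst smooth_on_cong[where g="\<lambda>z. z + l"]) (simp_all add: l)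
  qed
  ultimately show ?thesis
    using V is_chart_sheet by (auto simp: smooth_atlas_def covering_atlas_def)
qed

lemma transition_dir_deriv:
  assumes z: "z \<in> snd (sheet_chart a) ` (fst (sheet_chart a) \<inter> fst (sheet_chart b))" and v: "v \<in> V"
  shows "dir_deriv (snd (sheet_chart b) \<circ> chart_inv (sheet_chart a)) z v = v"
proof -
  let ?S = "snd (sheet_chart a) ` (fst (sheet_chart a) \<inter> fst (sheet_chart b))"
  obtain l where l: "\<And>z. z \<in> ?S \<Longrightarrow> snd (sheet_chart b) (chart_inv (sheet_chart a) z) = z + l"
    by (rule transition_translation) blast
  have "openin (top_of_set V) ?S" by (rule chart_transition_openin[OF is_chart_sheet is_chart_sheet])
  then have "dir_deriv (snd (sheet_chart b) \<circ> chart_inv (sheet_chart a)) z v = dir_deriv (\<lambda>z. z + l) z v"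
    by (rule dir_deriv_cong[OF V _ z v]) (simp add: l)
  also have "\<dots> = v"
    unfolding dir_deriv_def by (rule vector_derivative_at) (auto intro!: derivative_eq_intros)
  finally show ?thesis .
qed

lemma embedded_covering_atlas:
  assumes A: "topological_atlas M E \<A>" and \<Phi>: "smooth_map V V (linear_atlas V) M \<A> \<Phi>"
    and imm: "\<And>d z a. d \<in> \<A> \<Longrightarrow> z \<in> V \<Longrightarrow> \<Phi> z \<in> fst d \<Longrightarrow> a \<in> V \<Longrightarrow> a \<noteq> 0 \<Longrightarrow>
      dir_deriv (\<lambda>w. snd d (\<Phi> w)) z a \<noteq> 0"
  shows "embedded_submanifold M \<A> L V covering_atlas"
  unfolding embedded_submanifold_def
proof (intro conjI ballI impI)
  show "smooth_atlas L V covering_atlas" by (rule covering_atlas_smooth)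
  show "smooth_map L V covering_atlas M \<A> id"
  proof (rule smooth_mapI)
    show "id ` L \<subseteq> M" using smooth_mapD(1)[OF \<Phi>] \<Phi>_image by auto
    show "continuous_on L id" by (rule continuous_on_id')
    fix c d assume "c \<in> covering_atlas" and d: "d \<in> \<A>"
    then obtain a where c: "c = sheet_chart a" by (auto simp: covering_atlas_def)
    let ?S = "snd c ` (fst c \<inter> id -` fst d)"
    have S: "z \<in> sheet a" "z \<in> V" "\<Phi> z \<in> fst d" if "z \<in> ?S" for z
      using sheet_overlap[of z a "fst d"] that by (auto simp: c)
    have "smooth_on V ?S (\<lambda>u. snd d (\<Phi> u))"
      by (rule smooth_on_subset[OF smooth_map_from_linear[OF \<Phi> d]]) (use S in blast)
    then show "smooth_on V ?S (\<lambda>u. snd d (id (chart_inv c u)))"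
      by (subst smooth_on_cong[where g="\<lambda>u. snd d (\<Phi> u)"]) (simp_all add: c sheet_chart_inv S(1)[unfolded c])
  qed
  fix c d z v assume cd: "c \<in> covering_atlas" "d \<in> \<A>" "z \<in> snd c ` (fst c \<inter> fst d)" "v \<in> V" "v \<noteq> 0"
  then obtain a where c: "c = sheet_chart a" by (auto simp: covering_atlas_def)
  note S = sheet_overlap[OF cd(3)[unfolded c]]
  have "dir_deriv (snd d \<circ> chart_inv c) z v = dir_deriv (\<lambda>w. snd d (\<Phi> w)) z v"
    by (rule dir_deriv_cong[OF V sheet_openin S(1) cd(4)]) (simp add: c sheet_chart_inv)
  then show "dir_deriv (snd d \<circ> chart_inv c) z v \<noteq> 0" using imm[OF cd(2) S(2,3) cd(4,5)] by simp
qed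

text \<open>The hypothesis concerns germs of curves because the inverse chart agrees with
  \<open>\<Phi>\<close> only on the sheet.\<close>

lemma sheet_frame:
  assumes vel: "\<And>\<gamma> z v. z \<in> V \<Longrightarrow> v \<in> V \<Longrightarrow> \<forall>\<^sub>F s in nhds 0. \<gamma> s = \<Phi> (z + s *\<^sub>R v) \<Longrightarrow> vel \<gamma> = X v"
    and z: "z \<in> sheet a" and v: "v \<in> V"
  shows "frame vel (sheet_chart a) z v = X v"
  unfolding frame_def
proof (rule vel)
  show "z \<in> V" using z by (simp add: sheet_def)
  show "\<forall>\<^sub>F s in nhds 0. chart_inv (sheet_chart a) (z + s *\<^sub>R v) = \<Phi> (z + s *\<^sub>R v)"
    using eventually_line_in_openin[OF V sheet_openin z v] by (rule eventually_mono) (rule sheet_chart_inv)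
qed (rule v)

end

text \<open>Transitions are translations, so their differential is the identity and commutes with
  \<open>cscale \<i>\<close>. The statement stands outside the locale because the model type is now
  a product.\<close>

lemma holomorphic_covering_atlas:
  fixes V :: "('v::euclidean_space \<times> 'v) set"
  assumes "translation_covering V \<Phi> L r" and cs: "\<And>\<zeta> a. a \<in> V \<Longrightarrow> cscale \<zeta> a \<in> V"
  shows "holomorphic_atlas L V (translation_covering.covering_atlas V \<Phi> r)"
proof -
  interpret translation_covering V \<Phi> L r by fact
  show ?thesis
    unfolding holomorphic_atlas_def
  proof (intro conjI ballI allI)
    fix d e z a assume "d \<in> covering_atlas" "e \<in> covering_atlas" and z: "z \<in> snd d ` (fst d \<inter> fst e)" and a: "a \<in> V"
    then obtain i j where ij: "d = sheet_chart i" "e = sheet_chart j" by (auto simp: covering_atlas_def)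
    show "dir_deriv (snd e \<circ> chart_inv d) z (cscale \<i> a) = cscale \<i> (dir_deriv (snd e \<circ> chart_inv d) z a)"
      unfolding ij transition_dir_deriv[OF z[unfolded ij] a] transition_dir_deriv[OF z[unfolded ij] cs[OF a]] ..
  qed (rule covering_atlas_smooth, rule cs)
qed

section \<open>Constant symplectic forms and quadratic potentials\<close>

lemma dir_deriv_const: "dir_deriv (\<lambda>_. k) z a = 0"
  by (simp add: dir_deriv_def vector_derivative_const_at)

text \<open>With constant coefficients every derivative in the closedness condition is 0, and only
  linear algebra is left.\<close>

lemma constant_symplectic_form:
  assumes V: "subspace V" "openin (top_of_set V) S"
    and \<Omega>: "\<And>z a b. z \<in> S \<Longrightarrow> a \<in> V \<Longrightarrow> b \<in> V \<Longrightarrow> \<Omega> z a b = \<beta> a b"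
    and add: "\<And>a b b'. a \<in> V \<Longrightarrow> b \<in> V \<Longrightarrow> b' \<in> V \<Longrightarrow> \<beta> a (b + b') = \<beta> a b + \<beta> a b'"
    and scale: "\<And>a b r. a \<in> V \<Longrightarrow> b \<in> V \<Longrightarrow> \<beta> a (r *\<^sub>R b) = r * \<beta> a b"
    and skew: "\<And>a b. a \<in> V \<Longrightarrow> b \<in> V \<Longrightarrow> \<beta> b a = - \<beta> a b"
    and nondeg: "\<And>a. a \<in> V \<Longrightarrow> a \<noteq> 0 \<Longrightarrow> \<exists>b\<in>V. \<beta> a b \<noteq> 0"
  shows "symplectic_form_on V S \<Omega>"
proof -
  have 1: "smooth_on V S (\<lambda>z. \<Omega> z a b)" if "a \<in> V" "b \<in> V" for a b
    using smooth_on_const by (subst smooth_on_cong[where g="\<lambda>_. \<beta> a b"]) (auto simp: \<Omega> that)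
  have 2: "dir_deriv (\<lambda>w. \<Omega> w a b) z e = 0" if "z \<in> S" "a \<in> V" "b \<in> V" "e \<in> V" for z a b e
    using dir_deriv_cong[OF V that(1,4), of "\<lambda>w. \<Omega> w a b" "\<lambda>_. \<beta> a b"] \<Omega> that by (simp add: dir_deriv_const)
  have 3: "\<Omega> z b a = - \<Omega> z a b" if "z \<in> S" "a \<in> V" "b \<in> V" for z a b
    unfolding \<Omega>[OF that] \<Omega>[OF that(1,3,2)] by (rule skew[OF that(2,3)])
  have 4: "\<exists>b\<in>V. \<Omega> z a b \<noteq> 0" if "z \<in> S" "a \<in> V" "a \<noteq> 0" for z a
    using nondeg[OF that(2,3)] \<Omega>[OF that(1,2)] by auto
  show ?thesis
    unfolding symplectic_form_on_def
  proof (intro conjI ballI allI impI)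
    fix z a b b' r assume *: "z \<in> S" "a \<in> V" "b \<in> V" "b' \<in> V"
    show "\<Omega> z a (b + b') = \<Omega> z a b + \<Omega> z a b'"
      using * V(1) by (simp add: \<Omega> add subspace_add)
    show "\<Omega> z a (r *\<^sub>R b) = r * \<Omega> z a b"
      using * V(1) by (simp add: \<Omega> scale subspace_scale)
  next
    fix z a b e assume "z \<in> S" "a \<in> V" "b \<in> V" "e \<in> V"
    then show "dir_deriv (\<lambda>w. \<Omega> w b e) z a - dir_deriv (\<lambda>w. \<Omega> w a e) z b + dir_deriv (\<lambda>w. \<Omega> w a b) z e = 0"
      by (simp add: 2)
  qed (rule 1 3 4; assumption)+
qed

text \<open>The function depends only on the real part \<open>fst w\<close>, so a derivative along
  \<open>cscale \<i> u\<close> is one along \<open>- snd u\<close>. Hence \<open>dzbar h\<close>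
  pairs \<open>fst u - \<i> snd u\<close> with \<open>k F (y + fst w)\<close>, and one more
  derivative gives constants. The space \<open>E\<close> is kept separate from \<open>fst V\<close>
  so that it can contain \<open>y\<close>.\<close>

lemma potential_d_dbar:
  fixes V :: "('v::euclidean_space \<times> 'v) set" and F :: "'v \<Rightarrow> 'v"
  assumes V: "subspace V" "openin (top_of_set V) S" "\<And>\<zeta> a. a \<in> V \<Longrightarrow> cscale \<zeta> a \<in> V"
    and F: "bounded_linear F" "\<And>u v. u \<in> E \<Longrightarrow> v \<in> E \<Longrightarrow> F u \<bullet> v = u \<bullet> F v"
    and E: "subspace E" "y \<in> E" "fst ` V \<subseteq> E"
    and h: "\<And>w. w \<in> S \<Longrightarrow> h w = complex_of_real (k * ((y + fst w) \<bullet> F (y + fst w)))"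
    and z: "z \<in> S" and a: "a \<in> V" and b: "b \<in> V"
  shows "\<i> * d_dbar h z a b = complex_of_real (k * (fst a \<bullet> F (snd b) - snd a \<bullet> F (fst b)))"
proof -
  have SV: "S \<subseteq> V" using V(2) by (rule openin_imp_subset)
  have linF: "linear F" using F(1) by (rule bounded_linear.linear)
  have i: "cscale \<i> u = (- snd u, fst u)" for u :: "'v \<times> 'v" by (simp add: cscale_def)
  have iV: "cscale \<i> u \<in> V" if "u \<in> V" for u using V(3) that .
  have snE: "snd u \<in> E" if "u \<in> V" for u
    using E(3) iV[OF that] i[of u] subspace_neg[OF E(1), of "- snd u"] by force
  have feE: "fst u \<in> E" if "u \<in> V" for u using E(3) that by blast
  have sw: "u \<bullet> F v = v \<bullet> F u" if "u \<in> E" "v \<in> E" for u v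
    using F(2)[OF that] by (simp only: inner_commute[of "F u" v])
  have h1: "dir_deriv h w u = complex_of_real (2 * k * (fst u \<bullet> F (y + fst w)))" if w: "w \<in> S" and u: "u \<in> V" for w u
  proof -
    have "dir_deriv h w u = dir_deriv (\<lambda>w. complex_of_real (k * ((y + fst w) \<bullet> F (y + fst w)))) w u"
      by (rule dir_deriv_cong[OF V(1,2) w u h])
    also have "\<dots> = complex_of_real (k * ((y + fst w) \<bullet> F (fst u) + fst u \<bullet> F (y + fst w)))"
      unfolding dir_deriv_def
    proof (rule vector_derivative_at)
      have g: "((\<lambda>s. y + fst (w + s *\<^sub>R u)) has_vector_derivative fst u) (at 0)"
        by (auto intro!: derivative_eq_intros)
      have "((\<lambda>s. (y + fst (w + s *\<^sub>R u)) \<bullet> F (y + fst (w + s *\<^sub>R u))) has_vector_derivative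
          (y + fst (w + 0 *\<^sub>R u)) \<bullet> F (fst u) + fst u \<bullet> F (y + fst (w + 0 *\<^sub>R u))) (at 0)"
        by (rule bounded_bilinear.has_vector_derivative[OF bounded_bilinear_inner g
              bounded_linear.has_vector_derivative[OF F(1) g]])
      then have "((\<lambda>s. k * ((y + fst (w + s *\<^sub>R u)) \<bullet> F (y + fst (w + s *\<^sub>R u)))) has_vector_derivative
          k * ((y + fst w) \<bullet> F (fst u) + fst u \<bullet> F (y + fst w))) (at 0)"
        by (auto intro: has_vector_derivative_mult_right)
      then show "((\<lambda>s. complex_of_real (k * ((y + fst (w + s *\<^sub>R u)) \<bullet> F (y + fst (w + s *\<^sub>R u))))) has_vector_derivative
          complex_of_real (k * ((y + fst w) \<bullet> F (fst u) + fst u \<bullet> F (y + fst w)))) (at 0)"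
        by (rule bounded_linear.has_vector_derivative[OF bounded_linear_of_real])
    qed
    also have "(y + fst w) \<bullet> F (fst u) = fst u \<bullet> F (y + fst w)"
    proof (rule sw)
      show "y + fst w \<in> E" using w SV E(1,2) feE by (blast intro: subspace_add)
    qed (rule feE[OF u])
    finally show ?thesis by simp
  qed
  have h2: "dzbar h w u = complex_of_real (k * (fst u \<bullet> F (y + fst w))) - \<i> * complex_of_real (k * (snd u \<bullet> F (y + fst w)))"
    if w: "w \<in> S" and u: "u \<in> V" for w u
    unfolding dzbar_def h1[OF w u] h1[OF w iV[OF u]] by (simp add: i field_simps)
  have h3: "dir_deriv (\<lambda>w. dzbar h w u) z v =
      complex_of_real (k * (fst u \<bullet> F (fst v))) - \<i> * complex_of_real (k * (snd u \<bullet> F (fst v)))"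
    if u: "u \<in> V" and v: "v \<in> V" for u v
  proof -
    have "dir_deriv (\<lambda>w. dzbar h w u) z v = dir_deriv (\<lambda>w. complex_of_real (k * (fst u \<bullet> F (y + fst w))) -
        \<i> * complex_of_real (k * (snd u \<bullet> F (y + fst w)))) z v"
      by (rule dir_deriv_cong[OF V(1,2) z v]) (rule h2[OF _ u])
    also have "\<dots> = complex_of_real (k * (fst u \<bullet> F (fst v))) - \<i> * complex_of_real (k * (snd u \<bullet> F (fst v)))"
      unfolding dir_deriv_def
    proof (rule vector_derivative_at)
      have g: "((\<lambda>s. y + fst (z + s *\<^sub>R v)) has_vector_derivative fst v) (at 0)"
        by (auto intro!: derivative_eq_intros)
      have "((\<lambda>s. complex_of_real (k * (q \<bullet> F (y + fst (z + s *\<^sub>R v))))) has_vector_derivative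
          complex_of_real (k * (q \<bullet> F (fst v)))) (at 0)" for q
        by (intro bounded_linear.has_vector_derivative[OF bounded_linear_of_real] has_vector_derivative_mult_right
            bounded_linear.has_vector_derivative[OF bounded_linear_inner_right]
            bounded_linear.has_vector_derivative[OF F(1)] g)
      then show "((\<lambda>s. complex_of_real (k * (fst u \<bullet> F (y + fst (z + s *\<^sub>R v)))) -
          \<i> * complex_of_real (k * (snd u \<bullet> F (y + fst (z + s *\<^sub>R v))))) has_vector_derivative
          complex_of_real (k * (fst u \<bullet> F (fst v))) - \<i> * complex_of_real (k * (snd u \<bullet> F (fst v)))) (at 0)"
        by (intro has_vector_derivative_diff has_vector_derivative_mult_right)
    qed
    finally show ?thesis .
  qed
  \<comment> \<open>Pairings of real with real and imaginary with imaginary parts are symmetric in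
    \<open>a\<close> and \<open>b\<close> and cancel in the antisymmetrisation; the mixed pairings
    add up.\<close>
  note sym = sw[OF feE[OF b] feE[OF a]] sw[OF snE[OF b] snE[OF a]] sw[OF feE[OF b] snE[OF a]]
    sw[OF snE[OF b] feE[OF a]]
  show ?thesis
    unfolding d_dbar_def dz_def h3[OF b a] h3[OF a b] h3[OF b iV[OF a]] h3[OF a iV[OF b]]
    by (simp add: i linear_neg[OF linF] sym complex_eq_iff) (simp add: field_simps)
qed

section \<open>Toral leaves\<close>

text \<open>\<open>Fl\<close> is a linear extension of \<open>F\<close> to the ambient Euclidean space.\<close>
locale toral_leaf_param = lie_group_torus G \<gg> \<A> c B \<rho>
  for G :: "'g::t2_space monoid" (structure) and \<gg> :: "'v::euclidean_space set"
    and \<A> :: "('g, 'v) chart set" and c :: "('g, 'v) chart" and B :: "'v set" and \<rho> :: "'v \<Rightarrow> 'g" +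
  fixes F Fl :: "'v \<Rightarrow> 'v" and \<sigma> :: complex and x :: 'g and y :: 'v and \<tt> :: "'v set"
  assumes \<tt>: "\<tt> = d\<rho> ` span B"
    and Fl: "bounded_linear Fl" "\<And>v. v \<in> \<gg> \<Longrightarrow> Fl v = F v"
    and F_self: "\<And>u v. u \<in> \<gg> \<Longrightarrow> v \<in> \<gg> \<Longrightarrow> F u \<bullet> v = u \<bullet> F v"
    and F_image: "F ` \<gg> \<subseteq> \<tt>"
    and F_pos: "\<And>u. u \<in> \<tt> \<Longrightarrow> u \<noteq> 0 \<Longrightarrow> 0 < u \<bullet> F u"
    and \<sigma>: "0 < Im \<sigma>" and x: "x \<in> carrier G" and y: "y \<in> \<gg>"
begin

abbreviation "V \<equiv> \<tt> \<times> \<tt>"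

lemma subspace_\<tt>: "subspace \<tt>" unfolding \<tt> by (rule subspace_d\<rho>)

lemma subspace_V: "subspace V" using subspace_\<tt> subspace_\<tt> by (rule subspace_Times)

lemma \<tt>_sub: "\<tt> \<subseteq> \<gg>" unfolding \<tt> using d\<rho>_in by blast

lemma linear_Fl: "linear Fl" using Fl(1) by (rule bounded_linear.linear)

lemma Fl_in: "v \<in> \<gg> \<Longrightarrow> Fl v \<in> \<tt>" using F_image Fl(2) by auto

lemma Fl_self: "u \<in> \<gg> \<Longrightarrow> v \<in> \<gg> \<Longrightarrow> Fl u \<bullet> v = u \<bullet> Fl v" by (simp add: Fl(2) F_self)

lemma Fl_pos: "u \<in> \<tt> \<Longrightarrow> u \<noteq> 0 \<Longrightarrow> 0 < u \<bullet> Fl u" using \<tt>_sub F_pos Fl(2) by auto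

lemma Fl_nonneg: "u \<in> \<tt> \<Longrightarrow> 0 \<le> u \<bullet> Fl u" using Fl_pos[of u] by (cases "u = 0") auto

lemma Fl_zero: "u \<in> \<tt> \<Longrightarrow> Fl u = 0 \<Longrightarrow> u = 0" using Fl_pos[of u] by auto

text \<open>Positivity makes \<open>Fl\<close> injective on \<open>\<tt>\<close>, and it maps
  \<open>\<tt>\<close> into itself, so dimensions agree.\<close>

lemma Fl_onto: "Fl ` \<tt> = \<tt>"
proof (rule subspace_dim_equal)
  have inj: "inj_on Fl (span \<tt>)"
    unfolding span_eq_iff[THEN iffD2, OF subspace_\<tt>]
    using linear_inj_on_iff_eq_0[OF linear_Fl subspace_\<tt>] Fl_zero by blast
  show "dim \<tt> \<le> dim (Fl ` \<tt>)" by (simp add: dim_image_eq[OF linear_Fl inj])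
  show "subspace (Fl ` \<tt>)" by (rule linear_subspace_image[OF linear_Fl subspace_\<tt>])
  show "Fl ` \<tt> \<subseteq> \<tt>" using Fl_in \<tt>_sub by blast
qed (rule subspace_\<tt>)

text \<open>The left inverse is chosen on the whole space with range in \<open>span B\<close>, so
  that \<open>N\<close> takes values in \<open>span B\<close> everywhere and not only on
  \<open>V\<close>.\<close>

definition log_\<tt> :: "'v \<Rightarrow> 'v" where
  "log_\<tt> = (SOME g. range g \<subseteq> span B \<and> linear g \<and> (\<forall>w\<in>span B. g (d\<rho> w) = w))"

lemma log_\<tt>: "range log_\<tt> \<subseteq> span B" "linear log_\<tt>" "w \<in> span B \<Longrightarrow> log_\<tt> (d\<rho> w) = w"
proof -
  have "inj_on d\<rho> (span B)"
    using linear_inj_on_iff_eq_0[OF linear_d\<rho> subspace_span] d\<rho>_inj by blast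
  from linear_exists_left_inverse_on[OF linear_d\<rho> subspace_span this]
  have "range log_\<tt> \<subseteq> span B \<and> linear log_\<tt> \<and> (\<forall>w\<in>span B. log_\<tt> (d\<rho> w) = w)"
    unfolding log_\<tt>_def by (rule someI_ex)
  then show "range log_\<tt> \<subseteq> span B" "linear log_\<tt>" "w \<in> span B \<Longrightarrow> log_\<tt> (d\<rho> w) = w" by auto
qed

lemma d\<rho>_log_\<tt>: "u \<in> \<tt> \<Longrightarrow> d\<rho> (log_\<tt> u) = u"
  unfolding \<tt> using log_\<tt>(3) by auto

text \<open>The linear map is chosen such that the curve \<open>s \<mapsto> \<Phi> (z + s (a, b))\<close> has as velocity the real part
  of \<open>(- cnj \<sigma> F (a + \<i> b), a + \<i> b)\<close>.\<close>
definition N :: "'v \<times> 'v \<Rightarrow> 'v" where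
  "N z = - log_\<tt> (Re \<sigma> *\<^sub>R Fl (fst z) + Im \<sigma> *\<^sub>R Fl (snd z))"

definition \<Phi> :: "'v \<times> 'v \<Rightarrow> 'g \<times> 'v" where
  "\<Phi> z = (x \<otimes> \<rho> (N z), y + fst z)"

lemma linear_N: "linear N"
  unfolding N_def
  by (intro linearI) (simp_all add: linear_add[OF linear_Fl] linear_add[OF log_\<tt>(2)]
      linear_scale[OF linear_Fl] linear_scale[OF log_\<tt>(2)] algebra_simps)

lemma bounded_linear_N: "bounded_linear N"
  using linear_N by (rule linear_conv_bounded_linear[THEN iffD1])

lemma N_in: "N z \<in> span B" unfolding N_def using log_\<tt>(1) by (intro span_neg) blast

lemma d\<rho>_N:
  assumes "z \<in> V"
  shows "d\<rho> (N z) = - (Re \<sigma> *\<^sub>R Fl (fst z) + Im \<sigma> *\<^sub>R Fl (snd z))"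
proof -
  have "Re \<sigma> *\<^sub>R Fl (fst z) + Im \<sigma> *\<^sub>R Fl (snd z) \<in> \<tt>"
    using assms \<tt>_sub Fl_in by (intro subspace_add[OF subspace_\<tt>] subspace_scale[OF subspace_\<tt>]) auto
  then show ?thesis unfolding N_def by (simp add: linear_neg[OF linear_d\<rho>] d\<rho>_log_\<tt>)
qed

text \<open>This is where \<open>Im \<sigma> > 0\<close> separates the two coordinates: once
  \<open>fst z\<close> vanishes, \<open>N z\<close> sees \<open>snd z\<close> through
  \<open>Im \<sigma> *\<^sub>R Fl (snd z)\<close>, and \<open>Fl\<close> is injective on
  \<open>\<tt>\<close>.\<close>

lemma N_fst_zero:
  assumes z: "z \<in> V" and 0: "fst z = 0" "N z = 0"
  shows "z = 0"
proof -
  have "Im \<sigma> *\<^sub>R Fl (snd z) = 0"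
    using d\<rho>_N[OF z] 0 by (simp add: linear_0[OF linear_d\<rho>] linear_0[OF linear_Fl])
  then have "Fl (snd z) = 0" using \<sigma> by simp
  then have "snd z = 0" using z Fl_zero[of "snd z"] by auto
  then show ?thesis using 0(1) by (simp add: prod_eq_iff)
qed

text \<open>The first coordinate must be \<open>q\<close>; the second is the solution
  \<open>b\<close> of \<open>Im \<sigma> *\<^sub>R Fl b = - (d\<rho> p + Re \<sigma> *\<^sub>R Fl
  q)\<close>, which exists by \<open>Fl_onto\<close>.\<close>

lemma N_fst_onto:
  assumes "p \<in> span B" "q \<in> \<tt>"
  obtains z where "z \<in> V" "N z = p" "fst z = q"
proof -
  have "d\<rho> p \<in> \<tt>" using assms(1) \<tt> by blast
  then have "(- (1 / Im \<sigma>)) *\<^sub>R (d\<rho> p + Re \<sigma> *\<^sub>R Fl q) \<in> Fl ` \<tt>"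
    unfolding Fl_onto using assms(2) \<tt>_sub Fl_in
    by (intro subspace_scale[OF subspace_\<tt>] subspace_add[OF subspace_\<tt>]) auto
  then obtain b where b: "b \<in> \<tt>" "Fl b = (- (1 / Im \<sigma>)) *\<^sub>R (d\<rho> p + Re \<sigma> *\<^sub>R Fl q)" by auto
  have "Im \<sigma> *\<^sub>R Fl b = - (d\<rho> p + Re \<sigma> *\<^sub>R Fl q)"
    unfolding b(2) scaleR_scaleR using \<sigma> by simp
  then have "- (Re \<sigma> *\<^sub>R Fl q + Im \<sigma> *\<^sub>R Fl b) = d\<rho> p" by simp
  then have "N (q, b) = p"
    unfolding N_def fst_conv snd_conv linear_neg[OF log_\<tt>(2), symmetric] using log_\<tt>(3)[OF assms(1)] by simp
  then show ?thesis using that[of "(q, b)"] assms b by simp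
qed

section \<open>The map onto the leaf: surjectivity, openness, periods, immersion\<close>

lemma leaf_eq: "toral_leaf G (\<rho> ` span B) \<tt> (x, y) = (\<lambda>w. x \<otimes> \<rho> w) ` span B \<times> (+) y ` \<tt>"
  by (auto simp: toral_leaf_def l_coset_def)

lemma \<Phi>_onto: "\<Phi> ` V = toral_leaf G (\<rho> ` span B) \<tt> (x, y)"
proof (intro equalityI subsetI)
  fix p assume "p \<in> \<Phi> ` V"
  then show "p \<in> toral_leaf G (\<rho> ` span B) \<tt> (x, y)"
    unfolding leaf_eq \<Phi>_def using N_in by auto
next
  fix p assume "p \<in> toral_leaf G (\<rho> ` span B) \<tt> (x, y)"
  then obtain w q where wq: "w \<in> span B" "q \<in> \<tt>" "p = (x \<otimes> \<rho> w, y + q)" unfolding leaf_eq by blast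
  obtain z where "z \<in> V" "N z = w" "fst z = q" using wq(1,2) by (rule N_fst_onto)
  then have "p = \<Phi> z" using wq(3) by (simp add: \<Phi>_def)
  then show "p \<in> \<Phi> ` V" using \<open>z \<in> V\<close> by blast
qed

text \<open>Continuity of left multiplication by \<open>inv x\<close> carries openness of
  \<open>\<rho>\<close> from the torus to its coset.\<close>

lemma translate_open:
  assumes "openin (top_of_set (span B)) W"
  shows "openin (top_of_set ((\<lambda>w. x \<otimes> \<rho> w) ` span B)) ((\<lambda>w. x \<otimes> \<rho> w) ` W)"
proof -
  obtain O' where O': "open O'" "\<rho> ` W = \<rho> ` span B \<inter> O'"
    using \<rho>_open[OF assms] by (auto simp: openin_open)
  have WB: "W \<subseteq> span B" using assms by (rule openin_imp_subset)
  let ?X = "(\<lambda>w. x \<otimes> \<rho> w) ` span B"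
  have XG: "?X \<subseteq> carrier G" using x \<rho>_carrier by auto
  have canc: "inv x \<otimes> (x \<otimes> \<rho> w) = \<rho> w" if "w \<in> span B" for w
    using inv_mult_cancel[OF x \<rho>_carrier[OF that]] .
  have "continuous_on (carrier G) (\<lambda>p. inv x \<otimes> p)"
    using x by (intro smooth_mapD(2)[OF smooth_left_mult]) simp
  then have "continuous_on ?X (\<lambda>p. inv x \<otimes> p)" using XG by (rule continuous_on_subset)
  then have "openin (top_of_set ?X) (?X \<inter> (\<lambda>p. inv x \<otimes> p) -` O')"
    using O'(1) by (rule continuous_openin_preimage_gen)
  moreover have "?X \<inter> (\<lambda>p. inv x \<otimes> p) -` O' = (\<lambda>w. x \<otimes> \<rho> w) ` W"
  proof (intro equalityI subsetI)
    fix p assume p: "p \<in> ?X \<inter> (\<lambda>p. inv x \<otimes> p) -` O'"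
    then obtain w where w: "w \<in> span B" "p = x \<otimes> \<rho> w" by blast
    have "\<rho> w \<in> O'" using p canc[OF w(1)] by (simp add: w(2))
    then have "\<rho> w \<in> \<rho> ` W" using O'(2) w(1) by blast
    then obtain w' where "w' \<in> W" "\<rho> w = \<rho> w'" by blast
    then show "p \<in> (\<lambda>w. x \<otimes> \<rho> w) ` W" using w(2) by auto
  next
    fix p assume "p \<in> (\<lambda>w. x \<otimes> \<rho> w) ` W"
    then obtain w where w: "w \<in> W" "p = x \<otimes> \<rho> w" by blast
    then have "\<rho> w \<in> O'" using O'(2) by blast
    then show "p \<in> ?X \<inter> (\<lambda>p. inv x \<otimes> p) -` O'" using w WB canc[of w] by auto
  qed
  ultimately show ?thesis by simp
qed

text \<open>\<open>\<Phi>\<close> factors through the linear isomorphism \<open>H\<close> from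
  \<open>V\<close> onto \<open>span B \<times> \<tt>\<close>, followed by a product of two open
  maps. As \<open>W\<close> need not be a product, openness is checked on boxes inside its image
  under \<open>H\<close>.\<close>

lemma \<Phi>_open:
  assumes W: "openin (top_of_set V) W"
  shows "openin (top_of_set (toral_leaf G (\<rho> ` span B) \<tt> (x, y))) (\<Phi> ` W)"
proof (subst openin_subopen, intro ballI)
  define H where "H z = (N z, fst z)" for z :: "'v \<times> 'v"
  have WV: "W \<subseteq> V" using W by (rule openin_imp_subset)
  have linH: "linear H"
    unfolding H_def by (intro linearI) (simp_all add: linear_add[OF linear_N] linear_scale[OF linear_N])
  have "inj_on H V"
    unfolding linear_inj_on_iff_eq_0[OF linH subspace_V] using N_fst_zero by (auto simp: H_def prod_eq_iff)
  from linear_exists_left_inverse_on[OF linH subspace_V this] obtain K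
    where K: "range K \<subseteq> V" "linear K" "\<And>z. z \<in> V \<Longrightarrow> K (H z) = z" by blast
  have "continuous_on (span B \<times> \<tt>) K" using K(2) by (rule linear_continuous_on[OF linear_conv_bounded_linear[THEN iffD1]])
  then have "openin (top_of_set (span B \<times> \<tt>)) ((span B \<times> \<tt>) \<inter> K -` W)"
    by (rule continuous_openin_preimage[OF _ _ W]) (use K(1) in blast)
  then have HW: "openin (top_of_set (span B \<times> \<tt>)) (H ` W)"
  proof (rule back_subst[where P="openin _"])
    show "(span B \<times> \<tt>) \<inter> K -` W = H ` W"
    proof (intro equalityI subsetI)
      fix p assume p: "p \<in> (span B \<times> \<tt>) \<inter> K -` W"
      then have "fst p \<in> span B" "snd p \<in> \<tt>" by auto
      then obtain z where z: "z \<in> V" "N z = fst p" "fst z = snd p" by (rule N_fst_onto)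
      then have "p = H z" by (simp add: H_def)
      then show "p \<in> H ` W" using p K(3)[OF z(1)] by auto
    next
      fix p assume "p \<in> H ` W"
      then obtain z where "z \<in> W" "p = H z" by blast
      then show "p \<in> (span B \<times> \<tt>) \<inter> K -` W" using WV K(3)[of z] N_in[of z] by (auto simp: H_def)
    qed
  qed
  fix p assume "p \<in> \<Phi> ` W"
  then obtain z where z: "z \<in> W" "p = \<Phi> z" by blast
  have "(N z, fst z) \<in> H ` W" using z(1) by (auto simp: H_def)
  from Times_in_interior_subtopology[OF this HW] obtain R1 R2
    where R: "openin (top_of_set (span B)) R1" "N z \<in> R1" "openin (top_of_set \<tt>) R2" "fst z \<in> R2"
      "R1 \<times> R2 \<subseteq> H ` W" by metis
  let ?T = "(\<lambda>w. x \<otimes> \<rho> w) ` R1 \<times> (+) y ` R2"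
  obtain O2 where O2: "open O2" "R2 = \<tt> \<inter> O2" using R(3) by (auto simp: openin_open)
  have "(+) y ` R2 = (+) y ` \<tt> \<inter> (+) y ` O2" unfolding O2(2) by (rule image_Int) (simp add: inj_on_def)
  then have "openin (top_of_set ((+) y ` \<tt>)) ((+) y ` R2)"
    using open_translation[OF O2(1), of y] by (simp add: openin_open_Int)
  then have "openin (top_of_set (toral_leaf G (\<rho> ` span B) \<tt> (x, y))) ?T"
    unfolding leaf_eq by (rule openin_Times[OF translate_open[OF R(1)]])
  moreover have "p \<in> ?T" using R(2,4) z(2) by (auto simp: \<Phi>_def)
  moreover have "?T \<subseteq> \<Phi> ` W"
  proof
    fix t assume "t \<in> ?T"
    then obtain u v where uv: "u \<in> R1" "v \<in> R2" "t = (x \<otimes> \<rho> u, y + v)" by blast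
    then have "(u, v) \<in> H ` W" using R(5) by blast
    then obtain z' where "z' \<in> W" "(u, v) = H z'" by blast
    then show "t \<in> \<Phi> ` W" using uv(3) by (auto simp: H_def \<Phi>_def)
  qed
  ultimately show "\<exists>T. openin (top_of_set (toral_leaf G (\<rho> ` span B) \<tt> (x, y))) T \<and> p \<in> T \<and> T \<subseteq> \<Phi> ` W"
    by blast
qed

text \<open>The second component of \<open>\<Phi>\<close> determines \<open>fst z\<close>, so
  periods change only \<open>snd z\<close>, by vectors that \<open>N\<close> maps into the
  lattice.\<close>

lemma \<Phi>_eqD:
  assumes "\<Phi> z = \<Phi> z'"
  shows "fst z = fst z'" "\<rho> (N (z' - z)) = \<one>"
proof -
  have 1: "x \<otimes> \<rho> (N z) = x \<otimes> \<rho> (N z')" and "y + fst z = y + fst z'" using assms by (simp_all add: \<Phi>_def)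
  then show "fst z = fst z'" by simp
  have "\<rho> (N z') = \<rho> (N z)" using 1 x N_in \<rho>_carrier by simp
  then have "\<rho> (N z' - N z) = \<one>" using \<rho>_eq_iff[OF N_in N_in] by blast
  then show "\<rho> (N (z' - z)) = \<one>" by (simp add: linear_diff[OF linear_N])
qed

lemma \<Phi>_smooth:
  "smooth_map V V (linear_atlas V) (cotangent_bundle G \<gg>) (cotangent_atlas \<gg> \<A>) \<Phi>"
  unfolding cotangent_bundle_def cotangent_atlas_def \<Phi>_def[abs_def]
proof (rule smooth_map_Pair)
  note atV = smooth_atlas_topological[OF smooth_atlas_linear[OF subspace_V]]
  note atB = smooth_atlas_topological[OF smooth_atlas_linear[OF subspace_span]]
  have "smooth_map V V (linear_atlas V) (span B) (linear_atlas (span B)) N"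
    using N_in by (intro smooth_map_linear_atlas smooth_on_linear bounded_linear_N) blast
  from smooth_map_compose[OF atV atB atlas_G this \<rho>_smooth]
  show "smooth_map V V (linear_atlas V) (carrier G) \<A> (\<lambda>z. x \<otimes> \<rho> (N z))"
    by (rule smooth_mult_of[OF atV smooth_map_const[OF x]])
  show "smooth_map V V (linear_atlas V) \<gg> (linear_atlas \<gg>) (\<lambda>z. y + fst z)"
    by (intro smooth_map_linear_atlas smooth_on_add smooth_on_const smooth_on_linear bounded_linear_fst)
      (use \<tt>_sub in \<open>auto intro!: subspace_add[OF subspace_\<gg> y]\<close>)
qed

lemma covering: "\<exists>r. translation_covering V \<Phi> (toral_leaf G (\<rho> ` span B) \<tt> (x, y)) r"
proof -
  obtain \<epsilon> where \<epsilon>: "\<epsilon> > 0" "\<And>w. w \<in> span B \<Longrightarrow> \<rho> w = \<one> \<Longrightarrow> norm w < \<epsilon> \<Longrightarrow> w = 0"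
    by (rule lattice_discrete) blast
  obtain K where K: "K > 0" "\<And>z. norm (N z) \<le> norm z * K"
    using bounded_linear.pos_bounded[OF bounded_linear_N] by blast
  \<comment> \<open>Lattice vectors shorter than \<open>\<epsilon>\<close> are 0 and
    \<open>N\<close> stretches by at most \<open>K\<close>, so a period shorter than
    \<open>\<epsilon> / K\<close>, which is four times the radius, vanishes.\<close>
  have "translation_covering V \<Phi> (toral_leaf G (\<rho> ` span B) \<tt> (x, y)) (\<epsilon> / (4 * K))"
  proof
    show "continuous_on V \<Phi>" by (rule smooth_mapD(2)[OF \<Phi>_smooth])
    show "0 < \<epsilon> / (4 * K)" using \<epsilon> K by simp
    fix z z' assume z: "z \<in> V" "z' \<in> V" and eq: "\<Phi> z = \<Phi> z'"
    show "\<Phi> (w + (z' - z)) = \<Phi> w" if "w \<in> V" for w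
      unfolding \<Phi>_def linear_add[OF linear_N] using \<Phi>_eqD[OF eq] N_in \<rho>_carrier by (simp add: \<rho>_add)
    assume "norm (z - z') < 4 * (\<epsilon> / (4 * K))"
    then have "norm (z' - z) * K < \<epsilon>" using K(1) by (simp add: field_simps norm_minus_commute)
    then have "norm (N (z' - z)) < \<epsilon>" using K(2)[of "z' - z"] by linarith
    then have "N (z' - z) = 0" using \<epsilon>(2)[OF N_in] \<Phi>_eqD[OF eq] by blast
    moreover have "z' - z \<in> V" using z subspace_V by (intro subspace_diff)
    ultimately have "z' - z = 0" using \<Phi>_eqD(1)[OF eq] by (intro N_fst_zero) auto
    then show "z = z'" by simp
  qed (rule subspace_V \<Phi>_onto \<Phi>_open; assumption?)+
  then show ?thesis ..
qed

text \<open>The vector component of a vanishing differential gives \<open>fst a = 0\<close>, the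
  group component gives \<open>N a = 0\<close>, and together they force
  \<open>a = 0\<close>.\<close>

lemma \<Phi>_immersion:
  assumes d: "d \<in> cotangent_atlas \<gg> \<A>" and z: "z \<in> V" "\<Phi> z \<in> fst d" and a: "a \<in> V" "a \<noteq> 0"
  shows "dir_deriv (\<lambda>w. snd d (\<Phi> w)) z a \<noteq> 0"
proof
  assume 0: "dir_deriv (\<lambda>w. snd d (\<Phi> w)) z a = 0"
  obtain e where e: "e \<in> \<A>" "d = (fst e \<times> \<gg>, map_prod (snd e) id)"
    using d unfolding cotangent_atlas_def by (elim prod_atlasE) (auto simp: linear_atlas_def)
  have at: "topological_atlas (cotangent_bundle G \<gg>) (\<gg> \<times> \<gg>) (cotangent_atlas \<gg> \<A>)"
    unfolding cotangent_bundle_def cotangent_atlas_def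
    by (rule topological_atlas_prod[OF atlas_G smooth_atlas_topological[OF smooth_atlas_linear[OF subspace_\<gg>]]])
  let ?S = "V \<inter> \<Phi> -` fst d"
  have S: "openin (top_of_set V) ?S"
    using smooth_mapD(1,2)[OF \<Phi>_smooth] is_chartD(1)[OF topological_atlasD(2)[OF at d]]
    by (intro continuous_openin_preimage) auto
  have zS: "z \<in> ?S" using z by blast
  \<comment> \<open>A zero \<open>dir_deriv\<close> says something about the curve only once
    differentiability is known; it comes from smoothness of \<open>\<Phi>\<close>.\<close>
  obtain f' where f': "((\<lambda>w. snd d (\<Phi> w)) has_derivative f') (at z within ?S)"
    by (rule smooth_on_differentiable[OF smooth_map_from_linear[OF \<Phi>_smooth d] zS])
  have "f' a = 0" using dir_deriv_eq[OF subspace_V S zS a(1) f'] 0 by simp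
  with has_derivative_imp_line[OF subspace_V S zS a(1) f']
  have der: "((\<lambda>s. snd d (\<Phi> (z + s *\<^sub>R a))) has_vector_derivative 0) (at 0)" by simp
  note der1 = bounded_linear.has_vector_derivative[OF bounded_linear_fst der]
    and der2 = bounded_linear.has_vector_derivative[OF bounded_linear_snd der]
  have "((\<lambda>s. y + fst z + s *\<^sub>R fst a) has_vector_derivative 0) (at 0)"
    using der2 by (simp add: e(2) \<Phi>_def add.assoc)
  moreover have "((\<lambda>s. y + fst z + s *\<^sub>R fst a) has_vector_derivative fst a) (at 0)"
    by (auto intro!: derivative_eq_intros)
  ultimately have fa: "fst a = 0" by (metis vector_derivative_unique_at)
  have "((\<lambda>s. snd e (x \<otimes> \<rho> (N z + s *\<^sub>R N a))) has_vector_derivative 0) (at 0)"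
    using der1 by (simp add: e(2) \<Phi>_def linear_add[OF linear_N] linear_scale[OF linear_N])
  moreover have "x \<otimes> \<rho> (N z) \<in> fst e" using z(2) by (simp add: e(2) \<Phi>_def)
  ultimately have "N a = 0" using translate_immersion[OF x N_in N_in e(1)] by blast
  then show False using N_fst_zero[OF a(1) fa] a(2) by simp
qed

section \<open>The constant frame, the induced form and the Kaehler structure\<close>

definition leaf_frame :: "'v \<times> 'v \<Rightarrow> 'v \<times> 'v" where
  "leaf_frame a = (- (Re \<sigma> *\<^sub>R Fl (fst a) + Im \<sigma> *\<^sub>R Fl (snd a)), fst a)"

lemma \<Phi>_velocity:
  assumes a: "a \<in> V" and \<gamma>: "\<forall>\<^sub>F s in nhds 0. \<gamma> s = \<Phi> (z + s *\<^sub>R a)"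
  shows "left_velocity G c \<gamma> = leaf_frame a"
proof -
  have "left_velocity G c \<gamma> = (d\<rho> (N a), fst a)"
    by (rule left_velocity_translate[OF x N_in[of z] N_in, of _ a "y + fst z"])
      (use \<gamma> in \<open>simp add: \<Phi>_def linear_add[OF linear_N] linear_scale[OF linear_N] add.assoc\<close>)
  then show ?thesis by (simp add: d\<rho>_N[OF a] leaf_frame_def)
qed

text \<open>Self-adjointness cancels the terms with \<open>Re \<sigma>\<close>, and the bracket term
  vanishes whatever the base point \<open>p\<close> is, since both first components lie in
  \<open>\<tt>\<close>.\<close>

lemma canonical_form_leaf:
  assumes a: "a \<in> V" and b: "b \<in> V"
  shows "canonical_form G c p (leaf_frame a) (leaf_frame b)
    = Im \<sigma> * (fst a \<bullet> Fl (snd b) - snd a \<bullet> Fl (fst b))"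
proof -
  have "lie_bracket G c (- (Re \<sigma> *\<^sub>R Fl (fst a) + Im \<sigma> *\<^sub>R Fl (snd a)))
      (- (Re \<sigma> *\<^sub>R Fl (fst b) + Im \<sigma> *\<^sub>R Fl (snd b))) = 0"
    unfolding d\<rho>_N[OF a, symmetric] d\<rho>_N[OF b, symmetric] by (rule lie_bracket_torus[OF N_in N_in])
  moreover have "Fl (fst a) \<bullet> fst b = fst a \<bullet> Fl (fst b)" "Fl (snd a) \<bullet> fst b = snd a \<bullet> Fl (fst b)"
    using a b \<tt>_sub by (auto intro!: Fl_self)
  ultimately show ?thesis
    by (cases p) (simp add: canonical_form_def leaf_frame_def inner_add_left inner_add_right algebra_simps)
qed

lemma leaf_kaehler:
  obtains \<C> where
    "embedded_submanifold (cotangent_bundle G \<gg>) (cotangent_atlas \<gg> \<A>)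
       (toral_leaf G (\<rho> ` span B) \<tt> (x, y)) V \<C>"
    "\<And>d. d \<in> \<C> \<Longrightarrow> symplectic_form_on V (chart_image d) (pullback (left_velocity G c) (canonical_form G c) d)"
    "kaehler_submanifold (left_velocity G c) (cotangent_bundle G \<gg>) (cotangent_atlas \<gg> \<A>)
       (canonical_form G c) (toral_leaf G (\<rho> ` span B) \<tt> (x, y)) V \<C>"
    "\<And>d z. d \<in> \<C> \<Longrightarrow> z \<in> chart_image d \<Longrightarrow>
       holomorphic_tangent_space (left_velocity G c) V d z = toral_distribution F \<sigma> \<tt>"
    "kaehler_potential (left_velocity G c) (canonical_form G c) V \<C>
       (\<lambda>p. 2 * Im \<sigma> * quadratic_hamiltonian F p)"
proof -
  let ?L = "toral_leaf G (\<rho> ` span B) \<tt> (x, y)"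
  obtain r where cov: "translation_covering V \<Phi> ?L r" using covering by blast
  interpret cv: translation_covering V \<Phi> ?L r by (rule cov)
  let ?C = cv.covering_atlas and ?vel = "left_velocity G c" and ?\<omega> = "canonical_form G c"
  have cs: "cscale \<zeta> a \<in> V" if "a \<in> V" for \<zeta> a
    using that by (auto simp: cscale_def intro!: subspace_add[OF subspace_\<tt>] subspace_diff[OF subspace_\<tt>] subspace_scale[OF subspace_\<tt>])
  have i: "cscale \<i> a = (- snd a, fst a)" for a :: "'v \<times> 'v" by (simp add: cscale_def)
  define \<beta> where "\<beta> a b = Im \<sigma> * (fst a \<bullet> Fl (snd b) - snd a \<bullet> Fl (fst b))" for a b
  have sheet: "\<exists>q. d = cv.sheet_chart q" if "d \<in> ?C" for d using that by (auto simp: cv.covering_atlas_def)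
  have frame: "frame ?vel d z a = leaf_frame a" if d: "d \<in> ?C" and z: "z \<in> chart_image d" and a: "a \<in> V" for d z a
  proof -
    obtain q where q: "d = cv.sheet_chart q" using sheet[OF d] by blast
    have "z \<in> cv.sheet q" using z unfolding q cv.sheet_chart_image .
    show ?thesis unfolding q
      by (rule cv.sheet_frame[where X=leaf_frame]) (rule \<Phi>_velocity, assumption+, fact+)
  qed
  have pb: "pullback ?vel ?\<omega> d z a b = \<beta> a b" if "d \<in> ?C" "z \<in> chart_image d" "a \<in> V" "b \<in> V" for d z a b
    unfolding pullback_def frame[OF that(1,2,3)] frame[OF that(1,2,4)] \<beta>_def
    by (rule canonical_form_leaf[OF that(3,4)])
  have self: "u \<bullet> Fl v = v \<bullet> Fl u" if "u \<in> \<tt>" "v \<in> \<tt>" for u v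
    using Fl_self[OF subsetD[OF \<tt>_sub that(1)] subsetD[OF \<tt>_sub that(2)]]
    by (simp only: inner_commute[of "Fl u" v])
  \<comment> \<open>Applying \<open>\<i>\<close> turns the mixed pairings into the sum of the values
    of the quadratic form of \<open>F\<close> at real and imaginary part.\<close>
  have pos: "0 < \<beta> a (cscale \<i> a)" if a: "a \<in> V" "a \<noteq> 0" for a
  proof -
    have "\<beta> a (cscale \<i> a) = Im \<sigma> * (fst a \<bullet> Fl (fst a) + snd a \<bullet> Fl (snd a))"
      by (simp add: \<beta>_def i linear_neg[OF linear_Fl])
    moreover have "0 < fst a \<bullet> Fl (fst a) + snd a \<bullet> Fl (snd a)"
      using a Fl_pos[of "fst a"] Fl_pos[of "snd a"] Fl_nonneg[of "fst a"] Fl_nonneg[of "snd a"]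
      by (cases "fst a = 0"; cases "snd a = 0") (auto simp: prod_eq_iff)
    ultimately show ?thesis using \<sigma> by simp
  qed
  have emb: "embedded_submanifold (cotangent_bundle G \<gg>) (cotangent_atlas \<gg> \<A>) ?L V ?C"
  proof (rule cv.embedded_covering_atlas[OF _ \<Phi>_smooth \<Phi>_immersion])
    show "topological_atlas (cotangent_bundle G \<gg>) (\<gg> \<times> \<gg>) (cotangent_atlas \<gg> \<A>)"
      unfolding cotangent_bundle_def cotangent_atlas_def
      by (rule topological_atlas_prod[OF atlas_G smooth_atlas_topological[OF smooth_atlas_linear[OF subspace_\<gg>]]])
  qed
  have imV: "openin (top_of_set V) (chart_image d)" if "d \<in> ?C" for d
    using sheet[OF that] is_chartD(2)[OF cv.is_chart_sheet] by blast
  have sym: "symplectic_form_on V (chart_image d) (pullback ?vel ?\<omega> d)" if d: "d \<in> ?C" for d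
  proof (rule constant_symplectic_form[where \<beta>=\<beta>, OF subspace_V imV[OF d] pb[OF d]])
    fix a b assume ab: "a \<in> V" "b \<in> V"
    show "\<beta> b a = - \<beta> a b" using ab self by (auto simp: \<beta>_def algebra_simps)
    show "\<beta> a (b + b') = \<beta> a b + \<beta> a b'" for b'
      by (simp add: \<beta>_def linear_add[OF linear_Fl] inner_add_right algebra_simps)
    show "\<beta> a (r *\<^sub>R b) = r * \<beta> a b" for r
      by (simp add: \<beta>_def linear_scale[OF linear_Fl] algebra_simps)
  next
    show "\<exists>b\<in>V. \<beta> a b \<noteq> 0" if "a \<in> V" "a \<noteq> 0" for a
      using pos[OF that] cs[OF that(1), of \<i>] by force
  qed
  have kae: "kaehler_submanifold ?vel (cotangent_bundle G \<gg>) (cotangent_atlas \<gg> \<A>) ?\<omega> ?L V ?C"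
    unfolding kaehler_submanifold_def
  proof (intro conjI ballI impI)
    show "holomorphic_atlas ?L V ?C" by (rule holomorphic_covering_atlas[OF cov cs])
    fix d z a assume dza: "d \<in> ?C" "z \<in> chart_image d" "a \<in> V"
    show "0 < pullback ?vel ?\<omega> d z a (cscale \<i> a)" if "a \<noteq> 0"
      using pos[OF dza(3) that] pb[OF dza cs[OF dza(3)]] by simp
    fix b assume b: "b \<in> V"
    have "\<beta> (cscale \<i> a) (cscale \<i> b) = \<beta> a b"
      by (simp add: \<beta>_def i linear_neg[OF linear_Fl] algebra_simps)
    then show "pullback ?vel ?\<omega> d z (cscale \<i> a) (cscale \<i> b) = pullback ?vel ?\<omega> d z a b"
      using pb[OF dza b] pb[OF dza(1,2) cs[OF dza(3)] cs[OF b]] by simp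
  qed (rule emb sym; assumption?)+
  have hol: "holomorphic_tangent_space ?vel V d z = toral_distribution F \<sigma> \<tt>"
    if dz: "d \<in> ?C" "z \<in> chart_image d" for d z
  proof -
    \<comment> \<open>The coordinate vector \<open>a\<close> is itself the parameter
      \<open>A\<close> of the distribution.\<close>
    have eq: "(frame ?vel d z a, - frame ?vel d z (cscale \<i> a)) =
        ((fst (cscale (- cnj \<sigma>) (map_prod F F a)), fst a), (snd (cscale (- cnj \<sigma>) (map_prod F F a)), snd a))"
      if a: "a \<in> V" for a
    proof -
      have "F (fst a) = Fl (fst a)" "F (snd a) = Fl (snd a)" using a \<tt>_sub Fl(2) by auto
      then show ?thesis
        unfolding frame[OF dz a] frame[OF dz cs[OF a]]
        by (simp add: leaf_frame_def i cscale_def linear_neg[OF linear_Fl] algebra_simps)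
    qed
    show ?thesis unfolding holomorphic_tangent_space_def toral_distribution_def
    proof (intro equalityI subsetI)
      fix p assume "p \<in> {(frame ?vel d z a, - frame ?vel d z (cscale \<i> a)) | a. a \<in> V}"
      then obtain a where a: "a \<in> V" "p = (frame ?vel d z a, - frame ?vel d z (cscale \<i> a))" by blast
      show "p \<in> {((fst w, fst A), (snd w, snd A)) | w A. A \<in> V \<and> w = cscale (- cnj \<sigma>) (map_prod F F A)}"
        unfolding a(2) eq[OF a(1)] using a(1) by blast
    next
      fix p assume "p \<in> {((fst w, fst A), (snd w, snd A)) | w A. A \<in> V \<and> w = cscale (- cnj \<sigma>) (map_prod F F A)}"
      then obtain a where a: "a \<in> V" "p = ((fst (cscale (- cnj \<sigma>) (map_prod F F a)), fst a),
          (snd (cscale (- cnj \<sigma>) (map_prod F F a)), snd a))" by blast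
      show "p \<in> {(frame ?vel d z a, - frame ?vel d z (cscale \<i> a)) | a. a \<in> V}"
        unfolding a(2) eq[OF a(1), symmetric] using a(1) by blast
    qed
  qed
  have pot: "kaehler_potential ?vel ?\<omega> V ?C (\<lambda>p. 2 * Im \<sigma> * quadratic_hamiltonian F p)"
    unfolding kaehler_potential_def
  proof (intro ballI conjI)
    fix d assume d: "d \<in> ?C"
    obtain q where q: "d = cv.sheet_chart q" using sheet[OF d] by blast
    \<comment> \<open>The factor 2 cancels the 1/2 of the Hamiltonian, and \<open>F\<close> may be
      exchanged for \<open>Fl\<close> because \<open>y + fst w\<close> lies in
      \<open>\<gg>\<close>.\<close>
    have val: "2 * Im \<sigma> * quadratic_hamiltonian F (chart_inv d w) = Im \<sigma> * ((y + fst w) \<bullet> Fl (y + fst w))"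
      if w: "w \<in> chart_image d" for w
    proof -
      have "w \<in> cv.sheet q" using w q cv.sheet_chart_image by simp
      moreover have "y + fst w \<in> \<gg>"
        using \<open>w \<in> cv.sheet q\<close> \<tt>_sub
        by (auto simp: cv.sheet_def intro!: subspace_add[OF subspace_\<gg> y])
      ultimately show ?thesis
        by (simp add: q cv.sheet_chart_inv \<Phi>_def quadratic_hamiltonian_def Fl(2))
    qed
    have "smooth_on V (chart_image d) (\<lambda>w. Im \<sigma> * ((y + fst w) \<bullet> Fl (y + fst w)))"
    proof (rule smooth_on_linear_compose[OF bounded_linear_mult_right],
        rule smooth_on_bilinear[OF bounded_bilinear_inner _ smooth_on_linear_compose[OF Fl(1)]])
      show "smooth_on V (chart_image d) (\<lambda>w. y + fst w)"
        by (intro smooth_on_add smooth_on_const smooth_on_linear bounded_linear_fst)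
      then show "smooth_on V (chart_image d) (\<lambda>w. y + fst w)" .
    qed
    moreover have "smooth_on V (chart_image d) ((\<lambda>p. 2 * Im \<sigma> * quadratic_hamiltonian F p) \<circ> chart_inv d) \<longleftrightarrow>
        smooth_on V (chart_image d) (\<lambda>w. Im \<sigma> * ((y + fst w) \<bullet> Fl (y + fst w)))"
      by (rule smooth_on_cong) (simp only: comp_def val)
    ultimately show "smooth_on V (chart_image d) ((\<lambda>p. 2 * Im \<sigma> * quadratic_hamiltonian F p) \<circ> chart_inv d)"
      by blast
    fix z a b assume zab: "z \<in> chart_image d" "a \<in> V" "b \<in> V"
    \<comment> \<open>The potential lemma is applied with \<open>\<gg>\<close> in the role of
      \<open>E\<close>, as \<open>y\<close> need not belong to \<open>\<tt>\<close>.\<close>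
    have fstV: "fst ` V \<subseteq> \<gg>" using \<tt>_sub by auto
    have "\<i> * d_dbar (\<lambda>w. complex_of_real (2 * Im \<sigma> * quadratic_hamiltonian F (chart_inv d w))) z a b
        = complex_of_real (Im \<sigma> * (fst a \<bullet> Fl (snd b) - snd a \<bullet> Fl (fst b)))"
    proof (rule potential_d_dbar[where E=\<gg> and y=y, OF subspace_V imV[OF d] _ Fl(1) _ subspace_\<gg> y fstV _ zab])
      fix w assume "w \<in> chart_image d"
      then show "complex_of_real (2 * Im \<sigma> * quadratic_hamiltonian F (chart_inv d w)) =
          complex_of_real (Im \<sigma> * ((y + fst w) \<bullet> Fl (y + fst w)))"
        by (simp only: val)
    qed (rule cs Fl_self; assumption)+
    then show "complex_of_real (pullback ?vel ?\<omega> d z a b) =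
        \<i> * d_dbar (\<lambda>w. complex_of_real (2 * Im \<sigma> * quadratic_hamiltonian F (chart_inv d w))) z a b"
      using pb[OF d zab] by (simp add: \<beta>_def)
  qed
  show ?thesis by (rule that[OF emb sym kae hol pot])
qed

end

theorem theorem3p8:
  fixes G :: "'g::t2_space monoid" and \<gg> \<tt> :: "'v::euclidean_space set"
    and \<A> :: "('g, 'v) chart set" and c :: "('g, 'v) chart"
    and T :: "'g set" and F :: "'v \<Rightarrow> 'v" and \<sigma> :: complex and x :: 'g and y :: 'v
  assumes "lie_group G \<gg> \<A>" and "compact (carrier G)" and "connected (carrier G)"
    and "c \<in> \<A>" and "\<one>\<^bsub>G\<^esub> \<in> fst c"
    and "Ad_invariant G \<gg> c"
    and "maximal_torus G \<A> T" and "\<tt> = subgroup_lie_algebra G \<A> c T"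
    and "\<And>u v. u \<in> \<gg> \<Longrightarrow> v \<in> \<gg> \<Longrightarrow> F (u + v) = F u + F v"
    and "\<And>r v. v \<in> \<gg> \<Longrightarrow> F (r *\<^sub>R v) = r *\<^sub>R F v"
    and "\<And>u v. u \<in> \<gg> \<Longrightarrow> v \<in> \<gg> \<Longrightarrow> F u \<bullet> v = u \<bullet> F v"
    and "F ` \<gg> \<subseteq> \<tt>"
    and "\<And>v. v \<in> \<gg> \<Longrightarrow> (\<And>u. u \<in> \<tt> \<Longrightarrow> u \<bullet> v = 0) \<Longrightarrow> F v = 0"
    and "\<And>u. u \<in> \<tt> \<Longrightarrow> u \<noteq> 0 \<Longrightarrow> 0 < u \<bullet> F u"
    and "0 < Im \<sigma>"
    and "(x, y) \<in> cotangent_bundle G \<gg>"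
  shows "symplectic_submanifold (left_velocity G c) (cotangent_bundle G \<gg>) (cotangent_atlas \<gg> \<A>)
           (canonical_form G c) (toral_leaf G T \<tt> (x, y))
       \<and> (\<exists>(V::('v \<times> 'v) set) \<C>.
           kaehler_submanifold (left_velocity G c) (cotangent_bundle G \<gg>) (cotangent_atlas \<gg> \<A>)
             (canonical_form G c) (toral_leaf G T \<tt> (x, y)) V \<C>
         \<and> (\<forall>d\<in>\<C>. \<forall>z\<in>chart_image d.
             holomorphic_tangent_space (left_velocity G c) V d z = toral_distribution F \<sigma> \<tt>)
         \<and> kaehler_potential (left_velocity G c) (canonical_form G c) V \<C>
             (\<lambda>p. 2 * Im \<sigma> * quadratic_hamiltonian F p))"
proof -
  obtain B :: "'v set" and \<rho> where \<rho>: "independent B"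
    "smooth_map (span B) (span B) (linear_atlas (span B)) (carrier G) \<A> \<rho>"
    "\<forall>u\<in>span B. \<forall>w\<in>span B. \<rho> (u + w) = \<rho> u \<otimes>\<^bsub>G\<^esub> \<rho> w"
    "{w \<in> span B. \<rho> w = \<one>\<^bsub>G\<^esub>} = {(\<Sum>b\<in>B. of_int (n b) *\<^sub>R b) | n. True}"
    and T: "\<rho> ` span B = T"
    using assms(7) unfolding maximal_torus_def torus_def by blast
  interpret tor: lie_group_torus G \<gg> \<A> c B \<rho>
    using assms(1,4,5) \<rho> by unfold_locales auto
  \<comment> \<open>\<open>F\<close> is linear on \<open>\<gg>\<close> only and arbitrary elsewhere;
    differentiation in the ambient space uses a linear extension.\<close>
  obtain Fl where Fl: "bounded_linear Fl" "\<And>v. v \<in> \<gg> \<Longrightarrow> Fl v = F v"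
    using linear_extension_from_subspace[of \<gg> F] tor.subspace_\<gg> assms(9,10) by metis
  have \<tt>: "\<tt> = tor.d\<rho> ` span B" unfolding assms(8) T[symmetric] by (rule tor.lie_algebra_eq)
  interpret leaf: toral_leaf_param G \<gg> \<A> c B \<rho> F Fl \<sigma> x y \<tt>
  proof (rule toral_leaf_param.intro[OF tor.lie_group_torus_axioms], rule toral_leaf_param_axioms.intro)
    show "x \<in> carrier G" "y \<in> \<gg>" using assms(16) by (auto simp: cotangent_bundle_def)
  qed (fact \<tt> Fl assms)+
  obtain \<C> where "embedded_submanifold (cotangent_bundle G \<gg>) (cotangent_atlas \<gg> \<A>) (toral_leaf G T \<tt> (x, y)) (\<tt> \<times> \<tt>) \<C>"
    "\<And>d. d \<in> \<C> \<Longrightarrow> symplectic_form_on (\<tt> \<times> \<tt>) (chart_image d) (pullback (left_velocity G c) (canonical_form G c) d)"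
    "kaehler_submanifold (left_velocity G c) (cotangent_bundle G \<gg>) (cotangent_atlas \<gg> \<A>)
       (canonical_form G c) (toral_leaf G T \<tt> (x, y)) (\<tt> \<times> \<tt>) \<C>"
    "\<And>d z. d \<in> \<C> \<Longrightarrow> z \<in> chart_image d \<Longrightarrow>
       holomorphic_tangent_space (left_velocity G c) (\<tt> \<times> \<tt>) d z = toral_distribution F \<sigma> \<tt>"
    "kaehler_potential (left_velocity G c) (canonical_form G c) (\<tt> \<times> \<tt>) \<C>
       (\<lambda>p. 2 * Im \<sigma> * quadratic_hamiltonian F p)"
    using leaf.leaf_kaehler unfolding T by metis
  \<comment> \<open>The holomorphic atlas also witnesses the symplectic claim: its model space
    \<open>\<tt> \<times> \<tt>\<close> lies in the product type of the ambient charts, as required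
    there.\<close>
  then show ?thesis unfolding symplectic_submanifold_def by blast
qed

end
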